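(* Let $f:\Pi\to\mathbb{R}$ be a cone-additive function. Assume that $G(o,o|z)=\sum_{n\ge0}\mathbb{P}[X_n=o]z^n$ has radius of convergence strictly bigger than $1$. Let $\mathcal{R}>1$ be a real number with $\sup_{k\in\mathbb{N}}\mathbb{E}\bigl[\mathcal{R}^{\mathrm{length}(\psi_k)}\bigr]<\infty$, and assume that there exist constants $C\in(0,\infty)$ and $R_f\in(0,\mathcal{R})$ such that $$|f(\pi)|\le C\cdot R_f^{\mathrm{length}(\pi)}\quad\text{for all }\pi\in\Pi.$$ Then there exists a constant $\mathfrak{c}\in\mathbb{R}$ such that $$\lim_{n\to\infty}\frac1n f\bigl([X_0,\ldots,X_n]\bigr)=\mathfrak{c}\quad\text{almost surely.}$$ Moreover, if $f$ is strictly positive, then $\mathfrak{c}>0$.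
   Context: Notation: $\mathbb{N}=\{1,2,\dots\}$, $\mathbb{N}_0=\mathbb{N}\cup\{0\}$. Free product. Let $V_1,V_2$ be disjoint finite or countable sets with $|V_i|\ge 2$, not both of cardinality $2$, with distinguished elements (roots) $o_i\in V_i$; put $V_i^\times=V_i\setminus\{o_i\}$. For $i\in\{1,2\}$ let $P_i=(p_i(x,y))_{x,y\in V_i}$ be a transition matrix on $V_i$ with $p_i(x,x)=0$ for all $x\in V_i$ and such that for every $x\in V_i$ there is $n_x\in\mathbb{N}$ with $p_i^{(n_x)}(o_i,x)>0$ ($p_i^{(n)}$ denotes $n$-step transition probabilities). The free product $V=V_1*V_2$ is the set of all finite words $v_1\dots v_n$, $n\in\mathbb{N}$, with letters in $V_1^\times\cup V_2^\times$ such that no two consecutive letters lie in the same $V_i^\times$, together with the empty word $o$; both $o_1,o_2$ are identified with $o$, so $V_i\subset V$. Word length: $\|v_1\dots v_n\|=n$, $\|o\|=0$. Type: $\delta(v_1\dots v_n)=i$ if $v_n\in V_i^\times$ ($o$ has no type). Words are concatenated whenever the result lies in $V$, with $uo=ou=u$. Random walk. Fix $\alpha\in(0,1)$. Put $\bar p_i(uv,uw)=p_i(v,w)$ for $u\in V$ with $\delta(u)\ne i$ ($u=o$ allowed) and $v,w\in V_i$, and $\bar p_i(x,y)=0$ otherwise. Let $P=\alpha\bar P_1+(1-\alpha)\bar P_2=(p(x,y))_{x,y\in V}$, and let $(X_n)_{n\in\mathbb{N}_0}$ be the Markov chain on $V$ with transition matrix $P$ and $X_0=o$. Let $\mathcal{X}$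 be the directed graph on $V$ with an edge from $x$ to $y$ iff $p(x,y)>0$. A path is a finite sequence $[v_0,\dots,v_n]$, $n\in\mathbb{N}_0$, with an edge from $v_{i-1}$ to $v_i$ for each $i$; its length is $n$. $\Pi$ is the set of all finite paths. The cone $C(x)$ is the set of all words in $V$ with prefix $x$; $C(o)=V$. If $G(o,o|z)$ has radius of convergence $>1$, the walk is transient and $\|X_n\|\to\infty$ almost surely. Restrictions. For a path $\pi=[u_0,\dots,u_m]$ and $A\subseteq V$ containing some $u_\ell$, let $\pi|_A=[x_0,\dots,x_\kappa]$, where $x_0=u_{i_0}$ with $i_0=\inf\{\ell: u_\ell\in A\}$ and $x_j=u_{i_j}$ with $i_j=\inf\{\ell>i_{j-1}: u_\ell\in A\setminus\{x_{j-1}\}\}$, as long as such an index exists (delete vertices outside $A$, then collapse successive repetitions). For $v\in V$, $\pi|_{C(v)}$ is this with $A=C(v)$, and $\pi|_{\neg C(v)}$ is this with $A=V\setminus(C(v)\setminus\{v\})$. If all vertices of $\pi=[vw_0,\dots,vw_m]$ lie in $C(v)$, then $v^{-1}\pi=[w_0,\dots,w_m]$. Final cone entry times. $\mathbf{e}_0=0$ and, for $k\in\mathbb{N}$, $\mathbf{e}_k=\inf\{\ell\in\mathbb{N}: \|X_\ell\|=k,\ X_i\in C(X_\ell)\text{ for all } i\ge\ell\}$ (almost surely finite). $\mathbf{k}(n)=\max\{k\in\mathbb{N}_0:\mathbf{e}_k\le n\}$. For $k\in\mathbb{N}$, $\pi_k=\bigl([X_0,\dots,X_{\mathbf{e}_k}]|_{C(X_{\mathbf{e}_{k-1}})}\bigr)\big|_{\neg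 C(X_{\mathbf{e}_k})}$, and $\pi_n^\ast=[X_0,\dots,X_n]|_{C(X_{\mathbf{e}_{\mathbf{k}(n)}})}$ for $n\in\mathbb{N}$. Cone-additivity. $f:\Pi\to\mathbb{R}$ is cone-additive (w.r.t. $P$) if (i) for all $n\in\mathbb{N}$, $f([X_0,\dots,X_n])=\sum_{j=1}^{\mathbf{k}(n)}f(\pi_j)+f(\pi_n^\ast)$ almost surely; and (ii) for all $j\in\mathbb{N}$, $f(\pi_j)=f(X_{\mathbf{e}_{j-1}}^{-1}\pi_j)$. The paths $\psi_k$. For $i\in\{1,2\}$ let $V_i^\ast$ be the set of words in $V$ starting with a letter of $V_i^\times$, together with $o$. Put $\psi_1=[X_0,\dots,X_{\mathbf{e}_1}]|_{V^\ast_{\delta(X_{\mathbf{e}_1})}}$ and, for $k\ge2$, $\psi_k=X_{\mathbf{e}_{k-1}}^{-1}\bigl([X_0,\dots,X_{\mathbf{e}_k}]|_{C(X_{\mathbf{e}_{k-1}})}\bigr)$. (A number $\mathcal{R}>1$ as in the claim exists when $G(o,o|z)$ has radius of convergence $>1$.) *)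

theory Defs
  imports "HOL-Probability.Probability"
begin

section \<open>Free products\<close>

(* The two factors V_1, V_2 are the sets "verts F 1" and "verts F 2"; only the indices 1 and 2,
   and only transition probabilities between elements of "verts F i", are ever used. *)
record 'a free_factors =
  verts :: "nat \<Rightarrow> 'a set"
  root :: "nat \<Rightarrow> 'a"
  ptrans :: "nat \<Rightarrow> 'a \<Rightarrow> 'a \<Rightarrow> real"

fun nstep :: "'s set \<Rightarrow> ('s \<Rightarrow> 's \<Rightarrow> real) \<Rightarrow> nat \<Rightarrow> 's \<Rightarrow> 's \<Rightarrow> real" where
  "nstep S p 0 x y = (if x = y then 1 else 0)"
| "nstep S p (Suc n) x y = (\<Sum>\<^sub>\<infinity>z\<in>S. p x z * nstep S p n z y)"

definition transition_matrix :: "'s set \<Rightarrow> ('s \<Rightarrow> 's \<Rightarrow> real) \<Rightarrow> bool" where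
  "transition_matrix S p \<longleftrightarrow>
     (\<forall>x\<in>S. \<forall>y\<in>S. 0 \<le> p x y) \<and> (\<forall>x\<in>S. (p x has_sum 1) S)"

definition free_factors_valid :: "'a free_factors \<Rightarrow> bool" where
  "free_factors_valid F \<longleftrightarrow>
     verts F 1 \<inter> verts F 2 = {} \<and>
     \<not> (card (verts F 1) = 2 \<and> card (verts F 2) = 2) \<and>
     (\<forall>i\<in>{1, 2}.
        countable (verts F i) \<and>
        (infinite (verts F i) \<or> 2 \<le> card (verts F i)) \<and>
        root F i \<in> verts F i \<and>
        transition_matrix (verts F i) (ptrans F i) \<and>
        (\<forall>x\<in>verts F i. ptrans F i x x = 0) \<and>
        (\<forall>x\<in>verts F i. \<exists>n\<ge>1. nstep (verts F i) (ptrans F i) n (root F i) x > 0))"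

definition letters :: "'a free_factors \<Rightarrow> nat \<Rightarrow> 'a set" where
  "letters F i = verts F i - {root F i}"

definition free_words :: "'a free_factors \<Rightarrow> 'a list set" where
  "free_words F = {w. set w \<subseteq> letters F 1 \<union> letters F 2 \<and>
     successively (\<lambda>x y. \<not> (\<exists>i\<in>{1, 2}. x \<in> letters F i \<and> y \<in> letters F i)) w}"

(* The identification of V_i with a subset of the free product: both roots become the empty word. *)
definition embed :: "'a free_factors \<Rightarrow> nat \<Rightarrow> 'a \<Rightarrow> 'a list" where
  "embed F i v = (if v = root F i then [] else [v])"

(* The empty word has no type; it gets the value 0, which differs from both indices. *)
definition word_type :: "'a free_factors \<Rightarrow> 'a list \<Rightarrow> nat" where
  "word_type F w = (if w = [] then 0 else if last w \<in> letters F 1 then 1 else 2)"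

(* Every word x is uniquely u @ embed F i v with word_type F u \<noteq> i and v in V_i;
   base_part gives u and factor_part gives v. *)
definition base_part :: "'a free_factors \<Rightarrow> nat \<Rightarrow> 'a list \<Rightarrow> 'a list" where
  "base_part F i x = (if word_type F x = i then butlast x else x)"

definition factor_part :: "'a free_factors \<Rightarrow> nat \<Rightarrow> 'a list \<Rightarrow> 'a" where
  "factor_part F i x = (if word_type F x = i then last x else root F i)"

(* The lemmas lifted_trans_concat and lifted_trans_eq_0 below give the usual description. *)
definition lifted_trans :: "'a free_factors \<Rightarrow> nat \<Rightarrow> 'a list \<Rightarrow> 'a list \<Rightarrow> real" where
  "lifted_trans F i x y =
     (if x \<in> free_words F \<and> y \<in> free_words F \<and> base_part F i x = base_part F i y
      then ptrans F i (factor_part F i x) (factor_part F i y) else 0)"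

definition free_trans :: "'a free_factors \<Rightarrow> real \<Rightarrow> 'a list \<Rightarrow> 'a list \<Rightarrow> real" where
  "free_trans F \<alpha> x y = \<alpha> * lifted_trans F 1 x y + (1 - \<alpha>) * lifted_trans F 2 x y"

definition cone :: "'a free_factors \<Rightarrow> 'a list \<Rightarrow> 'a list set" where
  "cone F x = {y \<in> free_words F. \<exists>w. y = x @ w}"

definition cone_compl :: "'a free_factors \<Rightarrow> 'a list \<Rightarrow> 'a list set" where
  "cone_compl F x = free_words F - (cone F x - {x})"

definition start_words :: "'a free_factors \<Rightarrow> nat \<Rightarrow> 'a list set" where
  "start_words F i = {w \<in> free_words F. w = [] \<or> hd w \<in> letters F i}"

subsection \<open>The lifted transition probabilities\<close>

lemma embed_in_free_words:
  assumes F: "free_factors_valid F" and i: "i \<in> {1, 2}"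
    and u: "u \<in> free_words F" "word_type F u \<noteq> i" and v: "v \<in> verts F i"
  shows "u @ embed F i v \<in> free_words F"
    and "base_part F i (u @ embed F i v) = u"
    and "factor_part F i (u @ embed F i v) = v"
proof -
  have disj: "letters F 1 \<inter> letters F 2 = {}"
    using F by (auto simp: free_factors_valid_def letters_def)
  have lst: "last u \<notin> letters F i" if "u \<noteq> []"
  proof -
    have "last u \<in> letters F 1 \<union> letters F 2"
      using u(1) last_in_set[OF that] unfolding free_words_def by blast
    then show ?thesis using u(2) i that disj
      unfolding word_type_def by (metis disjoint_iff insertE singletonD UnE)
  qed
  have v': "v \<in> letters F i" if "v \<noteq> root F i"
    using v that by (simp add: letters_def)
  have wt: "word_type F (u @ [v]) = i" if "v \<noteq> root F i"
    using v'[OF that] i disj by (auto simp: word_type_def)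
  show "u @ embed F i v \<in> free_words F"
  proof (cases "v = root F i")
    case False
    then show ?thesis using u(1) lst v'[OF False] i disj
      by (auto simp: embed_def free_words_def successively_append_iff)
  qed (use u in \<open>simp add: embed_def\<close>)
  show "base_part F i (u @ embed F i v) = u" "factor_part F i (u @ embed F i v) = v"
    using u(2) wt by (auto simp: embed_def base_part_def factor_part_def)
qed

lemma lifted_trans_concat:
  assumes "free_factors_valid F" "i \<in> {1, 2}" "u \<in> free_words F" "word_type F u \<noteq> i"
    and "v \<in> verts F i" "w \<in> verts F i"
  shows "lifted_trans F i (u @ embed F i v) (u @ embed F i w) = ptrans F i v w"
  using embed_in_free_words[OF assms(1-5)] embed_in_free_words[OF assms(1-4,6)]
  by (simp add: lifted_trans_def)

lemma free_word_decomp: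
  assumes F: "free_factors_valid F" and i: "i \<in> {1, 2}" and x: "x \<in> free_words F"
  shows "base_part F i x \<in> free_words F" "word_type F (base_part F i x) \<noteq> i"
    "factor_part F i x \<in> verts F i"
    "x = base_part F i x @ embed F i (factor_part F i x)"
proof -
  have disj: "letters F 1 \<inter> letters F 2 = {}" and r: "root F i \<in> verts F i"
    using F i by (auto simp: free_factors_valid_def letters_def)
  have "base_part F i x \<in> free_words F \<and> word_type F (base_part F i x) \<noteq> i \<and>
    factor_part F i x \<in> verts F i \<and> x = base_part F i x @ embed F i (factor_part F i x)"
  proof (cases "word_type F x = i")
    case False
    then show ?thesis using x r by (simp add: base_part_def factor_part_def embed_def)
  next
    case True
    then have ne: "x \<noteq> []" using i by (auto simp: word_type_def)
    then obtain u v where xu: "x = u @ [v]" by (metis rev_exhaust)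
    have v: "v \<in> letters F i"
      using True i x xu by (auto simp: word_type_def free_words_def split: if_splits)
    have "u \<in> free_words F" using x xu by (auto simp: free_words_def successively_append_iff)
    moreover have "word_type F u \<noteq> i"
    proof
      assume t: "word_type F u = i"
      then have une: "u \<noteq> []" using i by (auto simp: word_type_def)
      have "last u \<in> letters F 1 \<union> letters F 2"
        using x xu last_in_set[OF une] by (auto simp: free_words_def)
      then have "last u \<in> letters F i"
        using t i une unfolding word_type_def by (auto split: if_splits)
      then show False using x xu v une i by (auto simp: free_words_def successively_append_iff)
    qed
    ultimately show ?thesis using True xu v
      by (auto simp: base_part_def factor_part_def embed_def letters_def)
  qed
  then show "base_part F i x \<in> free_words F" "word_type F (base_part F i x) \<noteq> i"
    "factor_part F i x \<in> verts F i"
    "x = base_part F i x @ embed F i (factor_part F i x)" by blast+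
qed

lemma lifted_trans_eq_0:
  assumes "free_factors_valid F" "i \<in> {1, 2}"
    and "\<not> (\<exists>u v w. u \<in> free_words F \<and> word_type F u \<noteq> i \<and> v \<in> verts F i \<and> w \<in> verts F i \<and>
               x = u @ embed F i v \<and> y = u @ embed F i w)"
  shows "lifted_trans F i x y = 0"
  using assms(3) free_word_decomp[OF assms(1,2), of x] free_word_decomp[OF assms(1,2), of y]
  unfolding lifted_trans_def by (metis (no_types, lifting))

section \<open>Paths\<close>

definition paths :: "'a free_factors \<Rightarrow> real \<Rightarrow> 'a list list set" where
  "paths F \<alpha> = {\<pi>. \<pi> \<noteq> [] \<and> set \<pi> \<subseteq> free_words F \<and>
     successively (\<lambda>x y. free_trans F \<alpha> x y > 0) \<pi>}"

(* Number of edges, i.e. one less than the number of vertices. *)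
definition path_length :: "'b list \<Rightarrow> nat" where
  "path_length \<pi> = length \<pi> - 1"

definition restrict_path :: "'b list \<Rightarrow> 'b set \<Rightarrow> 'b list" where
  "restrict_path \<pi> A = remdups_adj (filter (\<lambda>x. x \<in> A) \<pi>)"

(* Left cancellation of v; meaningful for paths inside the cone of v. *)
definition unprefix_path :: "'a list \<Rightarrow> 'a list list \<Rightarrow> 'a list list" where
  "unprefix_path v \<pi> = map (drop (length v)) \<pi>"

section \<open>The random walk\<close>

definition markov_chain ::
  "'w measure \<Rightarrow> 's set \<Rightarrow> ('s \<Rightarrow> 's \<Rightarrow> real) \<Rightarrow> 's \<Rightarrow> (nat \<Rightarrow> 'w \<Rightarrow> 's) \<Rightarrow> bool" where
  "markov_chain M S p s X \<longleftrightarrow>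
     prob_space M \<and>
     (\<forall>n. X n \<in> measurable M (count_space S)) \<and>
     (AE \<omega> in M. X 0 \<omega> = s) \<and>
     (\<forall>n xs y. y \<in> S \<and> \<P>(\<omega> in M. \<forall>i\<le>n. X i \<omega> = xs i) > 0 \<longrightarrow>
        \<P>(\<omega> in M. X (Suc n) \<omega> = y \<bar> \<forall>i\<le>n. X i \<omega> = xs i) = p (xs n) y)"

definition traj :: "(nat \<Rightarrow> 'w \<Rightarrow> 's) \<Rightarrow> nat \<Rightarrow> 'w \<Rightarrow> 's list" where
  "traj X n \<omega> = map (\<lambda>i. X i \<omega>) [0..<Suc n]"

(* The infimum of the empty set is \<infinity>. *)
definition exit_time ::
  "'a free_factors \<Rightarrow> (nat \<Rightarrow> 'w \<Rightarrow> 'a list) \<Rightarrow> nat \<Rightarrow> 'w \<Rightarrow> enat" where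
  "exit_time F X k \<omega> =
     (if k = 0 then 0
      else Inf (enat ` {l. l \<ge> 1 \<and> length (X l \<omega>) = k \<and> (\<forall>i\<ge>l. X i \<omega> \<in> cone F (X l \<omega>))}))"

(* The next two definitions are meaningful where the final entry time is finite, which is almost
   surely the case for the transient walks considered; the_enat is arbitrary at \<infinity>. *)
definition exit_pt :: "'a free_factors \<Rightarrow> (nat \<Rightarrow> 'w \<Rightarrow> 'a list) \<Rightarrow> nat \<Rightarrow> 'w \<Rightarrow> 'a list" where
  "exit_pt F X k \<omega> = X (the_enat (exit_time F X k \<omega>)) \<omega>"

definition exit_traj :: "'a free_factors \<Rightarrow> (nat \<Rightarrow> 'w \<Rightarrow> 'a list) \<Rightarrow> nat \<Rightarrow> 'w \<Rightarrow> 'a list list" where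
  "exit_traj F X k \<omega> = traj X (the_enat (exit_time F X k \<omega>)) \<omega>"

definition last_exit :: "'a free_factors \<Rightarrow> (nat \<Rightarrow> 'w \<Rightarrow> 'a list) \<Rightarrow> nat \<Rightarrow> 'w \<Rightarrow> nat" where
  "last_exit F X n \<omega> = Max {k. exit_time F X k \<omega> \<le> enat n}"

definition path_piece :: "'a free_factors \<Rightarrow> (nat \<Rightarrow> 'w \<Rightarrow> 'a list) \<Rightarrow> nat \<Rightarrow> 'w \<Rightarrow> 'a list list" where
  "path_piece F X k \<omega> =
     restrict_path
       (restrict_path (exit_traj F X k \<omega>) (cone F (exit_pt F X (k - 1) \<omega>)))
       (cone_compl F (exit_pt F X k \<omega>))"

definition path_rest :: "'a free_factors \<Rightarrow> (nat \<Rightarrow> 'w \<Rightarrow> 'a list) \<Rightarrow> nat \<Rightarrow> 'w \<Rightarrow> 'a list list" where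
  "path_rest F X n \<omega> =
     restrict_path (traj X n \<omega>) (cone F (exit_pt F X (last_exit F X n \<omega>) \<omega>))"

definition psi :: "'a free_factors \<Rightarrow> (nat \<Rightarrow> 'w \<Rightarrow> 'a list) \<Rightarrow> nat \<Rightarrow> 'w \<Rightarrow> 'a list list" where
  "psi F X k \<omega> =
     (if k = 1
      then restrict_path (exit_traj F X 1 \<omega>) (start_words F (word_type F (exit_pt F X 1 \<omega>)))
      else unprefix_path (exit_pt F X (k - 1) \<omega>)
             (restrict_path (exit_traj F X k \<omega>) (cone F (exit_pt F X (k - 1) \<omega>))))"

(* Functions on paths are total functions on lists of words, only evaluated on paths. *)
definition cone_additive ::
  "'a free_factors \<Rightarrow> 'w measure \<Rightarrow> (nat \<Rightarrow> 'w \<Rightarrow> 'a list) \<Rightarrow> ('a list list \<Rightarrow> real) \<Rightarrow> bool" where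
  "cone_additive F M X f \<longleftrightarrow>
     (\<forall>n\<ge>1. AE \<omega> in M. f (traj X n \<omega>) =
        (\<Sum>j = 1..last_exit F X n \<omega>. f (path_piece F X j \<omega>)) + f (path_rest F X n \<omega>)) \<and>
     (\<forall>j\<ge>1. AE \<omega> in M.
        f (path_piece F X j \<omega>) = f (unprefix_path (exit_pt F X (j - 1) \<omega>) (path_piece F X j \<omega>)))"

end

theory Submission
  imports Defs "HOL-Library.Sublist"
begin

text \<open>
  Write $e_k$ for the final cone entry times.  The theorem is a strong law of large numbers for the
  summands $f(\pi_k)$, divided by a strong law for the increments of $e_k$.  The work lies in finding
  enough independence.

  \<^emph>\<open>Segments.\<close>  Inside a cone the transition probabilities depend on the root of the cone only through
  its type (\<open>q_shift\<close>).  Moreover, $e_k = n$ says that $X_n$ has length $k$ and that the walk enters the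
  cone of $X_n$ at time $n$ and never leaves it again, so a prescribed trajectory up to $e_k$ has as
  probability the weight of the path times the probability of holding the last cone.  Quotients of such
  products factorise: given the type of the first letter of the limiting word, the trajectory between $e_r$ and $e_k$, read relative to
  $X_{e_r}$, is independent of the trajectory up to $e_r$, and its law depends only on $k-r$ and on the
  type of $X_{e_r}$, which alternates with $r$ (\<open>emeasure_joint_segments\<close>).

  \<^emph>\<open>Decay of dependence.\<close>  The summand $f(\pi_k)$ is not a function of the last segment alone, because
  the walk may have visited the cone of $X_{e_{k-1}}$ long before $e_{k-1}$.  A visit before $e_r$, however,
  makes the path $\psi_{r+1}$ climb about $k-r$ levels (\<open>cone_path_seg_differs\<close>), and the exponential
  moments of the lengths make this exponentially unlikely.  Hence $f(\pi_k)$ agrees, outside an event of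
  probability $O(R^{-(k-r)})$, with the same functional of the segment between $e_r$ and $e_k$, which is
  independent of the trajectory up to $e_r$, given the type of the first letter.

  \<^emph>\<open>Strong law.\<close>  As $R_f < R$, the summands have bounded moments of some order $p > 1$, but in general
  no second moments.  Truncation at the number of summands, the variance bound coming from the decay of
  dependence, and Borel--Cantelli along a polynomial subsequence give the strong law for nonnegative
  summands, monotonicity filling the gaps (\<open>averages_tendsto\<close>).  It is applied to the positive and the
  negative part of $f$ and to the increments of $e_k$.  The means converge after adding two consecutive
  ones, which removes the dependence on the type of the first letter (\<open>pair_sum_limit\<close>), so the limit
  is a constant.

  \<^emph>\<open>Transience.\<close>  The walk returns to the empty word only finitely often, so with positive probability it
  leaves it for ever through one of the two factors, and then also through the other one
  (\<open>escape_other\<close>).  Therefore each visit to a level $k \ge 1$ is the last one with probability bounded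
  below.  Different times give disjoint events ``last visit'', so the expected number of visits to
  the level is finite, and all $e_k$ are finite almost surely (\<open>summable_level\<close>).
\<close>

section \<open>A strong law under geometrically decaying dependence\<close>

lemma min_le_powr_interpolation:
  fixes a b t :: real
  assumes "0 < a" "0 < b" "0 \<le> t" "t \<le> 1"
  shows "min a b \<le> a powr t * b powr (1 - t)"
proof -
  have m: "0 < min a b" using assms by simp
  have "min a b = min a b powr t * min a b powr (1 - t)"
    using m by (simp add: powr_add[symmetric])
  also have "\<dots> \<le> a powr t * b powr (1 - t)"
    using assms m by (intro mult_mono powr_mono2) auto
  finally show ?thesis .
qed

lemma sum_geometric_distance_le:
  fixes \<sigma> :: real
  assumes "0 < \<sigma>" "\<sigma> < 1"
  shows "(\<Sum>i<n. \<Sum>k<n. \<sigma> ^ ((i - k) + (k - i))) \<le> 2 * real n / (1 - \<sigma>)"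
proof -
  have geo: "(\<Sum>k<m. \<sigma> ^ k) \<le> 1 / (1 - \<sigma>)" for m
    using sum_le_suminf[of "\<lambda>k. \<sigma> ^ k" "{..<m}"] assms
    by (simp add: suminf_geometric summable_geometric)
  have inner: "(\<Sum>k<n. \<sigma> ^ ((i - k) + (k - i))) \<le> 2 / (1 - \<sigma>)" if i: "i < n" for i
  proof -
    have split: "{..<n} = {..i} \<union> {Suc i..<n}" using i by auto
    have "(\<Sum>k<n. \<sigma> ^ ((i - k) + (k - i))) =
        (\<Sum>k\<le>i. \<sigma> ^ ((i - k) + (k - i))) + (\<Sum>k=Suc i..<n. \<sigma> ^ ((i - k) + (k - i)))"
      unfolding split by (rule sum.union_disjoint) auto
    also have "(\<Sum>k\<le>i. \<sigma> ^ ((i - k) + (k - i))) = (\<Sum>k\<le>i. \<sigma> ^ k)"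
      by (rule sum.reindex_bij_witness[of _ "\<lambda>k. i - k" "\<lambda>k. i - k"]) auto
    also have "(\<Sum>k\<le>i. \<sigma> ^ k) \<le> 1 / (1 - \<sigma>)"
      using geo[of "Suc i"] by (simp add: lessThan_Suc_atMost)
    also have "(\<Sum>k=Suc i..<n. \<sigma> ^ ((i - k) + (k - i))) = (\<Sum>k\<in>{1..<n - i}. \<sigma> ^ k)"
      by (rule sum.reindex_bij_witness[of _ "\<lambda>k. i + k" "\<lambda>k. k - i"]) auto
    also have "\<dots> \<le> (\<Sum>k<n - i. \<sigma> ^ k)"
      using assms by (intro sum_mono2) auto
    also have "\<dots> \<le> 1 / (1 - \<sigma>)" by (rule geo)
    finally show ?thesis by simp
  qed
  have "(\<Sum>i<n. \<Sum>k<n. \<sigma> ^ ((i - k) + (k - i))) \<le> (\<Sum>i<n. 2 / (1 - \<sigma>))"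
    using inner by (intro sum_mono) auto
  then show ?thesis by (simp add: mult.commute)
qed

text \<open>For a monotone sequence of partial sums the averages are controlled by a subsequence as soon as the
  quotients of consecutive indices tend to $1$.  Powers $j^A$ have this property and still grow fast
  enough to make polynomially small probabilities summable.\<close>

lemma averages_tendsto_of_polynomial_subsequence:
  fixes S :: "nat \<Rightarrow> real"
  assumes mono: "incseq S" and nonneg: "\<And>n. 0 \<le> S n" and A: "1 \<le> A"
    and lim: "(\<lambda>j. S (Suc j ^ A) / real (Suc j ^ A)) \<longlonglongrightarrow> c"
  shows "(\<lambda>n. S n / real n) \<longlonglongrightarrow> c"
proof -
  define N where "N j = Suc j ^ A" for j
  have N_pos: "0 < N j" for j by (simp add: N_def)
  have N_ge: "Suc j \<le> N j" for j
    unfolding N_def using power_increasing[OF A, of "Suc j"] by simp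
  define J where "J n = Max {j. N j \<le> n}" for n
  have fin: "finite {j. N j \<le> n}" for n
  proof (rule finite_subset)
    show "{j. N j \<le> n} \<subseteq> {..n}" using N_ge Suc_leD le_trans by blast
  qed auto
  have J: "N (J n) \<le> n" "n < N (Suc (J n))" if "1 \<le> n" for n
  proof -
    have "0 \<in> {j. N j \<le> n}" using that by (simp add: N_def)
    then show "N (J n) \<le> n" using Max_in[OF fin[of n]] unfolding J_def by blast
    show "n < N (Suc (J n))"
      using Max_ge[OF fin[of n], of "Suc (J n)"] unfolding J_def[symmetric] by fastforce
  qed
  have J_lim: "filterlim J at_top at_top"
    unfolding filterlim_at_top
  proof
    fix Z show "\<forall>\<^sub>F n in sequentially. Z \<le> J n"
      unfolding eventually_sequentially J_def by (intro exI[of _ "N Z"] allI impI Max_ge fin) auto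
  qed
  have ratio: "(\<lambda>j. real (N j) / real (N (Suc j))) \<longlonglongrightarrow> 1"
  proof -
    have "(\<lambda>j. (real (Suc j) / real (Suc (Suc j))) ^ A) \<longlonglongrightarrow> 1 ^ A"
      by (intro tendsto_power LIMSEQ_n_over_Suc_n[THEN LIMSEQ_Suc])
    then show ?thesis by (simp add: N_def power_divide)
  qed
  have lim': "(\<lambda>j. S (N j) / real (N j)) \<longlonglongrightarrow> c" using lim by (simp add: N_def)
  have lower: "(\<lambda>j. S (N j) / real (N (Suc j))) \<longlonglongrightarrow> c"
  proof -
    have "(\<lambda>j. (S (N j) / real (N j)) * (real (N j) / real (N (Suc j)))) \<longlonglongrightarrow> c * 1"
      by (intro tendsto_mult lim' ratio)
    then show ?thesis using N_pos by (simp add: less_imp_neq[THEN not_sym])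
  qed
  have upper: "(\<lambda>j. S (N (Suc j)) / real (N j)) \<longlonglongrightarrow> c"
  proof -
    have "(\<lambda>j. (S (N (Suc j)) / real (N (Suc j))) / (real (N j) / real (N (Suc j)))) \<longlonglongrightarrow> c / 1"
      by (intro tendsto_divide lim'[THEN LIMSEQ_Suc] ratio) simp
    then show ?thesis using N_pos by (simp add: less_imp_neq[THEN not_sym])
  qed
  show ?thesis
  proof (rule tendsto_sandwich)
    show "\<forall>\<^sub>F n in sequentially. S (N (J n)) / real (N (Suc (J n))) \<le> S n / real n"
      using eventually_ge_at_top[of 1]
    proof eventually_elim
      case (elim n)
      show ?case using J[OF elim] mono nonneg elim by (intro frac_le) (auto simp: incseq_def)
    qed
    show "\<forall>\<^sub>F n in sequentially. S n / real n \<le> S (N (Suc (J n))) / real (N (J n))"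
      using eventually_ge_at_top[of 1]
    proof eventually_elim
      case (elim n)
      show ?case using J[OF elim] mono nonneg elim N_pos by (intro frac_le) (auto simp: incseq_def)
    qed
  qed (rule filterlim_compose[OF lower J_lim] filterlim_compose[OF upper J_lim])+
qed

text \<open>The variable \<open>Y' i k\<close> is a version of \<open>Y k\<close> that ignores everything up to index \<open>i\<close>: it is independent
  of \<open>Y i\<close> and differs from \<open>Y k\<close> with a probability that decays geometrically in \<open>k - i\<close>.\<close>

locale mixing_sequence = prob_space +
  fixes Y :: "nat \<Rightarrow> 'a \<Rightarrow> real" and Y' :: "nat \<Rightarrow> nat \<Rightarrow> 'a \<Rightarrow> real" and p K \<rho> :: real
  assumes Y_meas [measurable]: "\<And>k. Y k \<in> borel_measurable M"
    and Y_nonneg: "\<And>k \<omega>. 0 \<le> Y k \<omega>"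
    and Y'_nonneg: "\<And>i k \<omega>. 0 \<le> Y' i k \<omega>"
    and p: "1 < p" "p \<le> 2" and \<rho>: "0 < \<rho>" "\<rho> < 1" and K: "1 \<le> K"
    and moment_integrable: "\<And>k. integrable M (\<lambda>\<omega>. Y k \<omega> powr p)"
    and moment_le: "\<And>k. expectation (\<lambda>\<omega>. Y k \<omega> powr p) \<le> K"
    and indep: "\<And>i k. i < k \<Longrightarrow> indep_var borel (Y i) borel (Y' i k)"
    and approx: "\<And>i k. i < k \<Longrightarrow> prob {\<omega> \<in> space M. Y k \<omega> \<noteq> Y' i k \<omega>} \<le> K * \<rho> ^ (k - i)"
begin

text \<open>Truncation at the number $n$ of summands provides second moments of order $n^{2-p}$, while it changes
  one of the first $n$ summands only with probability $O(n^{1-p})$.\<close>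

definition U :: "nat \<Rightarrow> nat \<Rightarrow> 'a \<Rightarrow> real" where
  "U n k \<omega> = min (Y k \<omega>) (real n)"

lemma U_meas [measurable]: "U n k \<in> borel_measurable M"
  unfolding U_def by measurable

lemma Y'_meas [measurable]: "i < k \<Longrightarrow> Y' i k \<in> borel_measurable M"
  using indep[of i k] by (auto simp: indep_var_rv2)

lemma U_bounds: "0 \<le> U n k \<omega>" "U n k \<omega> \<le> real n"
  using Y_nonneg[of k \<omega>] by (auto simp: U_def)

lemma U_integrable [simp]: "integrable M (U n k)"
  by (rule integrable_const_bound[where B = "real n"]) (use U_bounds in auto)

lemma UU_integrable [simp]: "integrable M (\<lambda>\<omega>. U n i \<omega> * U n k \<omega>)"
proof (rule integrable_const_bound[where B = "real n * real n"])
  show "AE \<omega> in M. norm (U n i \<omega> * U n k \<omega>) \<le> real n * real n"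
    using U_bounds by (auto simp: abs_mult intro!: mult_mono)
qed auto

lemma UU_le:
  assumes n: "1 \<le> n"
  shows "expectation (\<lambda>\<omega>. U n i \<omega> * U n k \<omega>) \<le> K * real n powr (2 - p)"
proof -
  have sq: "(U n k \<omega>)\<^sup>2 \<le> real n powr (2 - p) * Y k \<omega> powr p" for k \<omega>
  proof (cases "Y k \<omega> = 0")
    case False
    then have y: "0 < U n k \<omega>" using Y_nonneg[of k \<omega>] n by (auto simp: U_def)
    then have "(U n k \<omega>)\<^sup>2 = U n k \<omega> powr (2 - p) * U n k \<omega> powr p"
      by (simp add: powr_add[symmetric])
    also have "\<dots> \<le> real n powr (2 - p) * Y k \<omega> powr p"
      using y p by (intro mult_mono powr_mono2) (auto simp: U_def)
    finally show ?thesis .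
  qed (use n in \<open>simp add: U_def\<close>)
  have "U n i \<omega> * U n k \<omega> \<le> (real n powr (2 - p) / 2) * (Y i \<omega> powr p + Y k \<omega> powr p)" for \<omega>
  proof -
    have "U n i \<omega> * U n k \<omega> \<le> ((U n i \<omega>)\<^sup>2 + (U n k \<omega>)\<^sup>2) / 2"
      using sum_squares_bound[of "U n i \<omega>" "U n k \<omega>"] by simp
    also have "\<dots> \<le> (real n powr (2 - p) / 2) * (Y i \<omega> powr p + Y k \<omega> powr p)"
      using sq[of i \<omega>] sq[of k \<omega>] by (simp add: field_simps)
    finally show ?thesis .
  qed
  then have "expectation (\<lambda>\<omega>. U n i \<omega> * U n k \<omega>) \<le>
      expectation (\<lambda>\<omega>. (real n powr (2 - p) / 2) * (Y i \<omega> powr p + Y k \<omega> powr p))"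
    using moment_integrable by (intro integral_mono) auto
  also have "\<dots> = (real n powr (2 - p) / 2) * (expectation (\<lambda>\<omega>. Y i \<omega> powr p) + expectation (\<lambda>\<omega>. Y k \<omega> powr p))"
    using moment_integrable by simp
  also have "\<dots> \<le> (real n powr (2 - p) / 2) * (K + K)"
    using moment_le by (intro mult_left_mono add_mono) auto
  finally show ?thesis by (simp add: mult.commute)
qed

text \<open>Near the diagonal the truncated second moment is the better bound, far from it the comparison of
  \<open>Y k\<close> with its independent version \<open>Y' i k\<close>, whose error is paid for with the truncation level squared.\<close>

lemma covariance_le:
  assumes n: "1 \<le> n" and ik: "i \<le> k"
  shows "expectation (\<lambda>\<omega>. U n i \<omega> * U n k \<omega>) - expectation (U n i) * expectation (U n k)
     \<le> 2 * K * min (real n powr (2 - p)) ((real n)\<^sup>2 * \<rho> ^ (k - i))"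
proof -
  define c where "c = expectation (\<lambda>\<omega>. U n i \<omega> * U n k \<omega>) - expectation (U n i) * expectation (U n k)"
  have pos: "0 \<le> expectation (U n i)" for i
    using U_bounds by simp
  have a: "c \<le> K * real n powr (2 - p)"
    using UU_le[OF n, of i k] mult_nonneg_nonneg[OF pos[of i] pos[of k]] unfolding c_def by linarith
  have "c \<le> 2 * K * ((real n)\<^sup>2 * \<rho> ^ (k - i))"
  proof (cases "i = k")
    case True
    have "real n powr (2 - p) \<le> real n powr 2" using n p by (intro powr_mono) auto
    then have "real n powr (2 - p) \<le> (real n)\<^sup>2" using n by simp
    then have "K * real n powr (2 - p) \<le> 2 * K * (real n)\<^sup>2" 
      using K by (intro mult_mono) auto
    then show ?thesis using a True by simp
  next
    case False
    then have lt: "i < k" using ik by simp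
    note [measurable] = Y'_meas[OF lt]
    define V where "V \<omega> = min (Y' i k \<omega>) (real n)" for \<omega>
    have [measurable]: "V \<in> borel_measurable M" unfolding V_def by measurable
    define D where "D = {\<omega> \<in> space M. Y k \<omega> \<noteq> Y' i k \<omega>}"
    have [measurable]: "D \<in> sets M" unfolding D_def by measurable
    have V: "0 \<le> V \<omega>" "V \<omega> \<le> real n" for \<omega> using Y'_nonneg[of i k \<omega>] by (auto simp: V_def)
    have Vint: "integrable M V"
      by (rule integrable_const_bound[where B = "real n"]) (use V in auto)
    have Dint: "integrable M (\<lambda>\<omega>. indicator D \<omega> :: real)" "expectation (\<lambda>\<omega>. indicator D \<omega>) = prob D"
      by (auto simp: less_top[symmetric])
    have UV: "\<bar>U n k \<omega> - V \<omega>\<bar> \<le> real n * indicator D \<omega>" if "\<omega> \<in> space M" for \<omega>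
      using that V[of \<omega>] U_bounds[of n k \<omega>] by (auto simp: D_def U_def V_def indicator_def)
    have ind: "indep_var borel (U n i) borel V"
    proof -
      have "indep_var borel ((\<lambda>y. min y (real n)) \<circ> Y i) borel ((\<lambda>y. min y (real n)) \<circ> Y' i k)"
        by (rule indep_var_compose[OF indep[OF lt]]) auto
      then show ?thesis by (simp add: comp_def U_def[abs_def] V_def[abs_def])
    qed
    have UVint: "integrable M (\<lambda>\<omega>. U n i \<omega> * V \<omega>)"
      by (rule indep_var_integrable[OF ind]) (auto simp: Vint)
    have "expectation (\<lambda>\<omega>. U n i \<omega> * U n k \<omega>) \<le> expectation (\<lambda>\<omega>. U n i \<omega> * V \<omega> + (real n)\<^sup>2 * indicator D \<omega>)"
    proof (rule integral_mono)
      fix \<omega> assume w: "\<omega> \<in> space M"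
      have "U n i \<omega> * (U n k \<omega> - V \<omega>) \<le> U n i \<omega> * (real n * indicator D \<omega>)"
        using UV[OF w] U_bounds[of n i \<omega>] by (intro mult_left_mono) auto
      also have "\<dots> \<le> real n * (real n * indicator D \<omega>)"
        using U_bounds[of n i \<omega>] by (intro mult_right_mono) auto
      finally have "U n i \<omega> * (U n k \<omega> - V \<omega>) \<le> real n * (real n * indicator D \<omega>)" .
      then show "U n i \<omega> * U n k \<omega> \<le> U n i \<omega> * V \<omega> + (real n)\<^sup>2 * indicator D \<omega>"
        by (simp add: algebra_simps power2_eq_square)
    qed (use UVint Dint in auto)
    also have "\<dots> = expectation (U n i) * expectation V + (real n)\<^sup>2 * prob D"
      using UVint Dint by (simp add: indep_var_lebesgue_integral[OF ind U_integrable Vint])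
    also have "expectation V \<le> expectation (\<lambda>\<omega>. U n k \<omega> + real n * indicator D \<omega>)"
    proof (rule integral_mono)
      fix \<omega> assume w: "\<omega> \<in> space M"
      show "V \<omega> \<le> U n k \<omega> + real n * indicator D \<omega>" using UV[OF w] by linarith
    qed (use Vint Dint in auto)
    also have "\<dots> = expectation (U n k) + real n * prob D"
      using Dint by simp
    finally have "expectation (\<lambda>\<omega>. U n i \<omega> * U n k \<omega>) \<le>
       expectation (U n i) * (expectation (U n k) + real n * prob D) + (real n)\<^sup>2 * prob D"
      using pos by (simp add: mult_left_mono)
    moreover have "expectation (U n i) \<le> real n"
      using integral_mono[of M "U n i" "\<lambda>_. real n"] U_bounds by (simp add: prob_space)
    then have "expectation (U n i) * (real n * prob D) \<le> real n * (real n * prob D)"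
      by (intro mult_right_mono) auto
    ultimately have "c \<le> 2 * (real n)\<^sup>2 * prob D"
      by (simp add: c_def algebra_simps power2_eq_square)
    also have "\<dots> \<le> 2 * (real n)\<^sup>2 * (K * \<rho> ^ (k - i))"
      using approx[OF lt] by (intro mult_left_mono) (auto simp: D_def)
    finally show ?thesis by (simp add: mult_ac)
  qed
  moreover have "c \<le> 2 * K * real n powr (2 - p)"
  proof -
    have "0 \<le> K * real n powr (2 - p)" using K by (intro mult_nonneg_nonneg) auto
    then show ?thesis using a by linarith
  qed
  ultimately have "c \<le> 2 * K * min (real n powr (2 - p)) ((real n)\<^sup>2 * \<rho> ^ (k - i))"
    by (simp only: min_def split: if_split) blast
  then show ?thesis by (simp only: c_def)
qed

text \<open>Interpolating the two covariance bounds with weight $\theta$ yields $n^{2-p\theta}$ times a geometric factor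
  in the distance from the diagonal.  The choice of $\theta$ makes $p\theta = 1 + \delta$ exceed $1$, so
  that the variance of $n$ summands is $O(n^{2-\delta})$.\<close>

definition \<delta> :: real where "\<delta> = (p - 1) / 2"
definition \<theta> :: real where "\<theta> = (p + 1) / (2 * p)"
definition \<sigma> :: real where "\<sigma> = \<rho> powr (1 - \<theta>)"

lemma exponents: "0 < \<delta>" "0 < \<theta>" "\<theta> < 1" "p * \<theta> = 1 + \<delta>" "0 < \<sigma>" "\<sigma> < 1"
proof -
  show t: "0 < \<delta>" "0 < \<theta>" "\<theta> < 1" "p * \<theta> = 1 + \<delta>" using p by (auto simp: \<delta>_def \<theta>_def field_simps)
  show "0 < \<sigma>" using \<rho> by (simp add: \<sigma>_def)
  show "\<sigma> < 1" unfolding \<sigma>_def using powr_less_mono2[of "1 - \<theta>" \<rho> 1] \<rho> t by simp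
qed

lemma covariance_decay:
  assumes n: "1 \<le> n"
  shows "expectation (\<lambda>\<omega>. U n i \<omega> * U n k \<omega>) - expectation (U n i) * expectation (U n k)
     \<le> 2 * K * (real n powr (1 - \<delta>) * \<sigma> ^ ((i - k) + (k - i)))"
proof -
  have *: "expectation (\<lambda>\<omega>. U n i \<omega> * U n k \<omega>) - expectation (U n i) * expectation (U n k)
     \<le> 2 * K * (real n powr (1 - \<delta>) * \<sigma> ^ (k - i))" if ik: "i \<le> k" for i k
  proof -
    have "min (real n powr (2 - p)) ((real n)\<^sup>2 * \<rho> ^ (k - i))
       \<le> (real n powr (2 - p)) powr \<theta> * ((real n)\<^sup>2 * \<rho> ^ (k - i)) powr (1 - \<theta>)"
      using n \<rho> exponents by (intro min_le_powr_interpolation) auto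
    also have "(real n powr (2 - p)) powr \<theta> = real n powr ((2 - p) * \<theta>)"
      by (simp add: powr_powr)
    also have "((real n)\<^sup>2 * \<rho> ^ (k - i)) powr (1 - \<theta>) = real n powr (2 * (1 - \<theta>)) * \<sigma> ^ (k - i)"
    proof -
      have "((real n)\<^sup>2) powr (1 - \<theta>) = real n powr (2 * (1 - \<theta>))"
        using n by (simp add: powr_powr flip: powr_numeral)
      moreover have "(\<rho> ^ (k - i)) powr (1 - \<theta>) = \<sigma> ^ (k - i)"
        using \<rho> by (simp add: \<sigma>_def powr_powr powr_power mult.commute flip: powr_realpow)
      ultimately show ?thesis using n \<rho> by (simp add: powr_mult)
    qed
    also have "real n powr ((2 - p) * \<theta>) * (real n powr (2 * (1 - \<theta>)) * \<sigma> ^ (k - i)) =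
        real n powr (1 - \<delta>) * \<sigma> ^ (k - i)"
    proof -
      have "(2 - p) * \<theta> + 2 * (1 - \<theta>) = 1 - \<delta>" using exponents(4) by (simp add: algebra_simps)
      then show ?thesis by (simp only: mult.assoc[symmetric] powr_add[symmetric])
    qed
    finally have "2 * K * min (real n powr (2 - p)) ((real n)\<^sup>2 * \<rho> ^ (k - i)) \<le>
       2 * K * (real n powr (1 - \<delta>) * \<sigma> ^ (k - i))"
      using K by (intro mult_left_mono) auto
    then show ?thesis using covariance_le[OF n ik] by linarith
  qed
  show ?thesis
  proof (cases "i \<le> k")
    case False
    then show ?thesis using *[of k i] by (simp add: mult.commute)
  qed (use * in simp)
qed

lemma truncated_variance_le:
  assumes n: "1 \<le> n"
  shows "expectation (\<lambda>\<omega>. ((\<Sum>k<n. U n k \<omega>) - (\<Sum>k<n. expectation (U n k)))\<^sup>2)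
     \<le> 4 * K / (1 - \<sigma>) * real n powr (2 - \<delta>)"
proof -
  have "expectation (\<lambda>\<omega>. ((\<Sum>k<n. U n k \<omega>) - (\<Sum>k<n. expectation (U n k)))\<^sup>2)
    = (\<Sum>i<n. \<Sum>k<n. expectation (\<lambda>\<omega>. U n i \<omega> * U n k \<omega>) - expectation (U n i) * expectation (U n k))"
  proof -
    have "expectation (\<lambda>\<omega>. ((\<Sum>k<n. U n k \<omega>) - (\<Sum>k<n. expectation (U n k)))\<^sup>2)
      = expectation (\<lambda>\<omega>. \<Sum>i<n. \<Sum>k<n. (U n i \<omega> - expectation (U n i)) * (U n k \<omega> - expectation (U n k)))"
      by (simp add: power2_eq_square sum_product flip: sum_subtractf)
    also have "\<dots> = expectation (\<lambda>\<omega>. \<Sum>i<n. \<Sum>k<n. U n i \<omega> * U n k \<omega> - expectation (U n i) * U n k \<omega>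
          - expectation (U n k) * U n i \<omega> + expectation (U n i) * expectation (U n k))"
      by (simp add: algebra_simps)
    also have "\<dots> = (\<Sum>i<n. \<Sum>k<n. expectation (\<lambda>\<omega>. U n i \<omega> * U n k \<omega>) - expectation (U n i) * expectation (U n k))"
      by (simp add: prob_space algebra_simps)
    finally show ?thesis .
  qed
  also have "\<dots> \<le> (\<Sum>i<n. \<Sum>k<n. 2 * K * (real n powr (1 - \<delta>) * \<sigma> ^ ((i - k) + (k - i))))"
    by (intro sum_mono covariance_decay n)
  also have "\<dots> = 2 * K * real n powr (1 - \<delta>) * (\<Sum>i<n. \<Sum>k<n. \<sigma> ^ ((i - k) + (k - i)))"
    by (simp add: sum_distrib_left mult_ac)
  also have "\<dots> \<le> 2 * K * real n powr (1 - \<delta>) * (2 * real n / (1 - \<sigma>))"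
    using K exponents by (intro mult_left_mono sum_geometric_distance_le) auto
  also have "\<dots> = 4 * K / (1 - \<sigma>) * (real n powr (1 - \<delta>) * real n powr 1)"
    using n by simp
  also have "real n powr (1 - \<delta>) * real n powr 1 = real n powr (2 - \<delta>)"
    by (subst powr_add[symmetric]) simp
  finally show ?thesis .
qed

lemma excess_le: "Y k \<omega> - U n k \<omega> \<le> Y k \<omega> powr p * real n powr (1 - p)" if "1 \<le> n"
proof (cases "Y k \<omega> \<le> real n")
  case True
  then show ?thesis by (simp add: U_def)
next
  case False
  then have y: "real n < Y k \<omega>" "0 < Y k \<omega>" using that by auto
  have "Y k \<omega> - U n k \<omega> \<le> Y k \<omega>" using U_bounds by simp
  also have "\<dots> = Y k \<omega> powr p * Y k \<omega> powr (1 - p)" using y by (simp flip: powr_add)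
  also have "\<dots> \<le> Y k \<omega> powr p * real n powr (1 - p)"
    using y that p by (intro mult_left_mono powr_mono2') auto
  finally show ?thesis .
qed

lemma Y_integrable: "integrable M (Y k)"
proof (rule Bochner_Integration.integrable_bound)
  show "integrable M (\<lambda>\<omega>. 1 + Y k \<omega> powr p)" using moment_integrable by simp
  show "AE \<omega> in M. norm (Y k \<omega>) \<le> norm (1 + Y k \<omega> powr p)"
  proof (rule AE_I2)
    fix \<omega>
    have "0 \<le> Y k \<omega> powr p" by simp
    moreover have "Y k \<omega> \<le> 1 + Y k \<omega> powr p"
    proof (cases "Y k \<omega> \<le> 1")
      case True
      then show ?thesis using \<open>0 \<le> Y k \<omega> powr p\<close> by linarith
    next
      case False
      then show ?thesis using excess_le[of 1 k \<omega>] by (simp add: U_def)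
    qed
    ultimately show "norm (Y k \<omega>) \<le> norm (1 + Y k \<omega> powr p)"
      using Y_nonneg[of k \<omega>] by simp
  qed
qed simp

lemma expectation_excess:
  assumes "1 \<le> n"
  shows "expectation (U n k) \<le> expectation (Y k)"
    and "expectation (Y k) - expectation (U n k) \<le> K * real n powr (1 - p)"
proof -
  show "expectation (U n k) \<le> expectation (Y k)"
    by (intro integral_mono Y_integrable) (auto simp: U_def)
  have "expectation (Y k) - expectation (U n k) = expectation (\<lambda>\<omega>. Y k \<omega> - U n k \<omega>)"
    by (simp add: Y_integrable)
  also have "\<dots> \<le> expectation (\<lambda>\<omega>. Y k \<omega> powr p * real n powr (1 - p))"
    using moment_integrable by (intro integral_mono excess_le assms) (auto simp: Y_integrable)
  also have "\<dots> \<le> K * real n powr (1 - p)"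
    using moment_integrable moment_le by (simp add: mult_right_mono)
  finally show "expectation (Y k) - expectation (U n k) \<le> K * real n powr (1 - p)" .
qed

lemma prob_large_le:
  assumes n: "1 \<le> n"
  shows "prob {\<omega> \<in> space M. \<exists>k<n. real n < Y k \<omega>} \<le> K * real n powr (1 - p)"
proof -
  have "prob {\<omega> \<in> space M. \<exists>k<n. real n < Y k \<omega>} = prob (\<Union>k\<in>{..<n}. {\<omega> \<in> space M. real n < Y k \<omega>})"
    by (rule arg_cong[where f = prob]) auto
  also have "\<dots> \<le> (\<Sum>k<n. prob {\<omega> \<in> space M. real n < Y k \<omega>})"
    by (rule finite_measure_subadditive_finite) auto
  also have "\<dots> \<le> (\<Sum>k<n. K / real n powr p)"
  proof (rule sum_mono)
    fix k
    have "prob {\<omega> \<in> space M. real n < Y k \<omega>} \<le> prob {\<omega> \<in> space M. real n powr p \<le> Y k \<omega> powr p}"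
      using p by (intro finite_measure_mono) (auto intro!: powr_mono2)
    also have "\<dots> \<le> expectation (\<lambda>\<omega>. Y k \<omega> powr p) / real n powr p"
      using n by (intro integral_Markov_inequality_measure[where A = "{}"] moment_integrable) auto
    also have "\<dots> \<le> K / real n powr p" by (intro divide_right_mono moment_le) auto
    finally show "prob {\<omega> \<in> space M. real n < Y k \<omega>} \<le> K / real n powr p" .
  qed
  also have "\<dots> = K * (real n powr 1 / real n powr p)" using n by simp
  also have "\<dots> = K * real n powr (1 - p)" by (simp only: powr_diff)
  finally show ?thesis .
qed

lemma prob_deviation_le:
  assumes n: "1 \<le> n" and \<epsilon>: "0 < \<epsilon>"
  shows "prob {\<omega> \<in> space M. \<epsilon> * real n \<le> \<bar>(\<Sum>k<n. Y k \<omega>) - (\<Sum>k<n. expectation (U n k))\<bar>}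
    \<le> (K + 4 * K / (1 - \<sigma>) / \<epsilon>\<^sup>2) * real n powr (- \<delta>)"
proof -
  define m where "m = (\<Sum>k<n. expectation (U n k))"
  let ?L = "{\<omega> \<in> space M. \<exists>k<n. real n < Y k \<omega>}"
  let ?D = "{\<omega> \<in> space M. (\<epsilon> * real n)\<^sup>2 \<le> ((\<Sum>k<n. U n k \<omega>) - m)\<^sup>2}"
  have "{\<omega> \<in> space M. \<epsilon> * real n \<le> \<bar>(\<Sum>k<n. Y k \<omega>) - m\<bar>} \<subseteq> ?L \<union> ?D"
  proof
    fix \<omega> assume w: "\<omega> \<in> {\<omega> \<in> space M. \<epsilon> * real n \<le> \<bar>(\<Sum>k<n. Y k \<omega>) - m\<bar>}"
    show "\<omega> \<in> ?L \<union> ?D"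
    proof (cases "\<exists>k<n. real n < Y k \<omega>")
      case False
      then have "Y k \<omega> \<le> real n" if "k < n" for k using that by force
      then have "(\<Sum>k<n. Y k \<omega>) = (\<Sum>k<n. U n k \<omega>)"
        by (intro sum.cong refl) (simp add: U_def)
      then have "\<epsilon> * real n \<le> \<bar>(\<Sum>k<n. U n k \<omega>) - m\<bar>" using w by auto
      then have "(\<epsilon> * real n)\<^sup>2 \<le> ((\<Sum>k<n. U n k \<omega>) - m)\<^sup>2"
        using \<epsilon> by (subst (2) power2_abs[symmetric]) (intro power_mono, auto)
      then show ?thesis using w by auto
    qed (use w in auto)
  qed
  then have "prob {\<omega> \<in> space M. \<epsilon> * real n \<le> \<bar>(\<Sum>k<n. Y k \<omega>) - m\<bar>} \<le> prob (?L \<union> ?D)"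
    by (intro finite_measure_mono) auto
  also have "\<dots> \<le> prob ?L + prob ?D" by (intro measure_Un_le) auto
  also have "prob ?L \<le> K * real n powr (- \<delta>)"
  proof -
    have "real n powr (1 - p) \<le> real n powr (- \<delta>)"
      using n p by (intro powr_mono) (auto simp: \<delta>_def field_simps)
    then have "K * real n powr (1 - p) \<le> K * real n powr (- \<delta>)" using K by (intro mult_left_mono) auto
    then show ?thesis using prob_large_le[OF n] by linarith
  qed
  also have "prob ?D \<le> 4 * K / (1 - \<sigma>) / \<epsilon>\<^sup>2 * real n powr (- \<delta>)"
  proof -
    have int: "integrable M (\<lambda>\<omega>. ((\<Sum>k<n. U n k \<omega>) - m)\<^sup>2)"
    proof (rule integrable_const_bound[where B = "(real n * real n + \<bar>m\<bar>)\<^sup>2"])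
      show "AE \<omega> in M. norm (((\<Sum>k<n. U n k \<omega>) - m)\<^sup>2) \<le> (real n * real n + \<bar>m\<bar>)\<^sup>2"
      proof (rule AE_I2)
        fix \<omega>
        have "0 \<le> (\<Sum>k<n. U n k \<omega>)" using U_bounds by (intro sum_nonneg) auto
        moreover have "(\<Sum>k<n. U n k \<omega>) \<le> real n * real n"
          using sum_bounded_above[of "{..<n}" "\<lambda>k. U n k \<omega>" "real n"] U_bounds by simp
        ultimately have "\<bar>(\<Sum>k<n. U n k \<omega>) - m\<bar> \<le> real n * real n + \<bar>m\<bar>" by linarith
        then show "norm (((\<Sum>k<n. U n k \<omega>) - m)\<^sup>2) \<le> (real n * real n + \<bar>m\<bar>)\<^sup>2"
          using power_mono[of "\<bar>(\<Sum>k<n. U n k \<omega>) - m\<bar>" _ 2] by simp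
      qed
    qed auto
    have "prob ?D \<le> expectation (\<lambda>\<omega>. ((\<Sum>k<n. U n k \<omega>) - m)\<^sup>2) / (\<epsilon> * real n)\<^sup>2"
      using n \<epsilon> by (intro integral_Markov_inequality_measure[where A = "{}"] int) auto
    also have "\<dots> \<le> (4 * K / (1 - \<sigma>) * real n powr (2 - \<delta>)) / (\<epsilon> * real n)\<^sup>2"
      unfolding m_def by (intro divide_right_mono truncated_variance_le n) auto
    also have "\<dots> = 4 * K / (1 - \<sigma>) / \<epsilon>\<^sup>2 * (real n powr (2 - \<delta>) / real n powr 2)"
      using n \<epsilon> by (simp add: power_mult_distrib)
    also have "real n powr (2 - \<delta>) / real n powr 2 = real n powr (- \<delta>)"
      by (subst powr_diff[symmetric]) simp
    finally show ?thesis .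
  qed
  finally show ?thesis by (simp add: m_def algebra_simps)
qed

theorem averages_tendsto:
  assumes lim: "(\<lambda>n. (\<Sum>k<n. expectation (Y k)) / real n) \<longlonglongrightarrow> c"
  shows "AE \<omega> in M. (\<lambda>n. (\<Sum>k<n. Y k \<omega>) / real n) \<longlonglongrightarrow> c"
proof -
  (* the exponent of the subsequence: the deviation probabilities become O(j^(-2)) *)
  define A where "A = nat \<lceil>2 / \<delta>\<rceil>"
  have A: "2 \<le> real A * \<delta>" "1 \<le> A"
  proof -
    have "2 / \<delta> \<le> real A" "0 < 2 / \<delta>" using exponents by (auto simp: A_def of_nat_ceiling)
    then show "2 \<le> real A * \<delta>" "1 \<le> A" using exponents by (auto simp: field_simps) (cases A; simp)
  qed
  define N where "N j = Suc j ^ A" for j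
  have N_ge: "1 \<le> N j" for j by (simp add: N_def)
  define m where "m n = (\<Sum>k<n. expectation (U n k))" for n
  define E where "E i j = {\<omega> \<in> space M. 1 / real (Suc i) * real (N j) \<le> \<bar>(\<Sum>k<N j. Y k \<omega>) - m (N j)\<bar>}" for i j
  have "AE \<omega> in M. \<forall>\<^sub>F j in sequentially. \<omega> \<in> space M - E i j" for i
  proof (rule borel_cantelli_AE1)
    define B where "B = K + 4 * K / (1 - \<sigma>) / (1 / real (Suc i))\<^sup>2"
    show "summable (\<lambda>j. prob (E i j))"
    proof (rule summable_comparison_test')
      have "summable (\<lambda>j. real (Suc j) powr (- 2))"
        using summable_real_powr_iff[of "-2"] summable_Suc_iff[of "\<lambda>j. real j powr (-2)"] by simp
      then show "summable (\<lambda>j. B * real (Suc j) powr (- 2))" by (rule summable_mult)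
      fix j
      have "prob (E i j) \<le> B * real (N j) powr (- \<delta>)"
        unfolding E_def m_def B_def by (rule prob_deviation_le[OF N_ge]) simp
      also have "real (N j) powr (- \<delta>) = real (Suc j) powr (- (real A * \<delta>))"
        by (simp add: N_def powr_powr flip: powr_realpow)
      also have "B * \<dots> \<le> B * real (Suc j) powr (- 2)"
        using A K exponents by (intro mult_left_mono powr_mono) (auto simp: B_def)
      finally show "norm (prob (E i j)) \<le> B * real (Suc j) powr (- 2)" by simp
    qed
  qed (auto simp: E_def m_def less_top[symmetric])
  then have ae: "AE \<omega> in M. \<forall>i. \<forall>\<^sub>F j in sequentially. \<omega> \<in> space M - E i j"
    by (simp only: AE_all_countable) blast
  (* the truncation shifts each mean by at most K * n^(1-p) *)
  have mean: "(\<lambda>n. m n / real n) \<longlonglongrightarrow> c"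
  proof -
    have "(\<lambda>n. (\<Sum>k<n. expectation (Y k)) / real n - m n / real n) \<longlonglongrightarrow> 0"
    proof (rule tendsto_sandwich[of "\<lambda>_. 0" _ _ "\<lambda>n. K * real n powr (1 - p)"])
      show "\<forall>\<^sub>F n in sequentially. 0 \<le> (\<Sum>k<n. expectation (Y k)) / real n - m n / real n"
        using eventually_ge_at_top[of 1]
      proof eventually_elim
        case (elim n)
        then show ?case
          using expectation_excess(1)[OF elim] by (simp add: m_def divide_right_mono sum_mono)
      qed
      show "\<forall>\<^sub>F n in sequentially. (\<Sum>k<n. expectation (Y k)) / real n - m n / real n \<le> K * real n powr (1 - p)"
        using eventually_ge_at_top[of 1]
      proof eventually_elim
        case (elim n)
        have "(\<Sum>k<n. expectation (Y k)) - m n \<le> (\<Sum>k<n. K * real n powr (1 - p))"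
          unfolding m_def sum_subtractf[symmetric] by (intro sum_mono expectation_excess(2) elim)
        then show ?case using elim by (simp add: field_simps)
      qed
      have "(\<lambda>n. real n powr (1 - p)) \<longlonglongrightarrow> 0"
        using p by (intro tendsto_neg_powr filterlim_real_sequentially) auto
      then show "(\<lambda>n. K * real n powr (1 - p)) \<longlonglongrightarrow> 0" by (rule tendsto_mult_right_zero)
    qed auto
    from tendsto_diff[OF lim this] show ?thesis by simp
  qed
  from ae show ?thesis
  proof eventually_elim
    case (elim \<omega>)
    have N_lim: "filterlim N at_top at_top"
    proof (rule filterlim_at_top_mono[OF filterlim_ident])
      show "\<forall>\<^sub>F j in sequentially. j \<le> N j"
      proof (rule always_eventually, rule allI)
        fix j show "j \<le> N j" using power_increasing[OF A(2), of "Suc j"] by (simp add: N_def)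
      qed
    qed
    have "(\<lambda>j. ((\<Sum>k<N j. Y k \<omega>) - m (N j)) / real (N j)) \<longlonglongrightarrow> 0"
    proof (rule LIMSEQ_I)
      fix r :: real assume "0 < r"
      then obtain i where i: "1 / real (Suc i) < r" using nat_approx_posE by blast
      from elim have "\<forall>\<^sub>F j in sequentially. \<omega> \<in> space M - E i j" by blast
      then obtain J where J: "\<And>j. j \<ge> J \<Longrightarrow> \<omega> \<in> space M - E i j"
        unfolding eventually_sequentially by blast
      have "norm (((\<Sum>k<N j. Y k \<omega>) - m (N j)) / real (N j) - 0) < r" if "j \<ge> J" for j
      proof -
        have "\<bar>(\<Sum>k<N j. Y k \<omega>) - m (N j)\<bar> < 1 / real (Suc i) * real (N j)"
          using J[OF that] by (auto simp: E_def)
        also have "\<dots> \<le> r * real (N j)" using i by (intro mult_right_mono) auto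
        finally show ?thesis using N_ge[of j] by (simp add: abs_divide divide_less_eq)
      qed
      then show "\<exists>no. \<forall>j\<ge>no. norm (((\<Sum>k<N j. Y k \<omega>) - m (N j)) / real (N j) - 0) < r" by blast
    qed
    from tendsto_add[OF this filterlim_compose[OF mean N_lim]]
    have "(\<lambda>j. (\<Sum>k<N j. Y k \<omega>) / real (N j)) \<longlonglongrightarrow> c" by (simp add: diff_divide_distrib)
    then show ?case
      unfolding N_def
      by (intro averages_tendsto_of_polynomial_subsequence[OF _ _ A(2)] sum_nonneg Y_nonneg
          incseq_SucI) (auto simp: Y_nonneg)
  qed
qed

end

section \<open>Nearest neighbour moves between words\<close>

text \<open>A step of the walk stays inside a copy of one factor: both words are a common word followed by at most
  one letter.  This tree-like relation is all that the geometry of the decomposition uses.\<close>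

definition nbr :: "'a list \<Rightarrow> 'a list \<Rightarrow> bool" where
  "nbr x y \<longleftrightarrow> x \<noteq> y \<and> (\<exists>u. (x = u \<or> (\<exists>v. x = u @ [v])) \<and> (y = u \<or> (\<exists>v. y = u @ [v])))"

lemma nbr_sym: "nbr x y \<Longrightarrow> nbr y x"
  by (auto simp: nbr_def)

lemma nbr_neq: "nbr x y \<Longrightarrow> x \<noteq> y"
  by (simp add: nbr_def)

lemma nbr_enters_at_root:
  assumes "nbr x y" "\<not> prefix z x" "prefix z y"
  shows "y = z"
  using assms by (auto simp: nbr_def prefix_snoc)

lemma nbr_leaves_at_root:
  assumes "nbr x y" "prefix z x" "\<not> prefix z y"
  shows "x = z"
  using nbr_enters_at_root[OF nbr_sym] assms by blast

lemma nbr_length: "nbr x y \<Longrightarrow> length x \<le> Suc (length y) \<and> length y \<le> Suc (length x)"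
  by (auto simp: nbr_def)

lemma nbr_longer: "nbr x y \<Longrightarrow> length x < length y \<Longrightarrow> \<exists>v. y = x @ [v]"
  by (auto simp: nbr_def)

section \<open>Restricting paths\<close>

text \<open>
  If a set can be entered and left only at one vertex \<open>z\<close>, then a path re-enters it where it left it.  So
  the part outside can be cut out and the repetition of \<open>z\<close> collapsed without creating new edges.  Both
  a cone and the complement of a punctured cone have the root of the cone as such a vertex.\<close>

lemma restrict_path_through_gate:
  fixes Q :: "'b \<Rightarrow> 'b \<Rightarrow> bool"
  assumes "successively Q \<pi>" and neq: "\<And>x y. Q x y \<Longrightarrow> x \<noteq> y"
    and enter: "\<And>x y. Q x y \<Longrightarrow> x \<notin> A \<Longrightarrow> y \<in> A \<Longrightarrow> y = z"
    and leave: "\<And>x y. Q x y \<Longrightarrow> x \<in> A \<Longrightarrow> y \<notin> A \<Longrightarrow> x = z"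
  shows "successively Q (restrict_path \<pi> A)"
proof -
  (* the induction also has to know that a path starting outside A first meets A in z *)
  have "successively Q (restrict_path \<pi> A) \<and>
      (filter (\<lambda>x. x \<in> A) \<pi> \<noteq> [] \<longrightarrow> hd \<pi> \<notin> A \<longrightarrow> hd (filter (\<lambda>x. x \<in> A) \<pi>) = z)"
    using assms(1)
  proof (induction \<pi>)
    case Nil
    then show ?case by (simp add: restrict_path_def)
  next
    case (Cons x \<pi>)
    show ?case
    proof (cases \<pi>)
      case Nil
      then show ?thesis by (simp add: restrict_path_def)
    next
      case (Cons y \<pi>')
      have xy: "Q x y" and s: "successively Q \<pi>" using Cons.prems Cons by auto
      note IH = Cons.IH[OF s]
      show ?thesis
      proof (cases "x \<in> A")
        case False
        have "hd (filter (\<lambda>x. x \<in> A) \<pi>) = z" if "filter (\<lambda>x. x \<in> A) \<pi> \<noteq> []"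
        proof (cases "y \<in> A")
          case True
          then show ?thesis using enter[OF xy False] Cons by simp
        qed (use IH that Cons in auto)
        then show ?thesis using False IH by (simp add: restrict_path_def)
      next
        case True
        show ?thesis
        proof (cases "filter (\<lambda>x. x \<in> A) \<pi>")
          case Nil
          then show ?thesis using True by (simp add: restrict_path_def)
        next
          case (Cons w ws)
          have s': "successively Q (remdups_adj (w # ws))"
            using IH Cons by (simp add: restrict_path_def)
          have "x = w \<or> Q x w"
          proof (cases "y \<in> A")
            case True
            then show ?thesis using xy Cons \<open>\<pi> = y # \<pi>'\<close> by auto
          next
            case False
            then have "x = z" using leave[OF xy True] by simp
            moreover have "w = z" using IH Cons False \<open>\<pi> = y # \<pi>'\<close> by auto
            ultimately show ?thesis by simp
          qed
          moreover have "hd (remdups_adj (w # ws)) = w" by simp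
          ultimately show ?thesis
            using s' True Cons by (cases "remdups_adj (w # ws)") (auto simp: restrict_path_def)
        qed
      qed
    qed
  qed
  then show ?thesis by blast
qed

lemma path_length_mono_suffix: "path_length (remdups_adj ys) \<le> path_length (remdups_adj (xs @ ys))"
proof (induction xs)
  case (Cons x xs)
  have "length (remdups_adj (xs @ ys)) \<le> length (remdups_adj (x # xs @ ys))"
    by (simp add: remdups_adj_Cons split: list.split)
  then show ?case using Cons by (simp add: path_length_def)
qed simp

lemma path_length_mono_prefix: "path_length (remdups_adj xs) \<le> path_length (remdups_adj (xs @ ys))"
  using path_length_mono_suffix[of "rev xs" "rev ys"]
  by (simp add: path_length_def flip: rev_append)

lemma remdups_adj_map_inj_on:
  assumes "inj_on h (set xs)"
  shows "remdups_adj (map h xs) = map h (remdups_adj xs)"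
  using assms
proof (induction xs rule: remdups_adj.induct)
  case (3 x y xs)
  then show ?case by (auto simp: inj_on_def)
qed auto

lemma successively_imp_remdups_adj_id:
  assumes "successively Q xs" "\<And>x y. Q x y \<Longrightarrow> x \<noteq> y"
  shows "remdups_adj xs = xs"
  using assms by (induction xs rule: remdups_adj.induct) auto

lemma successively_nbr_length:
  assumes "successively nbr xs" "xs \<noteq> []"
  shows "length (hd xs) \<le> length (last xs) + path_length xs"
  using assms
proof (induction xs rule: induct_list012)
  case (3 x y zs)
  then show ?case using nbr_length[of x y] by (auto simp: path_length_def)
qed auto

lemma successively_nbr_length_mem:
  assumes s: "successively nbr xs" and m: "x \<in> set xs"
  shows "length x \<le> length (last xs) + path_length xs"
proof -
  obtain as bs where xs: "xs = as @ x # bs" using m by (meson split_list)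
  then have "successively nbr (x # bs)" using s by (auto simp: successively_append_iff)
  from successively_nbr_length[OF this] show ?thesis using xs by (auto simp: path_length_def)
qed

lemma inj_on_drop_prefix:
  assumes "\<And>x. x \<in> A \<Longrightarrow> prefix u x"
  shows "inj_on (drop (length u)) A"
proof (rule inj_onI)
  fix x y assume "x \<in> A" "y \<in> A" and eq: "drop (length u) x = drop (length u) y"
  then obtain x' y' where "x = u @ x'" "y = u @ y'" using assms unfolding prefix_def by meson
  then show "x = y" using eq by simp
qed

lemma prefix_drop_iff:
  assumes "prefix v x" "prefix v u"
  shows "prefix (drop (length v) u) (drop (length v) x) \<longleftrightarrow> prefix u x"
  using assms by (auto simp: prefix_def)

section \<open>Final cone entries of a transient trajectory\<close>

definition final_entry :: "(nat \<Rightarrow> 'a list) \<Rightarrow> nat \<Rightarrow> nat" where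
  "final_entry x k = (LEAST l. length (x l) = k \<and> (\<forall>i\<ge>l. prefix (x l) (x i)))"

text \<open>The trajectory from the \<open>r\<close>-th to the \<open>k\<close>-th final cone entry, with the root of the \<open>r\<close>-th cone
  cancelled.  For \<open>r = 0\<close> this is the whole trajectory up to the \<open>k\<close>-th entry.\<close>

definition seg :: "(nat \<Rightarrow> 'a list) \<Rightarrow> nat \<Rightarrow> nat \<Rightarrow> 'a list list" where
  "seg x r k = map (\<lambda>i. drop r (x i)) [final_entry x r ..< Suc (final_entry x k)]"

text \<open>If \<open>b\<close> is the segment up to the \<open>k\<close>-th final cone entry, then \<open>butlast (last b)\<close> is the root of the
  final cone before it.  For the segment starting at time $0$ this is the path $\psi_k$; for later segments
  it is the part of $\psi_k$ that does not look back behind the start of the segment.\<close>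

definition cone_path :: "'a list list \<Rightarrow> 'a list list" where
  "cone_path b = (let u = butlast (last b) in map (drop (length u)) (remdups_adj (filter (prefix u) b)))"

text \<open>Applied to $\psi_k$, this removes the excursions into the interior of the \<open>k\<close>-th final cone, leaving
  $\pi_k$ with the root of the previous final cone cancelled.\<close>

definition trim :: "'a list list \<Rightarrow> 'a list list" where
  "trim p = remdups_adj (filter (\<lambda>z. z = last p \<or> \<not> prefix (last p) z) p)"

text \<open>Reading a segment backwards, the walk stays in the previous final cone exactly until the time of its
  final entry.  So this is the difference of the last two final cone entry times.\<close>

definition last_block_length :: "'a list list \<Rightarrow> nat" where
  "last_block_length b = length (takeWhile (prefix (butlast (last b))) (rev b)) - 1"

locale transient_path =
  fixes x :: "nat \<Rightarrow> 'a list"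
  assumes start: "x 0 = []"
    and step: "\<And>n. nbr (x n) (x (Suc n))"
    and finite_level: "\<And>k. finite {n. length (x n) = k}"
begin

abbreviation e :: "nat \<Rightarrow> nat" where "e \<equiv> final_entry x"

lemma final_entry_exists: "\<exists>l. length (x l) = k \<and> (\<forall>i\<ge>l. prefix (x l) (x i))"
proof -
  let ?S = "{n. length (x n) \<le> k}"
  have "?S = (\<Union>j\<le>k. {n. length (x n) = j})" by auto
  then have fin: "finite ?S" using finite_level by simp
  have "0 \<in> ?S" by (simp add: start)
  (* the last visit to a level at most k happens at level k and starts a cone that is never left *)
  define l where "l = Max ?S"
  have l: "length (x l) \<le> k" using Max_in[OF fin] \<open>0 \<in> ?S\<close> unfolding l_def by blast
  have after: "k < length (x i)" if "l < i" for i
    using Max_ge[OF fin, of i] that unfolding l_def by fastforce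
  have len: "length (x l) = k" using nbr_length[OF step[of l]] after[of "Suc l"] l by simp
  have "prefix (x l) (x i)" if "l \<le> i" for i
    using that
  proof (induction i rule: dec_induct)
    case (step i)
    show ?case
    proof (rule ccontr)
      assume "\<not> prefix (x l) (x (Suc i))"
      then have i: "x i = x l" using nbr_leaves_at_root[OF transient_path.step[OF transient_path_axioms]] step by blast
      then have "i = l" using after[of i] len step by (cases "i = l") auto
      then have "\<exists>v. x (Suc l) = x l @ [v]"
        using nbr_longer[OF transient_path.step[OF transient_path_axioms], of l] after[of "Suc l"] len by simp
      then show False using \<open>\<not> prefix (x l) (x (Suc i))\<close> \<open>i = l\<close> by auto
    qed
  qed simp
  then show ?thesis using len by blast
qed

lemma length_at_final_entry: "length (x (e k)) = k"
  and prefix_after_final_entry: "\<And>i. e k \<le> i \<Longrightarrow> prefix (x (e k)) (x i)"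
  unfolding final_entry_def using LeastI_ex[OF final_entry_exists[of k]] by blast+

lemma final_entry_least: "length (x l) = k \<Longrightarrow> (\<And>i. l \<le> i \<Longrightarrow> prefix (x l) (x i)) \<Longrightarrow> e k \<le> l"
  unfolding final_entry_def by (intro Least_le) blast

lemma final_entry_0 [simp]: "e 0 = 0"
  using final_entry_least[of 0 0] by (simp add: start)

lemma final_entry_strict_mono: "r < k \<Longrightarrow> e r < e k"
  using prefix_after_final_entry[of k "e r"] prefix_length_le length_at_final_entry
  by (metis linorder_not_less)

lemma final_entry_mono: "r \<le> k \<Longrightarrow> e r \<le> e k"
  using final_entry_strict_mono[of r k] by (cases "r = k") auto

lemma le_final_entry: "k \<le> e k"
  by (induction k) (auto intro: Suc_leI le_less_trans final_entry_strict_mono)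

lemma take_final_entry: "r \<le> k \<Longrightarrow> x (e r) = take r (x (e k))"
  using prefix_after_final_entry[OF final_entry_mono[of r k]] length_at_final_entry[of r]
  by (auto simp: prefix_def)

lemma prefix_final_entry: "r \<le> k \<Longrightarrow> prefix (x (e r)) (x (e k))"
  by (simp add: take_final_entry take_is_prefix)

lemma not_prefix_before_final_entry:
  assumes "1 \<le> k"
  shows "1 \<le> e k" "\<not> prefix (x (e k)) (x (e k - 1))"
proof -
  show pos: "1 \<le> e k" using final_entry_strict_mono[of 0 k] assms by simp
  show "\<not> prefix (x (e k)) (x (e k - 1))"
  proof
    assume last: "prefix (x (e k)) (x (e k - 1))"
    (* otherwise the walk would have entered the cone for good earlier, and through its root *)
    let ?P = "\<lambda>i. \<forall>j. i \<le> j \<longrightarrow> prefix (x (e k)) (x j)"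
    have P: "?P (e k - 1)"
    proof (intro allI impI)
      fix j assume "e k - 1 \<le> j"
      then show "prefix (x (e k)) (x j)"
        using last prefix_after_final_entry[of k j] by (cases "j = e k - 1") auto
    qed
    have "\<not> prefix (x (e k)) (x 0)" using start length_at_final_entry[of k] assms by (cases "x (e k)") auto
    then have "\<not> ?P 0" by blast
    define m where "m = (LEAST i. ?P i)"
    have m: "?P m" "m \<le> e k - 1" unfolding m_def by (rule LeastI[of ?P, OF P], rule Least_le[of ?P, OF P])
    have "m \<noteq> 0" using m \<open>\<not> ?P 0\<close> by metis
    then obtain m' where m': "m = Suc m'" by (cases m) auto
    have "m' < m" using m' by simp
    then have "\<not> ?P m'" unfolding m_def by (rule not_less_Least)
    then obtain j where "m' \<le> j" "\<not> prefix (x (e k)) (x j)" by blast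
    then have "\<not> prefix (x (e k)) (x m')" using m m' by (metis le_antisym not_less_eq_eq)
    then have "x m = x (e k)"
      using nbr_enters_at_root[OF step[of m']] m m' by auto
    then have "e k \<le> m" using m(1) length_at_final_entry[of k] by (intro final_entry_least) auto
    then show False using m(2) pos by simp
  qed
qed

text \<open>A time is the final entry time as soon as the walk arrives from outside a cone that it never leaves
  again.  Apart from the never leaving, this is a property of the path up to that time.\<close>

lemma final_entry_eqI:
  assumes "1 \<le> l" "length (x l) = k" "\<And>i. l \<le> i \<Longrightarrow> prefix (x l) (x i)" "\<not> prefix (x l) (x (l - 1))"
  shows "e k = l"
proof (rule ccontr)
  assume "e k \<noteq> l"
  then have lt: "e k < l" using final_entry_least[OF assms(2,3)] by simp
  then have "prefix (x (e k)) (x l)" by (intro prefix_after_final_entry) simp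
  then obtain zs where zs: "x l = x (e k) @ zs" by (auto simp: prefix_def)
  then have "length (x l) = k + length zs" using length_at_final_entry[of k] by simp
  then have "x (e k) = x l" using zs assms(2) by simp
  then show False using prefix_after_final_entry[of k "l - 1"] lt assms(4) by simp
qed

lemma seg_conv: "seg x r k = map (drop r) (map x [e r ..< Suc (e k)])"
  by (simp add: seg_def)

lemma prefix_on_segment:
  assumes "z \<in> set (map x [e r ..< Suc (e k)])"
  shows "prefix (x (e r)) z"
  using assms by (auto intro!: prefix_after_final_entry)

lemma seg_basic:
  assumes "r \<le> k"
  shows "seg x r k \<noteq> []" "hd (seg x r k) = []" "last (seg x r k) = drop r (x (e k))"
    "length (seg x r k) = Suc (e k - e r)"
proof -
  have *: "e r \<le> e k" by (rule final_entry_mono[OF assms])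
  then have "seg x r k = drop r (x (e r)) # map (\<lambda>i. drop r (x i)) [Suc (e r) ..< Suc (e k)]"
    by (simp add: seg_def upt_conv_Cons del: upt_Suc)
  then show "seg x r k \<noteq> []" "hd (seg x r k) = []" "length (seg x r k) = Suc (e k - e r)"
    using * length_at_final_entry[of r] by (simp_all del: upt_Suc)
  show "last (seg x r k) = drop r (x (e k))" using * by (simp add: seg_def)
qed

lemma seg_0: "seg x 0 k = map x [0 ..< Suc (e k)]"
  by (simp add: seg_def)

lemma butlast_last_seg:
  assumes "r < k"
  shows "butlast (last (seg x r k)) = drop r (x (e (k - 1)))"
proof -
  have "butlast (drop r (x (e k))) = drop r (take (k - 1) (x (e k)))"
    by (simp add: butlast_conv_take length_at_final_entry drop_take)
  then show ?thesis using assms seg_basic(3)[of r k] take_final_entry[of "k - 1" k] by simp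
qed

lemma cone_path_seg:
  assumes "r < k"
  shows "cone_path (seg x r k) =
    map (drop (k - 1)) (remdups_adj (filter (prefix (x (e (k - 1)))) (map x [e r ..< Suc (e k)])))"
proof -
  define L where "L = map x [e r ..< Suc (e k)]"
  define u where "u = x (e (k - 1))"
  have lu: "length u = k - 1" by (simp add: u_def length_at_final_entry)
  have vu: "prefix (x (e r)) u" using assms by (simp add: u_def prefix_final_entry)
  have "filter (prefix (drop r u)) (map (drop r) L) = map (drop r) (filter (prefix u) L)"
  proof -
    have "prefix (drop r u) (drop r z) \<longleftrightarrow> prefix u z" if "z \<in> set L" for z
      using prefix_drop_iff[OF prefix_on_segment vu] that length_at_final_entry[of r]
      unfolding L_def by simp
    then have "filter (prefix (drop r u) \<circ> drop r) L = filter (prefix u) L"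
      by (intro filter_cong) auto
    then show ?thesis by (simp add: filter_map)
  qed
  moreover have "inj_on (drop r) (set (filter (prefix u) L))"
    using inj_on_drop_prefix[of _ "x (e r)"] prefix_on_segment length_at_final_entry[of r]
    unfolding L_def by (metis (no_types, lifting) filter_is_subset subsetD)
  ultimately have "cone_path (seg x r k) =
      map (drop (length (drop r u))) (map (drop r) (remdups_adj (filter (prefix u) L)))"
    unfolding cone_path_def Let_def butlast_last_seg[OF assms]
    unfolding seg_conv L_def[symmetric] u_def[symmetric]
    by (simp add: remdups_adj_map_inj_on)
  also have "\<dots> = map (drop (k - 1)) (remdups_adj (filter (prefix u) L))"
    using assms lu by simp
  finally show ?thesis by (simp add: L_def u_def)
qed

lemma segment_split:
  assumes "r \<le> j" "j \<le> k"
  shows "map x [e r ..< Suc (e k)] = map x [e r ..< e j] @ map x [e j ..< Suc (e k)]"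
proof -
  have "[e r ..< Suc (e k)] = [e r ..< e j] @ [e j ..< Suc (e k)]"
    using final_entry_mono[OF assms(1)] final_entry_mono[OF assms(2)]
    by (metis le_Suc_eq le_add_diff_inverse upt_add_eq_append)
  then show ?thesis by simp
qed

text \<open>Starting later only drops a prefix of the path, so all moment bounds for $\psi_k$ are inherited.\<close>

lemma path_length_cone_path_seg_le:
  assumes "r < k"
  shows "path_length (cone_path (seg x r k)) \<le> path_length (cone_path (seg x 0 k))"
proof -
  have "map x [0 ..< Suc (e k)] = map x [0 ..< e r] @ map x [e r ..< Suc (e k)]"
    using segment_split[of 0 r k] assms by simp
  then show ?thesis
    using assms path_length_mono_suffix[of "filter (prefix (x (e (k - 1)))) (map x [e r ..< Suc (e k)])"
        "filter (prefix (x (e (k - 1)))) (map x [0 ..< e r])"]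
    by (simp only: cone_path_seg[of r k] cone_path_seg[of 0 k] final_entry_0 filter_append path_length_def length_map
       order.strict_trans1[of 0 r k])
qed

lemma successively_step: "successively nbr (map x [m ..< n])"
proof (induction n)
  case (Suc n)
  show ?case
  proof (cases "m < n")
    case True
    then have "last (map x [m ..< n]) = x (n - 1)" by (simp add: last_map)
    moreover have "nbr (x (n - 1)) (x n)" using step[of "n - 1"] True by simp
    ultimately show ?thesis using Suc True by (simp add: successively_append_iff)
  qed auto
qed simp

lemma successively_restrict_cone:
  "successively nbr (remdups_adj (filter (prefix u) (map x [m ..< n])))"
proof -
  have "successively nbr (restrict_path (map x [m ..< n]) {z. prefix u z})"
    by (rule restrict_path_through_gate[where z = u])
       (auto simp: successively_step dest: nbr_neq nbr_enters_at_root nbr_leaves_at_root)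
  then show ?thesis by (simp add: restrict_path_def)
qed

text \<open>A difference means that the cone of $X_{e_{k-1}}$ was visited before $e_r$.  That visit belongs to
  $\psi_{r+1}$, which has to descend from level $k-1$ to its end at level $r+1$ by steps of one level.\<close>

lemma cone_path_seg_differs:
  assumes "r < k" and ne: "cone_path (seg x r k) \<noteq> cone_path (seg x 0 k)"
  shows "k \<le> path_length (cone_path (seg x 0 (Suc r))) + r + 2"
proof -
  define u where "u = x (e (k - 1))"
  have sp: "map x [0 ..< Suc (e k)] = map x [0 ..< e r] @ map x [e r ..< Suc (e k)]"
    using segment_split[of 0 r k] assms by simp
  have "\<exists>l<e r. prefix u (x l)"
  proof (rule ccontr)
    assume "\<not> ?thesis"
    then have "filter (prefix u) (map x [0 ..< e r]) = []" by (auto simp: filter_empty_conv)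
    then have "cone_path (seg x 0 k) = cone_path (seg x r k)"
      using assms(1) cone_path_seg[of r k] cone_path_seg[of 0 k] sp by (simp add: u_def del: upt_Suc)
    then show False using ne by simp
  qed
  then obtain l where l: "l < e r" "prefix u (x l)" by blast
  define p where "p = remdups_adj (filter (prefix (x (e r))) (map x [0 ..< Suc (e (Suc r))]))"
  have "prefix (x (e r)) (x l)"
    using prefix_order.trans[OF prefix_final_entry[of r "k - 1"] l(2)[unfolded u_def]] assms(1) by simp
  moreover have "l < Suc (e (Suc r))" using l(1) final_entry_strict_mono[of r "Suc r"] by simp
  ultimately have mem: "x l \<in> set p" by (auto simp: p_def simp del: upt_Suc)
  have "last p = x (e (Suc r))" using prefix_final_entry[of r "Suc r"] by (simp add: p_def)
  then have "length (x l) \<le> Suc r + path_length p"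
    using successively_nbr_length_mem[OF _ mem] successively_restrict_cone[of "x (e r)"]
    by (simp add: p_def length_at_final_entry del: upt_Suc)
  moreover have "path_length p = path_length (cone_path (seg x 0 (Suc r)))"
    by (subst cone_path_seg) (simp_all add: p_def path_length_def del: upt_Suc)
  moreover have "k - 1 \<le> length (x l)"
    using prefix_length_le[OF l(2)] by (simp add: u_def length_at_final_entry)
  ultimately show ?thesis by linarith
qed

lemma last_block_length_seg:
  assumes "r < k"
  shows "last_block_length (seg x r k) = e k - e (k - 1)"
proof -
  let ?u = "x (e (k - 1))"
  let ?P = "prefix (drop r ?u) \<circ> drop r"
  have P: "?P z \<longleftrightarrow> prefix ?u z" if "z \<in> set (map x [e r ..< Suc (e k)])" for z
    using prefix_drop_iff[OF prefix_on_segment[OF that] prefix_final_entry[of r "k - 1"]] assms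
      length_at_final_entry[of r] by simp
  have sp: "map x [e r ..< Suc (e k)] = map x [e r ..< e (k - 1)] @ map x [e (k - 1) ..< Suc (e k)]"
    using assms by (intro segment_split) auto
  have "takeWhile (prefix (butlast (last (seg x r k)))) (rev (seg x r k))
      = map (drop r) (takeWhile ?P (rev (map x [e r ..< Suc (e k)])))"
    unfolding butlast_last_seg[OF assms] unfolding seg_conv rev_map takeWhile_map by (simp add: comp_def)
  also have "takeWhile ?P (rev (map x [e r ..< Suc (e k)])) =
      rev (map x [e (k - 1) ..< Suc (e k)]) @ takeWhile ?P (rev (map x [e r ..< e (k - 1)]))"
    unfolding sp rev_append
  proof (rule takeWhile_append2)
    fix z assume "z \<in> set (rev (map x [e (k - 1) ..< Suc (e k)]))"
    then have z: "z \<in> set (map x [e (k - 1) ..< Suc (e k)])" by (simp only: set_rev)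
    then have "z \<in> set (map x [e r ..< Suc (e k)])" unfolding sp set_append by blast
    moreover have "prefix ?u z" using z by (auto intro!: prefix_after_final_entry simp del: upt_Suc)
    ultimately show "?P z" using P by blast
  qed
  also have "takeWhile ?P (rev (map x [e r ..< e (k - 1)])) = []"
  proof (cases "r = k - 1")
    case False
    then have lt: "e r < e (k - 1)" using assms by (intro final_entry_strict_mono) auto
    then obtain m where m: "e (k - 1) = Suc m" "e r \<le> m" by (cases "e (k - 1)") auto
    have "\<not> ?P (x m)"
      using not_prefix_before_final_entry(2)[of "k - 1"] False assms m P[of "x m"]
        final_entry_mono[of "k - 1" k] by auto
    then show ?thesis using m by simp
  qed simp
  finally show ?thesis
    using final_entry_mono[of "k - 1" k] by (simp add: last_block_length_def)
qed

lemma block_length_le: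
  assumes "1 \<le> k"
  shows "e k - e (k - 1) \<le> path_length (cone_path (seg x 0 k))"
proof -
  let ?u = "x (e (k - 1))"
  let ?B = "map x [e (k - 1) ..< Suc (e k)]"
  have "filter (prefix ?u) ?B = ?B"
    using prefix_after_final_entry[of "k - 1"] by (intro filter_True) auto
  moreover have "remdups_adj ?B = ?B"
    by (rule successively_imp_remdups_adj_id[OF successively_step nbr_neq])
  moreover have "map x [0 ..< Suc (e k)] = map x [0 ..< e (k - 1)] @ ?B"
    using segment_split[of 0 "k - 1" k] by simp
  ultimately have "path_length ?B \<le> path_length (remdups_adj (filter (prefix ?u) (map x [0 ..< Suc (e k)])))"
    using path_length_mono_suffix[of ?B "filter (prefix ?u) (map x [0 ..< e (k - 1)])"]
    by (simp only: filter_append)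
  then show ?thesis
    using assms final_entry_mono[of "k - 1" k] cone_path_seg[of 0 k]
    by (simp add: path_length_def del: upt_Suc)
qed

lemma trim_cone_path_seg:
  assumes "r < k"
  shows "trim (cone_path (seg x r k)) = map (drop (k - 1))
    (restrict_path (restrict_path (map x [e r ..< Suc (e k)]) {z. prefix (x (e (k - 1))) z})
       {z. z = x (e k) \<or> \<not> prefix (x (e k)) z})"
proof -
  define q where "q = remdups_adj (filter (prefix (x (e (k - 1)))) (map x [e r ..< Suc (e k)]))"
  let ?u = "x (e (k - 1))" and ?v = "x (e k)"
  have uv: "prefix ?u ?v" by (rule prefix_final_entry) simp
  have q_pre: "prefix ?u z" if "z \<in> set q" for z using that by (simp add: q_def)
  have lu: "length ?u = k - 1" by (rule length_at_final_entry)
  have "q \<noteq> []" "last q = ?v"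
    using uv final_entry_mono[of r k] assms by (auto simp: q_def)
  have "filter (\<lambda>z. z = drop (k - 1) ?v \<or> \<not> prefix (drop (k - 1) ?v) z) (map (drop (k - 1)) q)
      = map (drop (k - 1)) (filter (\<lambda>z. z = ?v \<or> \<not> prefix ?v z) q)"
  proof -
    have "drop (k - 1) z = drop (k - 1) ?v \<longleftrightarrow> z = ?v" if "z \<in> set q" for z
      using q_pre[OF that] uv lu by (auto simp: prefix_def)
    moreover have "prefix (drop (k - 1) ?v) (drop (k - 1) z) \<longleftrightarrow> prefix ?v z" if "z \<in> set q" for z
      using prefix_drop_iff[OF q_pre[OF that] uv] lu by simp
    ultimately show ?thesis unfolding filter_map by (intro arg_cong[where f = "map _"] filter_cong) auto
  qed
  moreover have "inj_on (drop (k - 1)) (set (filter (\<lambda>z. z = ?v \<or> \<not> prefix ?v z) q))"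
    using inj_on_drop_prefix[of "set (filter (\<lambda>z. z = ?v \<or> \<not> prefix ?v z) q)" ?u] q_pre lu by auto
  moreover have "restrict_path (map x [e r ..< Suc (e k)]) {z. prefix ?u z} = q"
    by (simp only: restrict_path_def q_def mem_Collect_eq)
  moreover have "last (map (drop (k - 1)) q) = drop (k - 1) ?v"
    using \<open>q \<noteq> []\<close> \<open>last q = ?v\<close> by (simp add: last_map)
  ultimately show ?thesis
    unfolding cone_path_seg[OF assms] q_def[symmetric] trim_def
    by (simp only: remdups_adj_map_inj_on restrict_path_def[of q] mem_Collect_eq)
qed

end

section \<open>Words and transition probabilities of the free product\<close>

locale free_product_walk =
  fixes F :: "'a free_factors" and \<alpha> :: real
  assumes valid: "free_factors_valid F" and \<alpha>: "0 < \<alpha>" "\<alpha> < 1"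
begin

(* keeps the index 1 of the first factor a numeral *)
declare One_nat_def [simp del]

abbreviation W :: "'a list set" where "W \<equiv> free_words F"
abbreviation L :: "nat \<Rightarrow> 'a set" where "L \<equiv> letters F"
abbreviation ty :: "'a list \<Rightarrow> nat" where "ty \<equiv> word_type F"
abbreviation sw :: "nat \<Rightarrow> 'a list set" where "sw \<equiv> start_words F"
abbreviation q :: "'a list \<Rightarrow> 'a list \<Rightarrow> real" where "q \<equiv> free_trans F \<alpha>"

lemma letters_disjoint: "v \<in> L 1 \<Longrightarrow> v \<in> L 2 \<Longrightarrow> False"
  using valid by (auto simp: free_factors_valid_def letters_def)

lemma Nil_in_words [simp]: "[] \<in> W"
  by (simp add: free_words_def)

lemma Nil_in_start_words [simp]: "[] \<in> sw i"
  by (simp add: start_words_def)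

lemma start_words_subset: "sw i \<subseteq> W"
  by (auto simp: start_words_def)

lemma type_Nil [simp]: "ty [] = 0"
  by (simp add: word_type_def)

lemma type_snoc: "ty (x @ [v]) = (if v \<in> L 1 then 1 else 2)"
  by (simp add: word_type_def)

lemma type_append: "u \<noteq> [] \<Longrightarrow> ty (x @ u) = ty u"
  by (simp add: word_type_def)

lemma type_cases: "x \<noteq> [] \<Longrightarrow> ty x = 1 \<or> ty x = 2"
  by (simp add: word_type_def)

lemma words_append: "x @ u \<in> W \<longleftrightarrow> x \<in> W \<and> u \<in> W \<and>
    (x = [] \<or> u = [] \<or> \<not> (\<exists>i\<in>{1, 2}. last x \<in> L i \<and> hd u \<in> L i))"
  by (auto simp: free_words_def successively_append_iff)

lemma last_letter: "x \<in> W \<Longrightarrow> x \<noteq> [] \<Longrightarrow> last x \<in> L i \<longleftrightarrow> ty x = i" if "i \<in> {1, 2}"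
proof -
  assume x: "x \<in> W" "x \<noteq> []"
  then have "set x \<subseteq> L 1 \<union> L 2" by (simp add: free_words_def)
  then have "last x \<in> L 1 \<union> L 2" using last_in_set[OF x(2)] by blast
  then show "last x \<in> L i \<longleftrightarrow> ty x = i"
    using that x letters_disjoint by (auto simp: word_type_def)
qed

lemma hd_letter: "u \<in> W \<Longrightarrow> u \<noteq> [] \<Longrightarrow> hd u \<in> L 1 \<or> hd u \<in> L 2"
  using hd_in_set[of u] unfolding free_words_def by blast

lemma words_append_iff:
  assumes x: "x \<in> W" "x \<noteq> []"
  shows "x @ u \<in> W \<longleftrightarrow> u \<in> sw (3 - ty x)"
proof (cases "u = []")
  case False
  have "\<not> (\<exists>i\<in>{1, 2}. last x \<in> L i \<and> hd u \<in> L i) \<longleftrightarrow> hd u \<in> L (3 - ty x)" if "u \<in> W"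
    using hd_letter[OF that False] type_cases[OF x(2)] last_letter[OF _ x, of 1] last_letter[OF _ x, of 2]
      letters_disjoint[of "hd u"] by (auto simp flip: One_nat_def)
  then show ?thesis using x False by (auto simp: words_append start_words_def)
qed (use x in simp)

lemma cone_image: "x \<in> W \<Longrightarrow> x \<noteq> [] \<Longrightarrow> cone F x = (@) x ` sw (3 - ty x)"
  by (auto simp: cone_def words_append_iff)

lemma cone_iff: "y \<in> cone F x \<longleftrightarrow> y \<in> W \<and> prefix x y"
  by (auto simp: cone_def prefix_def)

text \<open>Hence the type of $X_{e_r}$ is determined by \<open>r\<close> and the type of the first letter.\<close>

lemma type_alternates:
  assumes "w \<in> W" "w \<noteq> []"
  shows "ty w = (if odd (length w) then ty [hd w] else 3 - ty [hd w])"
  using assms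
proof (induction w rule: rev_induct)
  case (snoc v w)
  show ?case
  proof (cases "w = []")
    case False
    have w: "w \<in> W" using snoc.prems words_append by blast
    have "[v] \<in> sw (3 - ty w)" using snoc.prems words_append_iff[OF w False] by simp
    then have "v \<in> L (3 - ty w)" by (simp add: start_words_def)
    then have "ty (w @ [v]) = 3 - ty w"
      using type_cases[OF False] letters_disjoint[of v] by (auto simp: type_snoc simp flip: One_nat_def)
    moreover have "ty [hd w] = 1 \<or> ty [hd w] = 2" by (rule type_cases) simp
    ultimately show ?thesis using snoc.IH[OF w False] False by auto
  qed simp
qed simp

lemma words_countable: "countable W"
proof (rule countable_subset)
  show "W \<subseteq> lists (L 1 \<union> L 2)" by (auto simp: free_words_def)
  have "countable (L i)" if "i \<in> {1, 2}" for i
    using valid that by (auto simp: free_factors_valid_def letters_def)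
  then have "countable (L 1 \<union> L 2)" by (intro countable_Un) auto
  then show "countable (lists (L 1 \<union> L 2))" by (rule countable_lists)
qed

lemma factor_trans_nonneg: "i \<in> {1, 2} \<Longrightarrow> v \<in> verts F i \<Longrightarrow> w \<in> verts F i \<Longrightarrow> 0 \<le> ptrans F i v w"
  using valid unfolding free_factors_valid_def transition_matrix_def by blast

lemma factor_trans_refl: "i \<in> {1, 2} \<Longrightarrow> v \<in> verts F i \<Longrightarrow> ptrans F i v v = 0"
  using valid unfolding free_factors_valid_def by blast

lemma lifted_nonneg: "i \<in> {1, 2} \<Longrightarrow> 0 \<le> lifted_trans F i x y"
  using factor_trans_nonneg[of i] free_word_decomp(3)[OF valid, of i x] free_word_decomp(3)[OF valid, of i y]
  by (simp add: lifted_trans_def)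

lemma lifted_refl: "i \<in> {1, 2} \<Longrightarrow> lifted_trans F i x x = 0"
  using factor_trans_refl[of i] free_word_decomp(3)[OF valid, of i x]
  by (simp add: lifted_trans_def)

lemma q_nonneg [simp]: "0 \<le> q x y"
  using lifted_nonneg \<alpha> by (simp add: free_trans_def)

lemma q_refl [simp]: "q x x = 0"
  using lifted_refl by (simp add: free_trans_def)

lemma q_pos_imp:
  assumes "0 < q x y"
  shows "nbr x y" "x \<in> W" "y \<in> W"
proof -
  obtain i where i: "i \<in> {1, 2}" "lifted_trans F i x y \<noteq> 0"
  proof -
    have "lifted_trans F 1 x y \<noteq> 0 \<or> lifted_trans F 2 x y \<noteq> 0"
      using assms by (auto simp: free_trans_def)
    then show thesis using that by blast
  qed
  then show "x \<in> W" "y \<in> W" by (meson lifted_trans_def)+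
  have "x \<noteq> y" using assms by auto
  moreover have "\<exists>u v w. x = u @ embed F i v \<and> y = u @ embed F i w"
    using lifted_trans_eq_0[OF valid i(1), of x y] i(2) by blast
  then obtain u v w where "x = u @ embed F i v" "y = u @ embed F i w" by blast
  then have "(x = u \<or> (\<exists>v. x = u @ [v])) \<and> (y = u \<or> (\<exists>v. y = u @ [v]))"
    by (simp add: embed_def)
  ultimately show "nbr x y" unfolding nbr_def by blast
qed

text \<open>
  Cancelling a common prefix leaves all parts of the definition unchanged, except at the root \<open>x\<close> of
  the cone: there the copy of the factor containing the last letter of \<open>x\<close> offers moves out of the cone,
  while the empty word offers moves to first letters of that factor.  Restricting to words that start with
  the other factor excludes both.\<close>

lemma lifted_shift:
  assumes x: "x \<in> W" "x \<noteq> []" and u: "u \<in> sw (3 - ty x)" and v: "v \<in> sw (3 - ty x)"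
    and i: "i \<in> {1, 2}"
  shows "lifted_trans F i (x @ u) (x @ v) = lifted_trans F i u v"
proof -
  have inW: "x @ u \<in> W" "x @ v \<in> W" "u \<in> W" "v \<in> W"
    using x u v words_append_iff start_words_subset by blast+
  have bp: "base_part F i (x @ w) = x @ base_part F i w" "factor_part F i (x @ w) = factor_part F i w"
    if "w \<noteq> []" for w
    using that by (simp_all add: base_part_def factor_part_def type_append butlast_append)
  have root_case: "base_part F i x = base_part F i (x @ w) \<longleftrightarrow> base_part F i [] = base_part F i w"
    "base_part F i [] = base_part F i w \<Longrightarrow> factor_part F i x = factor_part F i []"
    if w: "w \<in> sw (3 - ty x)" "w \<noteq> []" for w
  proof -
    show "base_part F i x = base_part F i (x @ w) \<longleftrightarrow> base_part F i [] = base_part F i w"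
    proof (cases "ty x = i")
      case False
      then have "base_part F i x = x" "base_part F i [] = []" using i by (auto simp: base_part_def)
      then show ?thesis unfolding bp[OF w(2)] by auto
    next
      case True
      have "length (base_part F i x) < length x" using True x by (simp add: base_part_def)
      moreover have "length x \<le> length (base_part F i (x @ w))" by (simp add: bp[OF w(2)])
      moreover have "base_part F i w \<noteq> []"
      proof
        assume "base_part F i w = []"
        then have "ty w = i" "butlast w = []" using w(2) by (auto simp: base_part_def split: if_splits)
        then obtain a where a: "w = [a]" using w(2) by (metis append_butlast_last_id append_Nil)
        then have "a \<in> L (3 - i)" using w(1) True by (simp add: start_words_def)
        moreover have "a \<in> L i"
          using \<open>ty w = i\<close> a i last_letter[OF i, of w] w start_words_subset by auto
        ultimately show False using i letters_disjoint[of a] by (auto simp flip: One_nat_def)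
      qed
      ultimately show ?thesis using i by (auto simp: base_part_def)
    qed
    show "factor_part F i x = factor_part F i []" if e: "base_part F i [] = base_part F i w"
    proof (cases "ty x = i")
      case True
      have "length (base_part F i x) < length x" using True x by (simp add: base_part_def)
      moreover have "length x \<le> length (base_part F i (x @ w))" by (simp add: bp[OF w(2)])
      ultimately show ?thesis
        using e \<open>base_part F i x = base_part F i (x @ w) \<longleftrightarrow> base_part F i [] = base_part F i w\<close> by auto
    qed (use i in \<open>auto simp: factor_part_def\<close>)
  qed
  consider "u = []" "v = []" | "u = []" "v \<noteq> []" | "u \<noteq> []" "v = []" | "u \<noteq> []" "v \<noteq> []" by blast
  then show ?thesis
  proof cases
    case 1
    then show ?thesis using lifted_refl[OF i] by simp
  next
    case 2
    show ?thesis
    proof (cases "base_part F i [] = base_part F i v")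
      case True
      then have "base_part F i x = base_part F i (x @ v)" "factor_part F i x = factor_part F i []"
        using root_case[OF v 2(2)] by blast+
      then show ?thesis
        using True inW bp(2)[OF 2(2)] x unfolding lifted_trans_def 2(1) append_Nil2 by simp
    next
      case False
      then have "base_part F i x \<noteq> base_part F i (x @ v)" using root_case(1)[OF v 2(2)] by blast
      then show ?thesis using False unfolding lifted_trans_def 2(1) append_Nil2 by simp
    qed
  next
    case 3
    show ?thesis
    proof (cases "base_part F i [] = base_part F i u")
      case True
      then have "base_part F i x = base_part F i (x @ u)" "factor_part F i x = factor_part F i []"
        using root_case[OF u 3(1)] by blast+
      then show ?thesis
        using True inW bp(2)[OF 3(1)] x unfolding lifted_trans_def 3(2) append_Nil2 by simp
    next
      case False
      then have "base_part F i (x @ u) \<noteq> base_part F i x" using root_case(1)[OF u 3(1)] by metis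
      then show ?thesis using False unfolding lifted_trans_def 3(2) append_Nil2 by simp
    qed
  next
    case 4
    show ?thesis
      unfolding lifted_trans_def bp[OF 4(1)] bp[OF 4(2)] by (simp add: inW)
  qed
qed

lemma q_shift:
  assumes "x \<in> W" "x \<noteq> []" "u \<in> sw (3 - ty x)" "v \<in> sw (3 - ty x)"
  shows "q (x @ u) (x @ v) = q u v"
  using lifted_shift[OF assms] by (simp add: free_trans_def)

text \<open>The first step inside a factor cannot stay at the root, since the factor chains have no loops.\<close>

lemma first_letter_reachable:
  assumes i: "i \<in> {1, 2}"
  shows "\<exists>v. [v] \<in> sw i \<and> ty [v] = i \<and> 0 < q [] [v]"
proof -
  let ?r = "root F i"
  have r: "?r \<in> verts F i" and sum1: "(ptrans F i ?r has_sum 1) (verts F i)"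
    using valid i unfolding free_factors_valid_def transition_matrix_def by blast+
  have "\<exists>v\<in>verts F i. ptrans F i ?r v \<noteq> 0"
  proof (rule ccontr)
    assume "\<not> ?thesis"
    then have "(ptrans F i ?r has_sum 0) (verts F i)" by (intro has_sum_0) auto
    then show False using sum1 has_sum_unique by fastforce
  qed
  then obtain v where v: "v \<in> verts F i" "ptrans F i ?r v \<noteq> 0" by blast
  then have pos: "0 < ptrans F i ?r v" using factor_trans_nonneg[OF i r v(1)] by simp
  have "v \<noteq> ?r" using v factor_trans_refl[OF i r] by auto
  then have vl: "v \<in> L i" using v by (simp add: letters_def)
  have "lifted_trans F i ([] @ embed F i ?r) ([] @ embed F i v) = ptrans F i ?r v"
    using i r v by (intro lifted_trans_concat valid) auto
  then have l: "0 < lifted_trans F i [] [v]" using pos \<open>v \<noteq> ?r\<close> by (simp add: embed_def)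
  have "0 < q [] [v]"
  proof (cases "i = 1")
    case True
    have "0 < \<alpha> * lifted_trans F 1 [] [v]" using l \<alpha> True by simp
    moreover have "0 \<le> (1 - \<alpha>) * lifted_trans F 2 [] [v]" using lifted_nonneg \<alpha> by simp
    ultimately show ?thesis unfolding free_trans_def by linarith
  next
    case False
    then have "0 < (1 - \<alpha>) * lifted_trans F 2 [] [v]" using l \<alpha> i by simp
    moreover have "0 \<le> \<alpha> * lifted_trans F 1 [] [v]" using lifted_nonneg \<alpha> by simp
    ultimately show ?thesis unfolding free_trans_def by linarith
  qed
  moreover have "[v] \<in> sw i" using vl i by (auto simp: start_words_def free_words_def)
  moreover have "ty [v] = i" using vl i letters_disjoint by (auto simp: word_type_def)
  ultimately show ?thesis by blast
qed

lemma q_pos_start_words: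
  assumes q: "0 < q x y" and x: "x \<in> sw j" "x \<noteq> []" and y: "y \<noteq> []" and j: "j \<in> {1, 2}"
  shows "y \<in> sw j"
proof -
  obtain i where i: "i \<in> {1, 2}" "lifted_trans F i x y \<noteq> 0"
  proof -
    have "lifted_trans F 1 x y \<noteq> 0 \<or> lifted_trans F 2 x y \<noteq> 0"
      using q by (auto simp: free_trans_def)
    then show thesis using that by blast
  qed
  then obtain u v w where d: "u \<in> W" "v \<in> verts F i" "w \<in> verts F i"
      "x = u @ embed F i v" "y = u @ embed F i w"
    using lifted_trans_eq_0[OF valid i(1), of x y] by blast
  have "hd y \<in> L j"
  proof (cases "u = []")
    case True
    then have "v \<in> L i" "w \<in> L i" "x = [v]" "y = [w]"
      using d x y by (auto simp: letters_def embed_def split: if_splits)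
    moreover have "v \<in> L j" using x \<open>x = [v]\<close> by (simp add: start_words_def)
    ultimately show ?thesis using i(1) j letters_disjoint by auto
  next
    case False
    then have "hd y = hd x" using d by simp
    then show ?thesis using x by (simp add: start_words_def)
  qed
  then show ?thesis using q_pos_imp(3)[OF q] by (simp add: start_words_def)
qed

lemma q_pos_unshift:
  assumes q: "0 < q x y" and pre: "prefix v x" "prefix v y" and v: "v \<noteq> []"
  shows "0 < q (drop (length v) x) (drop (length v) y)"
proof -
  obtain a b where ab: "x = v @ a" "y = v @ b" using pre by (auto simp: prefix_def)
  have W: "v @ a \<in> W" "v @ b \<in> W" using q_pos_imp[OF q] ab by auto
  then have vW: "v \<in> W" using words_append by blast
  have "q (v @ a) (v @ b) = q a b"
    using W words_append_iff[OF vW v] by (intro q_shift vW v) auto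
  then show ?thesis using q ab by simp
qed

end

section \<open>The decomposition of a walk at its final cone entries\<close>

locale transient_walk = free_product_walk F \<alpha> + transient_path "\<lambda>i. X i \<omega>"
  for F :: "'a free_factors" and \<alpha> :: real and X :: "nat \<Rightarrow> 'w \<Rightarrow> 'a list" and \<omega> :: 'w +
  assumes q_step: "\<And>n. 0 < q (X n \<omega>) (X (Suc n) \<omega>)"
begin

abbreviation x :: "nat \<Rightarrow> 'a list" where "x \<equiv> \<lambda>i. X i \<omega>"

lemma in_words [simp]: "X n \<omega> \<in> W"
  using q_pos_imp(2)[OF q_step] .

lemma exit_time_eq: "exit_time F X k \<omega> = enat (e k)"
proof (cases "k = 0")
  case True
  then show ?thesis by (simp add: exit_time_def zero_enat_def)
next
  case False
  let ?S = "{l. l \<ge> 1 \<and> length (X l \<omega>) = k \<and> (\<forall>i\<ge>l. X i \<omega> \<in> cone F (X l \<omega>))}"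
  have "e k \<in> ?S"
    using False not_prefix_before_final_entry(1)[of k] length_at_final_entry[of k] prefix_after_final_entry[of k]
    by (simp add: cone_iff)
  moreover have "e k \<le> l" if "l \<in> ?S" for l
    using that by (intro final_entry_least) (auto simp: cone_iff)
  ultimately have "Inf (enat ` ?S) = enat (e k)"
    by (intro antisym Inf_lower Inf_greatest) auto
  then show ?thesis using False by (simp add: exit_time_def)
qed

lemma exit_pt_eq: "exit_pt F X k \<omega> = X (e k) \<omega>"
  by (simp add: exit_pt_def exit_time_eq)

lemma exit_traj_eq: "exit_traj F X k \<omega> = map x [0 ..< Suc (e k)]"
  by (simp add: exit_traj_def exit_time_eq traj_def)

lemma restrict_cone_eq:
  "restrict_path (map x I) (cone F u) = remdups_adj (filter (prefix u) (map x I))"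
proof -
  have "filter (\<lambda>z. z \<in> cone F u) (map x I) = filter (prefix u) (map x I)"
    by (intro filter_cong) (auto simp: cone_iff)
  then show ?thesis by (simp add: restrict_path_def)
qed

lemma psi_eq:
  assumes "2 \<le> k"
  shows "psi F X k \<omega> = cone_path (seg x 0 k)"
  using assms cone_path_seg[of 0 k]
  unfolding psi_def exit_traj_eq exit_pt_eq restrict_cone_eq unprefix_path_def length_at_final_entry
  by (simp del: upt_Suc)

lemma path_piece_eq:
  assumes "1 \<le> k"
  shows "unprefix_path (exit_pt F X (k - 1) \<omega>) (path_piece F X k \<omega>) = trim (cone_path (seg x 0 k))"
proof -
  define p where "p = restrict_path (map x [0 ..< Suc (e k)]) {z. prefix (X (e (k - 1)) \<omega>) z}"
  have p: "restrict_path (map x [0 ..< Suc (e k)]) (cone F (X (e (k - 1)) \<omega>)) = p"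
    unfolding restrict_cone_eq p_def by (simp add: restrict_path_def)
  have "set p \<subseteq> W" by (auto simp: p_def restrict_path_def simp del: upt_Suc)
  then have "filter (\<lambda>z. z \<in> cone_compl F (X (e k) \<omega>)) p = filter (\<lambda>z. z = X (e k) \<omega> \<or> \<not> prefix (X (e k) \<omega>) z) p"
    by (intro filter_cong) (auto simp: cone_compl_def cone_iff)
  then show ?thesis
    using assms trim_cone_path_seg[of 0 k]
    unfolding path_piece_def exit_traj_eq exit_pt_eq p unprefix_path_def length_at_final_entry
    by (simp add: p_def[symmetric] restrict_path_def[of p] del: upt_Suc)
qed

lemma successively_q: "successively (\<lambda>x y. 0 < q x y) (map x [m ..< n])"
proof (induction n)
  case (Suc n)
  show ?case
  proof (cases "m < n")
    case True
    then have "last (map x [m ..< n]) = x (n - 1)" by (simp add: last_map)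
    moreover have "0 < q (x (n - 1)) (x n)" using q_step[of "n - 1"] True by simp
    ultimately show ?thesis using Suc True by (simp add: successively_append_iff)
  qed auto
qed simp

lemma successively_q_restrict_cone:
  assumes "successively (\<lambda>x y. 0 < q x y) \<pi>"
  shows "successively (\<lambda>x y. 0 < q x y) (restrict_path \<pi> {z. prefix u z})"
  by (rule restrict_path_through_gate[where z = u])
     (use assms nbr_neq[OF q_pos_imp(1)] nbr_enters_at_root[OF q_pos_imp(1)]
        nbr_leaves_at_root[OF q_pos_imp(1)] in auto)

lemma successively_q_restrict_complement:
  assumes "successively (\<lambda>x y. 0 < q x y) \<pi>"
  shows "successively (\<lambda>x y. 0 < q x y) (restrict_path \<pi> {z. z = v \<or> \<not> prefix v z})"
  by (rule restrict_path_through_gate[where z = v])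
     (use assms nbr_neq[OF q_pos_imp(1)] nbr_enters_at_root[OF q_pos_imp(1)]
        nbr_leaves_at_root[OF q_pos_imp(1)] in auto)

lemma trim_in_paths:
  assumes "r < k" "2 \<le> k"
  shows "trim (cone_path (seg x r k)) \<in> paths F \<alpha>"
proof -
  define u where "u = X (e (k - 1)) \<omega>"
  define p where "p = restrict_path (restrict_path (map x [e r ..< Suc (e k)]) {z. prefix u z})
       {z. z = x (e k) \<or> \<not> prefix (x (e k)) z}"
  have lu: "length u = k - 1" by (simp add: u_def length_at_final_entry)
  then have une: "u \<noteq> []" using assms by auto
  have s: "successively (\<lambda>x y. 0 < q x y) p"
    unfolding p_def
    by (intro successively_q_restrict_complement successively_q_restrict_cone successively_q)
  have pre: "prefix u z" "z \<in> W" if "z \<in> set p" for z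
    using that by (auto simp: p_def restrict_path_def simp del: upt_Suc)
  have "x (e k) \<in> set p"
    using assms final_entry_mono[of r k] prefix_final_entry[of "k - 1" k]
    by (auto simp: p_def restrict_path_def u_def simp del: upt_Suc)
  then have ne: "p \<noteq> []" by auto
  have "successively (\<lambda>x y. 0 < q (drop (length u) x) (drop (length u) y)) p"
  proof (rule successively_mono[OF s])
    fix y z assume "y \<in> set p" "z \<in> set p" "0 < q y z"
    then show "0 < q (drop (length u) y) (drop (length u) z)"
      by (intro q_pos_unshift pre(1) une)
  qed
  then have s': "successively (\<lambda>x y. 0 < q x y) (map (drop (length u)) p)"
    by (simp add: successively_map)
  have "drop (length u) z \<in> W" if z: "z \<in> set p" for z
  proof -
    obtain a where "z = u @ a" using pre(1)[OF z] by (auto simp: prefix_def)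
    then show ?thesis using pre[OF z] words_append by auto
  qed
  then have "map (drop (length u)) p \<in> paths F \<alpha>"
    using s' ne by (auto simp: paths_def)
  then show ?thesis using trim_cone_path_seg[OF assms(1)] lu by (simp add: p_def u_def del: upt_Suc)
qed

lemma path_length_trim_le: "path_length (trim p) \<le> path_length p"
proof -
  have "length (trim p) \<le> length p"
    unfolding trim_def by (rule order.trans[OF remdups_adj_length length_filter_le])
  then show ?thesis by (simp add: path_length_def)
qed

lemma last_exit_props:
  shows "e (last_exit F X n \<omega>) \<le> n" "n < e (Suc (last_exit F X n \<omega>))"
proof -
  have eq: "last_exit F X n \<omega> = Max {k. e k \<le> n}"
    by (simp add: last_exit_def exit_time_eq)
  have fin: "finite {k. e k \<le> n}"
  proof (rule finite_subset)
    show "{k. e k \<le> n} \<subseteq> {..n}"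
    proof
      fix k assume "k \<in> {k. e k \<le> n}"
      then show "k \<in> {..n}" using le_final_entry[of k] by simp
    qed
  qed simp
  have "0 \<in> {k. e k \<le> n}" by simp
  then show "e (last_exit F X n \<omega>) \<le> n" using Max_in[OF fin] unfolding eq by blast
  show "n < e (Suc (last_exit F X n \<omega>))"
  proof (rule ccontr)
    assume "\<not> n < e (Suc (last_exit F X n \<omega>))"
    then have "Suc (last_exit F X n \<omega>) \<in> {k. e k \<le> n}" by simp
    from Max_ge[OF fin this] show False unfolding eq by simp
  qed
qed

lemma path_rest_in_paths: "path_rest F X n \<omega> \<in> paths F \<alpha>"
  and path_length_path_rest_le:
    "path_length (path_rest F X n \<omega>) \<le> path_length (cone_path (seg x 0 (Suc (last_exit F X n \<omega>))))"
proof -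
  define k where "k = last_exit F X n \<omega>"
  define u where "u = x (e k)"
  note k = last_exit_props[of n, folded k_def]
  have eq: "path_rest F X n \<omega> = restrict_path (map x [0 ..< Suc n]) {z. prefix u z}"
    unfolding path_rest_def traj_def exit_pt_eq k_def[symmetric] restrict_cone_eq u_def
    by (simp only: restrict_path_def mem_Collect_eq)
  have "u \<in> set (map x [0 ..< Suc n])"
    unfolding u_def set_map using k(1) by (intro imageI) (simp del: upt_Suc)
  then have "u \<in> set (restrict_path (map x [0 ..< Suc n]) {z. prefix u z})"
    by (simp add: restrict_path_def del: upt_Suc)
  then have "restrict_path (map x [0 ..< Suc n]) {z. prefix u z} \<noteq> []"
    by (metis empty_iff empty_set)
  moreover have "set (restrict_path (map x [0 ..< Suc n]) {z. prefix u z}) \<subseteq> W"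
    by (auto simp: restrict_path_def simp del: upt_Suc)
  ultimately show "path_rest F X n \<omega> \<in> paths F \<alpha>"
    using successively_q_restrict_cone[OF successively_q[of 0 "Suc n"], of u]
    unfolding eq paths_def by (simp del: upt_Suc)
  have "[0 ..< Suc (e (Suc k))] = [0 ..< Suc n] @ [Suc n ..< Suc (e (Suc k))]"
    using k upt_add_eq_append[of 0 "Suc n" "e (Suc k) - n"] by simp
  then have "path_length (path_rest F X n \<omega>) \<le>
      path_length (remdups_adj (filter (prefix u) (map x [0 ..< Suc (e (Suc k))])))"
    unfolding eq restrict_path_def
    using path_length_mono_prefix[of "filter (prefix u) (map x [0 ..< Suc n])"
        "filter (prefix u) (map x [Suc n ..< Suc (e (Suc k))])"]
    by (simp del: upt_Suc)
  then show "path_length (path_rest F X n \<omega>) \<le> path_length (cone_path (seg x 0 (Suc (last_exit F X n \<omega>))))"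
    using cone_path_seg[of 0 "Suc k"]
    by (simp add: k_def[symmetric] u_def path_length_def del: upt_Suc)
qed

end

section \<open>Path probabilities of the walk\<close>

fun path_weight :: "('s \<Rightarrow> 's \<Rightarrow> real) \<Rightarrow> 's list \<Rightarrow> real" where
  "path_weight p (x # y # zs) = p x y * path_weight p (y # zs)"
| "path_weight p _ = 1"

lemma path_weight_append: "a \<noteq> [] \<Longrightarrow> path_weight p (a @ b) = path_weight p a * path_weight p (last a # b)"
proof (induction a rule: induct_list012)
  case (3 x y zs)
  then show ?case by simp
qed auto

lemma path_weight_snoc: "a \<noteq> [] \<Longrightarrow> path_weight p (a @ [y]) = path_weight p a * p (last a) y"
  by (simp add: path_weight_append)

lemma path_weight_nonneg: "(\<And>x y. 0 \<le> p x y) \<Longrightarrow> 0 \<le> path_weight p a"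
  by (induction p a rule: path_weight.induct) auto

text \<open>The probability that the chain started in \<open>x\<close> is in \<open>A\<close> at each of the times $1,\dots,m$; the
  starting point itself may lie outside \<open>A\<close>.\<close>

primrec stay :: "('s \<Rightarrow> 's \<Rightarrow> real) \<Rightarrow> 's set \<Rightarrow> nat \<Rightarrow> 's \<Rightarrow> ennreal" where
  "stay p A 0 x = 1"
| "stay p A (Suc m) x = (\<integral>\<^sup>+ y. ennreal (p x y) * stay p A m y \<partial>count_space A)"

definition stay_forever :: "('s \<Rightarrow> 's \<Rightarrow> real) \<Rightarrow> 's set \<Rightarrow> 's \<Rightarrow> ennreal" where
  "stay_forever p A x = (INF m. stay p A m x)"

lemma INF_cmult_ennreal:
  fixes f :: "nat \<Rightarrow> ennreal"
  assumes c: "c < top"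
  shows "(INF m. c * f m) = c * (INF m. f m)"
proof (cases "c = 0")
  case False
  show ?thesis
  proof (rule antisym)
    have "(INF m. c * f m) / c \<le> (INF m. f m)"
    proof (rule INF_greatest)
      fix m
      have "(INF m. c * f m) / c \<le> (c * f m) / c" by (intro divide_right_mono_ennreal INF_lower) simp
      also have "\<dots> = f m" using False c by (simp add: mult.commute[of c] mult_divide_eq_ennreal)
      finally show "(INF m. c * f m) / c \<le> f m" .
    qed
    then have "c * ((INF m. c * f m) / c) \<le> c * (INF m. f m)" by (rule mult_left_mono) simp
    also have "c * ((INF m. c * f m) / c) = (INF m. c * f m)"
      using False c by (simp add: ennreal_times_divide mult.commute[of c] mult_divide_eq_ennreal)
    finally show "(INF m. c * f m) \<le> c * (INF m. f m)" .
  qed (intro INF_greatest mult_left_mono INF_lower, auto)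
qed simp

lemma stay_mono: "A \<subseteq> B \<Longrightarrow> stay p A m x \<le> stay p B m x"
proof (induction m arbitrary: x)
  case (Suc m)
  have "stay p A (Suc m) x = (\<integral>\<^sup>+ y. ennreal (p x y) * stay p A m y * indicator A y \<partial>count_space UNIV)"
    by (simp add: nn_integral_count_space_indicator)
  also have "\<dots> \<le> (\<integral>\<^sup>+ y. ennreal (p x y) * stay p B m y * indicator B y \<partial>count_space UNIV)"
    using Suc by (intro nn_integral_mono mult_mono) (auto split: split_indicator)
  also have "\<dots> = stay p B (Suc m) x"
    by (simp add: nn_integral_count_space_indicator)
  finally show ?case .
qed simp

lemma stay_forever_mono: "A \<subseteq> B \<Longrightarrow> stay_forever p A x \<le> stay_forever p B x"
  unfolding stay_forever_def by (intro INF_mono) (blast intro: stay_mono)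

lemma stay_Suc_ge:
  assumes "y \<in> A"
  shows "ennreal (p x y) * stay p A m y \<le> stay p A (Suc m) x"
  using nn_integral_ge_point[OF assms, of "\<lambda>y. ennreal (p x y) * stay p A m y"] by simp

text \<open>Probabilities are computed by summing over the countably many values of a discrete random element,
  here a finite stretch of the trajectory.\<close>

lemma (in prob_space) emeasure_partition:
  assumes Z: "Z \<in> measurable M (count_space S)" and S: "countable S" "A \<subseteq> S" and P: "Measurable.pred M P"
  shows "emeasure M {\<omega> \<in> space M. Z \<omega> \<in> A \<and> P \<omega>} =
    (\<integral>\<^sup>+ b. emeasure M {\<omega> \<in> space M. Z \<omega> = b \<and> P \<omega>} \<partial>count_space A)"
proof -
  note [measurable] = P
  have ev: "{\<omega> \<in> space M. Z \<omega> = b \<and> P \<omega>} \<in> sets M" if "b \<in> A" for b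
  proof -
    have "Z -` {b} \<inter> space M \<in> sets M" using that S(2) by (intro measurable_sets[OF Z]) auto
    moreover have "{\<omega> \<in> space M. P \<omega>} \<in> sets M" by measurable
    moreover have "{\<omega> \<in> space M. Z \<omega> = b \<and> P \<omega>} = (Z -` {b} \<inter> space M) \<inter> {\<omega> \<in> space M. P \<omega>}" by auto
    ultimately show ?thesis by simp
  qed
  have "{\<omega> \<in> space M. Z \<omega> \<in> A \<and> P \<omega>} = (\<Union>b\<in>A. {\<omega> \<in> space M. Z \<omega> = b \<and> P \<omega>})" by auto
  also have "emeasure M \<dots> = (\<integral>\<^sup>+ b. emeasure M {\<omega> \<in> space M. Z \<omega> = b \<and> P \<omega>} \<partial>count_space A)"
    using countable_subset[OF S(2,1)] ev by (intro emeasure_UN_countable) (auto simp: disjoint_family_on_def)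
  finally show ?thesis .
qed

context free_product_walk
begin

lemma stay_shift:
  assumes x: "x \<in> W" "x \<noteq> []" and A: "A \<subseteq> sw (3 - ty x)" and u: "u \<in> sw (3 - ty x)"
  shows "stay q ((@) x ` A) m (x @ u) = stay q A m u"
  using u
proof (induction m arbitrary: u)
  case (Suc m)
  have "stay q ((@) x ` A) (Suc m) (x @ u) =
      (\<integral>\<^sup>+ v. ennreal (q (x @ u) (x @ v)) * stay q ((@) x ` A) m (x @ v) \<partial>count_space A)"
    unfolding stay.simps
    by (rule nn_integral_bij_count_space[symmetric]) (auto simp: bij_betw_def inj_on_def)
  also have "\<dots> = stay q A (Suc m) u"
    unfolding stay.simps using A Suc.prems
    by (intro nn_integral_cong) (auto simp: Suc.IH q_shift[OF x])
  finally show ?case .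
qed simp

lemma path_weight_shift:
  assumes x: "x \<in> W" "x \<noteq> []" and b: "b \<in> lists (sw (3 - ty x))"
  shows "path_weight q (map ((@) x) b) = path_weight q b"
  using b
proof (induction b rule: induct_list012)
  case (3 y z zs)
  then have "q (x @ y) (x @ z) = q y z" by (intro q_shift x) auto
  then show ?case using 3 by simp
qed auto

text \<open>By shift invariance, the probability that the walk started at a word of type \<open>t\<close> never leaves the cone
  of this word.\<close>

definition hold :: "nat \<Rightarrow> ennreal" where
  "hold t = stay_forever q (sw (3 - t)) []"

text \<open>The probability that the walk leaves the empty word for ever, through the factor \<open>j\<close>.\<close>

definition escape :: "nat \<Rightarrow> ennreal" where
  "escape j = stay_forever q (sw j - {[]}) []"

lemma stay_forever_cone: "x \<in> W \<Longrightarrow> x \<noteq> [] \<Longrightarrow> stay_forever q (cone F x) x = hold (ty x)"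
  using stay_shift[of x "sw (3 - ty x)" "[]"] by (simp add: stay_forever_def hold_def cone_image)

lemma stay_forever_punctured_cone:
  "x \<in> W \<Longrightarrow> x \<noteq> [] \<Longrightarrow> stay_forever q (cone F x - {x}) x = escape (3 - ty x)"
proof -
  assume x: "x \<in> W" "x \<noteq> []"
  have "cone F x - {x} = (@) x ` (sw (3 - ty x) - {[]})" using x by (auto simp: cone_image)
  then show ?thesis
    using stay_shift[OF x, of "sw (3 - ty x) - {[]}" "[]"] by (simp add: stay_forever_def escape_def)
qed

lemma escape_le_hold: "escape (3 - t) \<le> hold t"
  unfolding escape_def hold_def by (intro stay_forever_mono) auto

text \<open>With positive probability the first step leads to a letter \<open>v\<close> of the other factor; from there it is
  enough to never leave the cone of \<open>v\<close>, and this is at least as likely as escaping through \<open>j\<close>.\<close>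

lemma escape_other:
  assumes j: "j \<in> {1, 2}" and pos: "0 < escape j" and le1: "escape j \<le> 1"
  shows "0 < escape (3 - j)"
proof -
  have j': "3 - j \<in> {1, 2}" "3 - (3 - j) = j" using j by auto
  obtain v where v: "[v] \<in> sw (3 - j)" "ty [v] = 3 - j" "0 < q [] [v]"
    using first_letter_reachable[OF j'(1)] by blast
  have vW: "[v] \<in> W" using v start_words_subset by blast
  (* capped at 1 so that the bound also holds for zero steps *)
  define c where "c = min 1 (ennreal (q [] [v]))"
  have sub: "cone F [v] \<subseteq> sw (3 - j) - {[]}"
    using v(1) by (auto simp: cone_def start_words_def)
  have "c * escape j \<le> stay q (sw (3 - j) - {[]}) m []" for m
  proof (cases m)
    case 0
    have "c * escape j \<le> 1 * 1" using le1 by (intro mult_mono) (auto simp: c_def)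
    then show ?thesis using 0 by simp
  next
    case (Suc m')
    have "escape j \<le> hold (3 - j)" using escape_le_hold[of "3 - j"] j' by simp
    also have "\<dots> = stay_forever q (cone F [v]) [v]" using stay_forever_cone[OF vW] v by simp
    also have "\<dots> \<le> stay q (cone F [v]) m' [v]" unfolding stay_forever_def by (rule INF_lower) simp
    also have "\<dots> \<le> stay q (sw (3 - j) - {[]}) m' [v]" by (rule stay_mono[OF sub])
    finally have "c * escape j \<le> ennreal (q [] [v]) * stay q (sw (3 - j) - {[]}) m' [v]"
      by (intro mult_mono) (auto simp: c_def)
    also have "\<dots> \<le> stay q (sw (3 - j) - {[]}) m []"
      unfolding Suc using v(1) by (intro stay_Suc_ge) auto
    finally show ?thesis .
  qed
  then have "c * escape j \<le> escape (3 - j)"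
    unfolding escape_def[of "3 - j"] stay_forever_def by (intro INF_greatest)
  moreover have "0 < c * escape j" using pos v(3) by (auto simp: c_def ennreal_zero_less_mult_iff)
  ultimately show ?thesis by simp
qed

end

locale free_product_chain = free_product_walk F \<alpha> for F :: "'a free_factors" and \<alpha> :: real +
  fixes M :: "'w measure" and X :: "nat \<Rightarrow> 'w \<Rightarrow> 'a list"
  assumes chain: "markov_chain M (free_words F) (free_trans F \<alpha>) [] X"
begin

sublocale prob_space M
  using chain by (simp add: markov_chain_def)

lemma X_measurable: "X n \<in> measurable M (count_space W)"
  using chain by (simp add: markov_chain_def)

lemma X_in_words: "\<omega> \<in> space M \<Longrightarrow> X n \<omega> \<in> W"
  using measurable_space[OF X_measurable] by simp

lemma pred_X [measurable]: "Measurable.pred M (\<lambda>\<omega>. P (X n \<omega>))"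
  by (rule measurable_compose[OF X_measurable]) simp

lemma pred_XX [measurable]: "Measurable.pred M (\<lambda>\<omega>. P (X n \<omega>) (X m \<omega>))"
  by (rule measurable_compose_countable'[OF _ X_measurable words_countable, of "\<lambda>u \<omega>. P u (X m \<omega>)"])
    (rule pred_X)

lemma traj_eq_iff: "traj X n \<omega> = a \<longleftrightarrow> length a = Suc n \<and> (\<forall>i\<le>n. X i \<omega> = a ! i)"
proof -
  have "traj X n \<omega> = a \<longleftrightarrow> length a = Suc n \<and> (\<forall>i<Suc n. X i \<omega> = a ! i)"
    unfolding traj_def list_eq_iff_nth_eq by (auto simp del: upt_Suc)
  then show ?thesis by (simp add: less_Suc_eq_le)
qed

lemma traj_basic:
  "length (traj X n \<omega>) = Suc n" "hd (traj X n \<omega>) = X 0 \<omega>" "last (traj X n \<omega>) = X n \<omega>"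
  "set (traj X n \<omega>) = (\<lambda>i. X i \<omega>) ` {..n}"
proof -
  show "hd (traj X n \<omega>) = X 0 \<omega>" by (simp add: traj_def upt_conv_Cons del: upt_Suc)
  show "set (traj X n \<omega>) = (\<lambda>i. X i \<omega>) ` {..n}"
    by (simp add: traj_def atLeastLessThanSuc_atLeastAtMost atLeast0AtMost del: upt_Suc)
qed (simp_all add: traj_def)

lemma pred_traj [measurable]: "Measurable.pred M (\<lambda>\<omega>. traj X n \<omega> = a)"
  unfolding traj_eq_iff by measurable

lemma traj_measurable: "traj X n \<in> measurable M (count_space (lists W))"
proof -
  have "countable (lists W)" using words_countable by (rule countable_lists)
  moreover have "traj X n \<in> space M \<rightarrow> lists W"
    using X_in_words by (auto simp: traj_def)
  moreover have "traj X n -` {a} \<inter> space M \<in> sets M" for a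
  proof -
    have "{\<omega> \<in> space M. traj X n \<omega> = a} \<in> sets M" by measurable
    then show ?thesis by (simp add: vimage_def Int_def conj_commute)
  qed
  ultimately show ?thesis by (simp add: measurable_count_space_eq_countable)
qed

lemma countable_lists_words: "countable (lists W)"
  using words_countable by (rule countable_lists)

lemma prob_traj:
  assumes "length a = Suc n" "a \<in> lists W"
  shows "prob {\<omega> \<in> space M. traj X n \<omega> = a} = (if hd a = [] then path_weight q a else 0)"
  using assms
proof (induction n arbitrary: a)
  case 0
  then obtain y where a: "a = [y]" by (auto simp: length_Suc_conv)
  have start: "AE \<omega> in M. X 0 \<omega> = []" using chain by (simp add: markov_chain_def)
  have "prob {\<omega> \<in> space M. traj X 0 \<omega> = a} = prob {\<omega> \<in> space M. [] = y}"
    by (rule prob_eq_AE) (use start in \<open>auto simp: a traj_def elim!: eventually_mono\<close>)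
  then show ?case by (auto simp: a prob_space)
next
  case (Suc n)
  then obtain b y where a: "a = b @ [y]" and b: "length b = Suc n"
    by (metis length_Suc_conv_rev)
  have bne: "b \<noteq> []" using b by auto
  have W: "b \<in> lists W" "y \<in> W" using Suc.prems a by auto
  note IH = Suc.IH[OF b W(1)]
  let ?B = "{\<omega> \<in> space M. \<forall>i\<le>n. X i \<omega> = b ! i}"
  have B: "{\<omega> \<in> space M. traj X n \<omega> = b} = ?B" using b by (simp add: traj_eq_iff)
  have A: "{\<omega> \<in> space M. traj X (Suc n) \<omega> = a} = {\<omega> \<in> space M. X (Suc n) \<omega> = y \<and> (\<forall>i\<le>n. X i \<omega> = b ! i)}"
    using b by (auto simp: traj_eq_iff a nth_append less_Suc_eq_le le_Suc_eq)
  have last: "last b = b ! n" using b bne by (simp add: last_conv_nth)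
  show ?case
  proof (cases "prob ?B = 0")
    case True
    have "prob {\<omega> \<in> space M. traj X (Suc n) \<omega> = a} \<le> prob ?B"
      unfolding A by (intro finite_measure_mono) auto
    then have z: "prob {\<omega> \<in> space M. traj X (Suc n) \<omega> = a} = 0" using True by (simp add: measure_le_0_iff)
    show ?thesis
      using z True IH B bne by (auto simp: a path_weight_snoc split: if_splits)
  next
    case False
    then have pos: "0 < prob ?B" by (simp add: less_le)
    have "\<P>(\<omega> in M. X (Suc n) \<omega> = y \<bar> \<forall>i\<le>n. X i \<omega> = b ! i) = q (b ! n) y"
      using chain pos W unfolding markov_chain_def by blast
    then have "prob {\<omega> \<in> space M. traj X (Suc n) \<omega> = a} = q (last b) y * prob ?B"
      unfolding cond_prob_def A last using pos by (simp add: field_simps)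
    then show ?thesis using IH B bne by (simp add: a path_weight_snoc)
  qed
qed

lemma emeasure_traj_stay:
  assumes "length a = Suc n" "a \<in> lists W" "hd a = []" "A \<subseteq> W"
  shows "emeasure M {\<omega> \<in> space M. traj X n \<omega> = a \<and> (\<forall>i<m. X (Suc (n + i)) \<omega> \<in> A)}
     = ennreal (path_weight q a) * stay q A m (last a)"
  using assms(1-3)
proof (induction m arbitrary: n a)
  case 0
  then show ?case using prob_traj[of a n] by (simp add: emeasure_eq_measure)
next
  case (Suc m)
  have ne: "a \<noteq> []" using Suc.prems by auto
  have eq: "{\<omega> \<in> space M. traj X n \<omega> = a \<and> (\<forall>i<Suc m. X (Suc (n + i)) \<omega> \<in> A)} =
     (\<Union>y\<in>A. {\<omega> \<in> space M. traj X (Suc n) \<omega> = a @ [y] \<and> (\<forall>i<m. X (Suc (Suc n + i)) \<omega> \<in> A)})"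
    (is "?L = (\<Union>y\<in>A. ?R y)")
  proof -
    have t: "traj X (Suc n) \<omega> = a @ [y] \<longleftrightarrow> traj X n \<omega> = a \<and> X (Suc n) \<omega> = y" for \<omega> y
      by (simp add: traj_def)
    show ?thesis unfolding All_less_Suc2 t by auto
  qed
  have "emeasure M ?L = (\<integral>\<^sup>+ y. emeasure M (?R y) \<partial>count_space A)"
    unfolding eq
  proof (rule emeasure_UN_countable)
    show "countable A" using assms(4) words_countable by (rule countable_subset)
    show "disjoint_family_on ?R A" by (auto simp: disjoint_family_on_def)
  qed measurable
  also have "\<dots> = (\<integral>\<^sup>+ y. ennreal (path_weight q a) * (ennreal (q (last a) y) * stay q A m y) \<partial>count_space A)"
  proof (rule nn_integral_cong)
    fix y assume "y \<in> space (count_space A)"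
    then have "emeasure M (?R y) = ennreal (path_weight q (a @ [y])) * stay q A m (last (a @ [y]))"
      using Suc.prems ne assms(4) by (intro Suc.IH) auto
    then show "emeasure M (?R y) = ennreal (path_weight q a) * (ennreal (q (last a) y) * stay q A m y)"
      using ne by (simp add: path_weight_snoc ennreal_mult' mult.assoc path_weight_nonneg)
  qed
  also have "\<dots> = ennreal (path_weight q a) * stay q A (Suc m) (last a)"
    by (simp add: nn_integral_cmult)
  finally show ?case .
qed

text \<open>The Markov property for the infinite future: having reached the end of the path \<open>a\<close>, the chance of
  staying in \<open>A\<close> depends only on the last vertex.\<close>

lemma emeasure_traj_stay_forever:
  assumes "length a = Suc n" "a \<in> lists W" "hd a = []" "A \<subseteq> W"
  shows "emeasure M {\<omega> \<in> space M. traj X n \<omega> = a \<and> (\<forall>i>n. X i \<omega> \<in> A)}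
     = ennreal (path_weight q a) * stay_forever q A (last a)"
proof -
  let ?E = "\<lambda>m. {\<omega> \<in> space M. traj X n \<omega> = a \<and> (\<forall>i<m. X (Suc (n + i)) \<omega> \<in> A)}"
  have "{\<omega> \<in> space M. traj X n \<omega> = a \<and> (\<forall>i>n. X i \<omega> \<in> A)} = (\<Inter>m. ?E m)"
  proof (intro set_eqI iffI)
    fix \<omega> assume w: "\<omega> \<in> (\<Inter>m. ?E m)"
    have "X i \<omega> \<in> A" if ni: "n < i" for i
    proof -
      have "\<omega> \<in> ?E (i - n)" using w by blast
      then have "\<forall>j<i - n. X (Suc (n + j)) \<omega> \<in> A" by blast
      moreover obtain j where "i = Suc (n + j)" using less_imp_Suc_add[OF ni] by blast
      ultimately show ?thesis by simp
    qed
    then show "\<omega> \<in> {\<omega> \<in> space M. traj X n \<omega> = a \<and> (\<forall>i>n. X i \<omega> \<in> A)}" using w by auto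
  qed auto
  also have "emeasure M \<dots> = (INF m. emeasure M (?E m))"
    by (rule INF_emeasure_decseq[symmetric]) (auto simp: decseq_def)
  also have "\<dots> = (INF m. ennreal (path_weight q a) * stay q A m (last a))"
    using emeasure_traj_stay[OF assms] by simp
  also have "\<dots> = ennreal (path_weight q a) * stay_forever q A (last a)"
    unfolding stay_forever_def by (rule INF_cmult_ennreal) simp
  finally show ?thesis .
qed

lemma escape_le_1: "escape j \<le> 1"
  unfolding escape_def stay_forever_def by (rule INF_lower2[of 0]) auto

lemma AE_start: "AE \<omega> in M. X 0 \<omega> = []"
  using chain by (simp add: markov_chain_def)

lemma AE_q_pos: "AE \<omega> in M. \<forall>n. 0 < q (X n \<omega>) (X (Suc n) \<omega>)"
proof -
  have "AE \<omega> in M. \<not> traj X n \<omega> = a" if "a \<in> lists W" "path_weight q a \<le> 0" for n a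
  proof (cases "length a = Suc n")
    case True
    have "path_weight q a = 0" using path_weight_nonneg[of q a] that(2) by simp
    then have "prob {\<omega> \<in> space M. traj X n \<omega> = a} = 0"
      using prob_traj[OF True] that by auto
    then show ?thesis by (subst (asm) prob_Collect_eq_0) auto
  next
    case False
    then have "\<not> traj X n \<omega> = a" for \<omega> by (simp add: traj_eq_iff)
    then show ?thesis by simp
  qed
  then have "AE \<omega> in M. traj X n \<omega> = a \<longrightarrow> 0 < path_weight q a" if "a \<in> lists W" for n a
    using that by (cases "0 < path_weight q a") auto
  then have "AE \<omega> in M. \<forall>n. \<forall>a\<in>lists W. traj X n \<omega> = a \<longrightarrow> 0 < path_weight q a"
    unfolding AE_all_countable AE_ball_countable[OF countable_lists_words] by blast
  then show ?thesis
  proof (rule AE_mp, intro AE_I2 impI allI)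
    fix \<omega> n
    assume w: "\<omega> \<in> space M" and pos: "\<forall>n. \<forall>a\<in>lists W. traj X n \<omega> = a \<longrightarrow> 0 < path_weight q a"
    have "traj X (Suc n) \<omega> \<in> lists W" using measurable_space[OF traj_measurable w] by simp
    then have "0 < path_weight q (traj X (Suc n) \<omega>)" using pos by blast
    also have "traj X (Suc n) \<omega> = traj X n \<omega> @ [X (Suc n) \<omega>]" by (simp add: traj_def)
    also have "path_weight q \<dots> = path_weight q (traj X n \<omega>) * q (X n \<omega>) (X (Suc n) \<omega>)"
      by (subst path_weight_snoc) (simp_all add: traj_def)
    finally show "0 < q (X n \<omega>) (X (Suc n) \<omega>)"
      using path_weight_nonneg[of q "traj X n \<omega>"] by (simp add: zero_less_mult_iff)
  qed
qed

lemma AE_finite_visits: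
  assumes "summable (\<lambda>n. prob {\<omega> \<in> space M. P (X n \<omega>)})"
  shows "AE \<omega> in M. finite {n. P (X n \<omega>)}"
proof -
  have "AE \<omega> in M. \<forall>\<^sub>F n in sequentially. \<omega> \<in> space M - {\<omega> \<in> space M. P (X n \<omega>)}"
    using assms by (intro borel_cantelli_AE1) (auto simp: less_top[symmetric])
  then show ?thesis
  proof (rule AE_mp, intro AE_I2 impI)
    fix \<omega> assume "\<omega> \<in> space M" "\<forall>\<^sub>F n in sequentially. \<omega> \<in> space M - {\<omega> \<in> space M. P (X n \<omega>)}"
    then obtain N where N: "\<And>n. n \<ge> N \<Longrightarrow> \<not> P (X n \<omega>)" by (auto simp: eventually_sequentially)
    have "{n. P (X n \<omega>)} \<subseteq> {..<N}" using N not_le_imp_less by blast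
    then show "finite {n. P (X n \<omega>)}" by (rule finite_subset) simp
  qed
qed

end

section \<open>Transience\<close>

locale transient_chain = free_product_chain F \<alpha> M X
  for F :: "'a free_factors" and \<alpha> :: real and M :: "'w measure" and X :: "nat \<Rightarrow> 'w \<Rightarrow> 'a list" +
  assumes radius: "conv_radius (\<lambda>n. prob {\<omega> \<in> space M. X n \<omega> = []}) > 1"
begin

lemma AE_finite_visits_root: "AE \<omega> in M. finite {n. X n \<omega> = []}"
proof (rule AE_finite_visits)
  have "summable (\<lambda>n. prob {\<omega> \<in> space M. X n \<omega> = []} * 1 ^ n)"
    using radius by (intro summable_in_conv_radius) (simp add: one_ereal_def)
  then show "summable (\<lambda>n. prob {\<omega> \<in> space M. X n \<omega> = []})" by simp
qed

text \<open>Almost surely there is a last visit to the empty word, after which the walk stays within the words of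
  one factor.  If both escape probabilities vanished, each of the countably many scenarios for
  this last visit would be null.\<close>

lemma escape_pos:
  assumes "j \<in> {1, 2}" shows "0 < escape j"
proof -
  have "\<exists>j\<in>{1, 2}. 0 < escape j"
  proof (rule ccontr)
    assume "\<not> ?thesis"
    then have zero: "escape j = 0" if "j \<in> {1, 2}" for j using that by force
    have *: "AE \<omega> in M. \<not> (traj X n \<omega> = a \<and> (\<forall>i>n. X i \<omega> \<in> sw j - {[]}))"
      if a: "a \<in> {a \<in> lists W. hd a = [] \<and> last a = []}" and j: "j \<in> {1, 2}" for n a j
    proof (cases "length a = Suc n")
      case True
      have "emeasure M {\<omega> \<in> space M. traj X n \<omega> = a \<and> (\<forall>i>n. X i \<omega> \<in> sw j - {[]})}
        = ennreal (path_weight q a) * stay_forever q (sw j - {[]}) (last a)"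
        using a True start_words_subset by (intro emeasure_traj_stay_forever) auto
      also have "\<dots> = 0" using a zero[OF j] by (simp add: escape_def)
      finally show ?thesis by (intro AE_I[OF subset_refl]) auto
    next
      case False
      then show ?thesis by (simp add: traj_eq_iff)
    qed
    then have "AE \<omega> in M. \<forall>n. \<forall>a\<in>{a \<in> lists W. hd a = [] \<and> last a = []}. \<forall>j\<in>{1, 2}.
        \<not> (traj X n \<omega> = a \<and> (\<forall>i>n. X i \<omega> \<in> sw j - {[]}))"
    proof -
      have c: "countable {a \<in> lists W. hd a = [] \<and> last a = []}" "countable {1, 2 :: nat}"
        using countable_lists_words by (auto intro: countable_subset[OF _ countable_lists_words])
      show ?thesis
        using * unfolding AE_all_countable AE_ball_countable[OF c(1)] AE_ball_countable[OF c(2)] by blast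
    qed
    then have "AE \<omega> in M. False"
      using AE_finite_visits_root AE_start AE_q_pos
    proof (eventually_elim, goal_cases)
      case (1 \<omega>)
      have inW: "X n \<omega> \<in> W" for n using 1(4) q_pos_imp(2) by blast
      let ?Z = "{n. X n \<omega> = []}"
      define n where "n = Max ?Z"
      have "0 \<in> ?Z" using 1(3) by simp
      then have n: "X n \<omega> = []" using Max_in[OF 1(2)] unfolding n_def by blast
      have after: "X i \<omega> \<noteq> []" if "n < i" for i
        using Max_ge[OF 1(2), of i] that unfolding n_def by fastforce
      obtain j where j: "j \<in> {1, 2}" "X (Suc n) \<omega> \<in> sw j"
        using hd_letter[OF inW[of "Suc n"]] after[of "Suc n"] inW[of "Suc n"] unfolding start_words_def by blast
      have "X i \<omega> \<in> sw j" if "Suc n \<le> i" for i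
        using that
      proof (induction i rule: dec_induct)
        case (step i)
        have "0 < q (X i \<omega>) (X (Suc i) \<omega>)" using 1(4) by blast
        then show ?case
          using q_pos_start_words[of "X i \<omega>" "X (Suc i) \<omega>" j] step j(1) after[of i] after[of "Suc i"] by simp
      qed (rule j)
      then have stays: "\<forall>i>n. X i \<omega> \<in> sw j - {[]}" using after by auto
      have "traj X n \<omega> \<in> {a \<in> lists W. hd a = [] \<and> last a = []}"
        using inW n 1(3) by (auto simp: traj_basic)
      then show False using 1(1) stays j(1) by blast
    qed
    then show False by simp
  qed
  then obtain i where i: "i \<in> {1, 2}" "0 < escape i" by blast
  then have "0 < escape (3 - i)" by (intro escape_other escape_le_1)
  moreover have "j = i \<or> j = 3 - i" using assms i by auto
  ultimately show ?thesis using i by auto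
qed

lemma hold_pos: "t \<in> {1, 2} \<Longrightarrow> 0 < hold t"
  using escape_pos[of "3 - t"] escape_le_hold[of t] by (auto intro: less_le_trans)

lemma hold_le_1: "hold t \<le> 1"
  unfolding hold_def stay_forever_def by (rule INF_lower2[of 0]) auto

text \<open>Each visit to level \<open>k\<close> is the last one with probability at least \<open>a\<close>, namely when the walk
  stays for ever inside the cone of the visited word without coming back to this word.  As at most one visit is the last, the expected number of
  visits is at most \<open>1 / a\<close>.\<close>

lemma summable_level:
  assumes k: "1 \<le> k"
  shows "summable (\<lambda>n. prob {\<omega> \<in> space M. length (X n \<omega>) = k})"
proof -
  define a where "a = min (escape 1) (escape 2)"
  have a: "0 < a" using escape_pos by (simp add: a_def)
  define P where "P n \<omega> \<longleftrightarrow> length (X n \<omega>) = k" for n \<omega>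
  (* the disjoint events of leaving level k for ever at time n *)
  define D where "D n \<omega> \<longleftrightarrow> length (X n \<omega>) = k \<and> (\<forall>i>n. X i \<omega> \<in> cone F (X n \<omega>) - {X n \<omega>})" for n \<omega>
  have Pm [measurable]: "Measurable.pred M (P n)" for n
    unfolding P_def[abs_def] by (rule pred_X)
  have Dm [measurable]: "Measurable.pred M (D n)" for n
  proof -
    have "Measurable.pred M (\<lambda>\<omega>. X i \<omega> \<in> cone F (X n \<omega>) - {X n \<omega>})" for i
      by (rule pred_XX)
    then show ?thesis unfolding D_def[abs_def] by measurable
  qed
  have "emeasure M {\<omega> \<in> space M. P n \<omega>} * a \<le> emeasure M {\<omega> \<in> space M. D n \<omega>}" for n
  proof -
    define A where "A = {b \<in> lists W. length b = Suc n \<and> length (last b) = k \<and> hd b = []}"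
    have A: "A \<subseteq> lists W" by (auto simp: A_def)
    note part = emeasure_partition[OF traj_measurable[of n] countable_lists_words A]
    have "emeasure M {\<omega> \<in> space M. P n \<omega>} = emeasure M {\<omega> \<in> space M. traj X n \<omega> \<in> A \<and> True}"
    proof (rule emeasure_eq_AE)
      show "AE \<omega> in M. (\<omega> \<in> {\<omega> \<in> space M. P n \<omega>}) = (\<omega> \<in> {\<omega> \<in> space M. traj X n \<omega> \<in> A \<and> True})"
        using AE_start
      proof eventually_elim
        case (elim \<omega>)
        have "traj X n \<omega> \<in> A \<longleftrightarrow> length (X n \<omega>) = k" if "\<omega> \<in> space M"
          using measurable_space[OF traj_measurable[of n] that] elim traj_basic[of n \<omega>] by (simp add: A_def)
        then show ?case by (auto simp: P_def)
      qed
      have "traj X n -` A \<inter> space M \<in> sets M" using A by (intro measurable_sets[OF traj_measurable]) simp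
      moreover have "traj X n -` A \<inter> space M = {\<omega> \<in> space M. traj X n \<omega> \<in> A \<and> True}" by auto
      ultimately show "{\<omega> \<in> space M. traj X n \<omega> \<in> A \<and> True} \<in> sets M" by simp
    qed measurable
    also have "\<dots> * a = (\<integral>\<^sup>+ b. emeasure M {\<omega> \<in> space M. traj X n \<omega> = b \<and> True} * a \<partial>count_space A)"
      by (subst part[where P = "\<lambda>_. True"]) (simp_all add: nn_integral_multc)
    also have "\<dots> \<le> (\<integral>\<^sup>+ b. emeasure M {\<omega> \<in> space M. traj X n \<omega> = b \<and> D n \<omega>} \<partial>count_space A)"
    proof (rule nn_integral_mono)
      fix b assume "b \<in> space (count_space A)"
      then have b: "b \<in> lists W" "length b = Suc n" "length (last b) = k" "hd b = []" by (auto simp: A_def)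
      have lb: "last b \<in> W" "last b \<noteq> []" using b k last_in_set[of b] by (cases "b = []"; fastforce)+
      have "emeasure M {\<omega> \<in> space M. traj X n \<omega> = b \<and> True} * a = ennreal (path_weight q b) * a"
        using b prob_traj[of b n] by (simp add: emeasure_eq_measure)
      also have "\<dots> \<le> ennreal (path_weight q b) * escape (3 - ty (last b))"
        using type_cases[OF lb(2)] by (intro mult_left_mono) (auto simp: a_def simp flip: One_nat_def)
      also have "\<dots> = ennreal (path_weight q b) * stay_forever q (cone F (last b) - {last b}) (last b)"
        using stay_forever_punctured_cone[OF lb] by simp
      also have "\<dots> = emeasure M {\<omega> \<in> space M. traj X n \<omega> = b \<and> (\<forall>i>n. X i \<omega> \<in> cone F (last b) - {last b})}"
        using b by (intro emeasure_traj_stay_forever[symmetric]) (auto simp: cone_def)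
      also have "{\<omega> \<in> space M. traj X n \<omega> = b \<and> (\<forall>i>n. X i \<omega> \<in> cone F (last b) - {last b})} =
          {\<omega> \<in> space M. traj X n \<omega> = b \<and> D n \<omega>}"
      proof -
        have "X n \<omega> = last b" if "traj X n \<omega> = b" for \<omega> using that traj_basic(3)[of n \<omega>] by simp
        then show ?thesis using b unfolding D_def by auto
      qed
      finally show "emeasure M {\<omega> \<in> space M. traj X n \<omega> = b \<and> True} * a \<le>
          emeasure M {\<omega> \<in> space M. traj X n \<omega> = b \<and> D n \<omega>}" .
    qed
    also have "\<dots> \<le> emeasure M {\<omega> \<in> space M. D n \<omega>}"
      by (subst part[OF Dm[of n], symmetric]) (auto intro!: emeasure_mono)
    finally show ?thesis .
  qed
  then have "(\<Sum>n. emeasure M {\<omega> \<in> space M. P n \<omega>} * a) \<le> (\<Sum>n. emeasure M {\<omega> \<in> space M. D n \<omega>})"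
    by (intro suminf_le) auto
  also have "\<dots> = emeasure M (\<Union>n. {\<omega> \<in> space M. D n \<omega>})"
  proof (rule suminf_emeasure)
    have "False" if d: "D n \<omega>" "D m \<omega>" and "n < m" for n m \<omega>
    proof -
      have "X m \<omega> \<in> cone F (X n \<omega>)" "X m \<omega> \<noteq> X n \<omega>" "length (X m \<omega>) = length (X n \<omega>)"
        using d \<open>n < m\<close> by (auto simp: D_def)
      then show False by (auto simp: cone_def)
    qed
    then show "disjoint_family (\<lambda>n. {\<omega> \<in> space M. D n \<omega>})"
      unfolding disjoint_family_on_def by (auto simp: set_eq_iff) (metis linorder_neqE_nat)
  qed auto
  also have "\<dots> \<le> 1" by (rule emeasure_le_1)
  finally have "(\<Sum>n. emeasure M {\<omega> \<in> space M. P n \<omega>}) * a \<le> 1"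
    by simp
  then have "(\<Sum>n. emeasure M {\<omega> \<in> space M. P n \<omega>}) \<noteq> top"
    using a by (auto simp: ennreal_top_mult top_unique split: if_splits)
  then show ?thesis
    unfolding P_def by (intro summable_suminf_not_top) (auto simp: emeasure_eq_measure)
qed

lemma AE_transient_walk: "AE \<omega> in M. transient_walk F \<alpha> X \<omega>"
proof -
  have "AE \<omega> in M. finite {n. length (X n \<omega>) = k}" for k
  proof (cases "k = 0")
    case True
    then show ?thesis using AE_finite_visits_root by simp
  next
    case False
    then show ?thesis using AE_finite_visits[OF summable_level[of k], of] by simp
  qed
  then have "AE \<omega> in M. \<forall>k. finite {n. length (X n \<omega>) = k}" by (simp add: AE_all_countable)
  then show ?thesis
    using AE_start AE_q_pos
  proof eventually_elim
    case (elim \<omega>)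
    then show ?case
      by unfold_locales (auto dest: q_pos_imp)
  qed
qed

end

section \<open>The law of the trajectory between final cone entries\<close>

text \<open>The property of a path that, together with never leaving the last cone, characterises the segments
  with level difference \<open>d\<close>.\<close>

definition valid_seg :: "nat \<Rightarrow> 'a list list \<Rightarrow> bool" where
  "valid_seg d b \<longleftrightarrow> 2 \<le> length b \<and> hd b = [] \<and> length (last b) = d \<and>
     \<not> prefix (last b) (b ! (length b - 2))"

context transient_path
begin

lemma valid_seg_seg:
  assumes "r < k"
  shows "valid_seg (k - r) (seg x r k)"
proof -
  have e: "e r < e k" by (rule final_entry_strict_mono[OF assms])
  have k: "1 \<le> k" using assms by simp
  let ?v = "x (e r)"
  have "seg x r k ! (length (seg x r k) - 2) = drop r (x (e k - 1))"
  proof -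
    obtain d where d: "e k = Suc (e r + d)" using less_imp_Suc_add[OF e] by blast
    show ?thesis by (simp add: seg_def d del: upt_Suc)
  qed
  moreover have "prefix (drop (length ?v) (x (e k))) (drop (length ?v) (x (e k - 1))) \<longleftrightarrow> prefix (x (e k)) (x (e k - 1))"
    using e assms by (intro prefix_drop_iff prefix_after_final_entry prefix_final_entry) auto
  ultimately show ?thesis
    using seg_basic[of r k] assms e not_prefix_before_final_entry[OF k]
    by (simp add: valid_seg_def length_at_final_entry)
qed

lemma seg_0_eq_iff:
  assumes "1 \<le> r"
  shows "seg x 0 r = a \<longleftrightarrow> valid_seg r a \<and> map x [0 ..< length a] = a \<and>
     (\<forall>i\<ge>length a - 1. prefix (last a) (x i))"
proof
  assume a: "seg x 0 r = a"
  have "valid_seg r a" using valid_seg_seg[of 0 r] assms a by simp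
  moreover have "length a = Suc (e r)" "last a = x (e r)" using seg_basic[of 0 r] a by auto
  moreover have "map x [0 ..< Suc (e r)] = a" using a by (simp add: seg_0)
  ultimately show "valid_seg r a \<and> map x [0 ..< length a] = a \<and> (\<forall>i\<ge>length a - 1. prefix (last a) (x i))"
    using prefix_after_final_entry[of r] by simp
next
  assume a: "valid_seg r a \<and> map x [0 ..< length a] = a \<and> (\<forall>i\<ge>length a - 1. prefix (last a) (x i))"
  then have len: "2 \<le> length a" by (simp add: valid_seg_def)
  have nth: "x i = a ! i" if "i < length a" for i
    using a that by (metis add_0 nth_map_upt minus_nat.diff_0)
  have last: "last a = x (length a - 1)"
    using len nth[of "length a - 1"] last_conv_nth[of a] by fastforce
  have "e r = length a - 1"
  proof (rule final_entry_eqI)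
    show "\<not> prefix (x (length a - 1)) (x (length a - 1 - 1))"
      using a len nth[of "length a - 2"] last by (simp add: valid_seg_def numeral_2_eq_2)
  qed (use a len last in \<open>auto simp: valid_seg_def\<close>)
  then have "Suc (e r) = length a" using len by simp
  then show "seg x 0 r = a" using a by (simp only: seg_0)
qed

text \<open>Two consecutive segments are prescribed by prescribing the trajectory up to the second entry and the
  holding of the second cone.  The first cone is then held automatically, being larger.\<close>

lemma seg_seg_eq_iff:
  assumes "1 \<le> r" "r < k" and c: "c = a @ map ((@) (last a)) (tl b)"
  shows "seg x 0 r = a \<and> seg x r k = b \<longleftrightarrow> valid_seg r a \<and> valid_seg (k - r) b \<and>
     map x [0 ..< length c] = c \<and> (\<forall>i\<ge>length c - 1. prefix (last c) (x i))"
proof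
  assume ab: "seg x 0 r = a \<and> seg x r k = b"
  have e: "e r < e k" by (rule final_entry_strict_mono[OF assms(2)])
  have la: "last a = x (e r)" using seg_basic[of 0 r] ab by auto
  have "tl b = map (\<lambda>i. drop r (x i)) [Suc (e r) ..< Suc (e k)]"
    using ab e by (auto simp: seg_def upt_conv_Cons simp del: upt_Suc)
  moreover have "x (e r) @ drop r (x i) = x i" if "e r \<le> i" for i
    using prefix_after_final_entry[OF that] length_at_final_entry[of r] by (auto simp: prefix_def)
  ultimately have "map ((@) (last a)) (tl b) = map x [Suc (e r) ..< Suc (e k)]"
    unfolding la by (auto simp del: upt_Suc)
  then have "c = map x ([0 ..< Suc (e r)] @ [Suc (e r) ..< Suc (e k)])"
    using ab by (simp add: c seg_0 del: upt_Suc) 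
  also have "[0 ..< Suc (e r)] @ [Suc (e r) ..< Suc (e k)] = [0 ..< Suc (e k)]"
    using upt_add_eq_append[of 0 "Suc (e r)" "e k - e r"] e by simp
  finally have cc: "c = map x [0 ..< Suc (e k)]" .
  then have "length c = Suc (e k)" "last c = x (e k)" by simp_all
  then show "valid_seg r a \<and> valid_seg (k - r) b \<and>
     map x [0 ..< length c] = c \<and> (\<forall>i\<ge>length c - 1. prefix (last c) (x i))"
    using valid_seg_seg[of 0 r] valid_seg_seg[of r k] ab assms cc prefix_after_final_entry[of k]
    by simp
next
  assume R: "valid_seg r a \<and> valid_seg (k - r) b \<and>
     map x [0 ..< length c] = c \<and> (\<forall>i\<ge>length c - 1. prefix (last c) (x i))"
  let ?v = "last a" and ?m = "length a - 1"
  have a: "2 \<le> length a" "length ?v = r" "\<not> prefix ?v (a ! (length a - 2))"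
    and b: "2 \<le> length b" "hd b = []" "length (last b) = k - r" "\<not> prefix (last b) (b ! (length b - 2))"
    using R by (auto simp: valid_seg_def)
  have lc: "length c = length a + length b - 1" using b by (simp add: c)
  have ne: "a \<noteq> []" "b \<noteq> []" "tl b \<noteq> []" using a b by (auto simp: tl_Nil)
  have nth: "x i = c ! i" if "i < length c" for i
    using R that by (metis add_0 nth_map_upt minus_nat.diff_0)
  have xa: "x i = a ! i" if "i < length a" for i
    using nth[of i] that lc b by (simp add: c nth_append)
  have xb: "x (?m + j) = ?v @ b ! j" if "j < length b" for j
  proof (cases j)
    case 0
    then show ?thesis using xa[of ?m] a ne b by (simp add: last_conv_nth hd_conv_nth)
  next
    case (Suc j')
    then have idx: "?m + j = length a + j'" using a by simp
    have "x (?m + j) = c ! (?m + j)" by (rule nth) (use that lc a in simp)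
    then have "x (?m + j) = c ! (length a + j')" by (simp only: idx)
    also have "\<dots> = ?v @ tl b ! j'" using that Suc by (simp add: c nth_append)
    finally show ?thesis using that Suc by (simp add: nth_tl)
  qed
  have n: "length c - 1 = ?m + (length b - 1)" using lc a b by simp
  have last_c: "last c = ?v @ last b"
    using ne by (simp add: c last_map last_tl)
  have xk: "x (length c - 1) = ?v @ last b"
  proof -
    have "length b - 1 < length b" using ne by simp
    from xb[OF this] show ?thesis by (simp only: n last_conv_nth[OF ne(2)])
  qed
  have ek: "e k = length c - 1"
  proof (rule final_entry_eqI)
    show "1 \<le> length c - 1" using lc a b by simp
    show "length (x (length c - 1)) = k" using xk a b assms by simp
    show "prefix (x (length c - 1)) (x i)" if "length c - 1 \<le> i" for i
      using R that xk last_c by simp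
    have "length c - 1 - 1 = ?m + (length b - 2)" using lc a b by simp
    then have "x (length c - 1 - 1) = ?v @ b ! (length b - 2)"
      using xb[of "length b - 2"] b by simp
    then show "\<not> prefix (x (length c - 1)) (x (length c - 1 - 1))"
      using xk b by simp
  qed
  have pre: "prefix ?v (x i)" if "?m \<le> i" for i
  proof (cases "i \<le> length c - 1")
    case True
    then have "i - ?m < length b" using n b by simp
    from xb[OF this] show ?thesis using that by simp
  next
    case False
    then have "prefix (?v @ last b) (x i)" using R last_c by (metis nat_le_linear)
    then show ?thesis by (metis append_prefixD)
  qed
  have er: "e r = ?m"
  proof (rule final_entry_eqI)
    have xm: "x ?m = ?v" using xa[of ?m] a ne by (simp add: last_conv_nth)
    show "1 \<le> ?m" using a by simp
    show "length (x ?m) = r" using xm a by simp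
    show "prefix (x ?m) (x i)" if "?m \<le> i" for i using pre[OF that] xm by simp
    have "x (?m - 1) = a ! (length a - 2)" using xa[of "length a - 2"] a by (simp add: numeral_2_eq_2)
    then show "\<not> prefix (x ?m) (x (?m - 1))" using xm a by simp
  qed
  have "seg x 0 r = a"
    by (rule nth_equalityI) (use er a xa in \<open>auto simp: seg_0 nth_append simp del: upt_Suc\<close>)
  moreover have "seg x r k = b"
  proof (rule nth_equalityI)
    have "e k - e r = length b - 1" unfolding er ek n by simp
    then show len: "length (seg x r k) = length b"
      using seg_basic(4)[OF less_imp_le[OF assms(2)]] b(1) by linarith
    fix j assume "j < length (seg x r k)"
    then have j: "j < length b" using len by simp
    have "seg x r k ! j = drop r (x (e r + j))"
      using \<open>j < length (seg x r k)\<close> by (simp add: seg_def del: upt_Suc)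
    then show "seg x r k ! j = b ! j" using xb[OF j] er a by simp
  qed
  ultimately show "seg x 0 r = a \<and> seg x r k = b" by blast
qed

end

context free_product_chain
begin

abbreviation path_seg :: "nat \<Rightarrow> nat \<Rightarrow> 'w \<Rightarrow> 'a list list" where
  "path_seg r k \<omega> \<equiv> seg (\<lambda>i. X i \<omega>) r k"

lemma final_entry_measurable: "(\<lambda>\<omega>. final_entry (\<lambda>i. X i \<omega>) k) \<in> measurable M (count_space UNIV)"
  unfolding final_entry_def
proof (rule measurable_Least)
  fix l
  have "Measurable.pred M (\<lambda>\<omega>. prefix (X l \<omega>) (X i \<omega>))" for i by (rule pred_XX)
  moreover have "Measurable.pred M (\<lambda>\<omega>. length (X l \<omega>) = k)" by (rule pred_X)
  ultimately show "Measurable.pred M (\<lambda>\<omega>. length (X l \<omega>) = k \<and> (\<forall>i\<ge>l. prefix (X l \<omega>) (X i \<omega>)))"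
    by measurable
qed

lemma drop_in_words: "w \<in> W \<Longrightarrow> drop r w \<in> W"
  using words_append[of "take r w" "drop r w"] by simp

lemma path_seg_measurable: "path_seg r k \<in> measurable M (count_space (lists W))"
proof -
  let ?f = "\<lambda>m n \<omega>. map (\<lambda>i. drop r (X i \<omega>)) [m ..< Suc n]"
  have f: "?f m n \<in> measurable M (count_space (lists W))" for m n
    unfolding measurable_count_space_eq_countable[OF countable_lists_words]
  proof (intro conjI ballI)
    show "?f m n \<in> space M \<rightarrow> lists W" using X_in_words drop_in_words by auto
    fix a
    have "?f m n \<omega> = a \<longleftrightarrow> length a = Suc n - m \<and> (\<forall>j<Suc n - m. drop r (X (m + j) \<omega>) = a ! j)" for \<omega>
      unfolding list_eq_iff_nth_eq by (auto simp del: upt_Suc)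
    moreover have "Measurable.pred M (\<lambda>\<omega>. length a = Suc n - m \<and> (\<forall>j<Suc n - m. drop r (X (m + j) \<omega>) = a ! j))"
      by measurable
    ultimately have "Measurable.pred M (\<lambda>\<omega>. ?f m n \<omega> = a)" by presburger
    then have "{\<omega> \<in> space M. ?f m n \<omega> = a} \<in> sets M" by measurable
    then show "?f m n -` {a} \<inter> space M \<in> sets M" by (simp add: vimage_def Int_def conj_commute)
  qed
  have g: "(\<lambda>\<omega>. ?f m (final_entry (\<lambda>i. X i \<omega>) k) \<omega>) \<in> measurable M (count_space (lists W))" for m
    by (rule measurable_compose_countable'[where f = "\<lambda>n \<omega>. ?f m n \<omega>" and I = UNIV, OF f final_entry_measurable])
       simp
  show ?thesis
    unfolding seg_def
    by (rule measurable_compose_countable'[where f = "\<lambda>m \<omega>. ?f m (final_entry (\<lambda>i. X i \<omega>) k) \<omega>" and I = UNIV,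
          OF g final_entry_measurable]) simp
qed

lemma pred_path_seg [measurable]: "Measurable.pred M (\<lambda>\<omega>. P (path_seg r k \<omega>))"
  by (rule measurable_compose[OF path_seg_measurable]) simp

lemma path_seg_in_lists: "\<omega> \<in> space M \<Longrightarrow> path_seg r k \<omega> \<in> lists W"
  using measurable_space[OF path_seg_measurable] by simp

end

context transient_chain
begin

lemma emeasure_trajectory_then_cone:
  assumes c: "c \<in> lists W" "hd c = []" "last c \<noteq> []" "c \<noteq> []"
  shows "emeasure M {\<omega> \<in> space M. map (\<lambda>i. X i \<omega>) [0 ..< length c] = c \<and> (\<forall>i\<ge>length c - 1. prefix (last c) (X i \<omega>))}
    = ennreal (path_weight q c) * hold (ty (last c))"
proof -
  define n where "n = length c - 1"
  have n: "length c = Suc n" using c by (simp add: n_def)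
  have lc: "last c \<in> W" using c last_in_set[of c] by auto
  have "emeasure M {\<omega> \<in> space M. traj X n \<omega> = c \<and> (\<forall>i>n. X i \<omega> \<in> cone F (last c))} =
      ennreal (path_weight q c) * stay_forever q (cone F (last c)) (last c)"
    using n c by (intro emeasure_traj_stay_forever) (auto simp: cone_def)
  also have "stay_forever q (cone F (last c)) (last c) = hold (ty (last c))"
    using lc c by (intro stay_forever_cone)
  also have "{\<omega> \<in> space M. traj X n \<omega> = c \<and> (\<forall>i>n. X i \<omega> \<in> cone F (last c))} =
      {\<omega> \<in> space M. map (\<lambda>i. X i \<omega>) [0 ..< length c] = c \<and> (\<forall>i\<ge>length c - 1. prefix (last c) (X i \<omega>))}"
  proof -
    have "(\<forall>i>n. X i \<omega> \<in> cone F (last c)) \<longleftrightarrow> (\<forall>i\<ge>n. prefix (last c) (X i \<omega>))"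
      if "\<omega> \<in> space M" "traj X n \<omega> = c" for \<omega>
    proof -
      have "X n \<omega> = last c" using that(2) traj_basic(3)[of n \<omega>] by simp
      then show ?thesis
        using X_in_words[OF that(1)] by (auto simp: cone_iff le_less)
    qed
    then show ?thesis unfolding n traj_def[symmetric] by auto
  qed
  finally show ?thesis .
qed

lemma emeasure_path_seg:
  assumes r: "1 \<le> r" and a: "a \<in> lists W"
  shows "emeasure M {\<omega> \<in> space M. path_seg 0 r \<omega> = a} =
    (if valid_seg r a then ennreal (path_weight q a) * hold (ty (last a)) else 0)"
proof -
  have "emeasure M {\<omega> \<in> space M. path_seg 0 r \<omega> = a} =
    emeasure M {\<omega> \<in> space M. valid_seg r a \<and> map (\<lambda>i. X i \<omega>) [0 ..< length a] = a \<and>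
      (\<forall>i\<ge>length a - 1. prefix (last a) (X i \<omega>))}"
  proof (rule emeasure_eq_AE)
    show "AE \<omega> in M. (\<omega> \<in> {\<omega> \<in> space M. path_seg 0 r \<omega> = a}) = (\<omega> \<in> {\<omega> \<in> space M. valid_seg r a \<and>
       map (\<lambda>i. X i \<omega>) [0 ..< length a] = a \<and> (\<forall>i\<ge>length a - 1. prefix (last a) (X i \<omega>))})"
      using AE_transient_walk
    proof eventually_elim
      case (elim \<omega>)
      interpret transient_walk F \<alpha> X \<omega> by fact
      show ?case using seg_0_eq_iff[OF r, of a] by simp
    qed
    have [measurable]: "Measurable.pred M (\<lambda>\<omega>. map (\<lambda>i. X i \<omega>) [0 ..< length a] = a)"
    proof -
      have "map (\<lambda>i. X i \<omega>) [0 ..< length a] = a \<longleftrightarrow> (\<forall>i<length a. X i \<omega> = a ! i)" for \<omega>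
        unfolding list_eq_iff_nth_eq by auto
      then show ?thesis by simp
    qed
    show "{\<omega> \<in> space M. valid_seg r a \<and> map (\<lambda>i. X i \<omega>) [0 ..< length a] = a \<and>
      (\<forall>i\<ge>length a - 1. prefix (last a) (X i \<omega>))} \<in> sets M"
      by measurable
  qed measurable
  also have "\<dots> = (if valid_seg r a then ennreal (path_weight q a) * hold (ty (last a)) else 0)"
  proof (cases "valid_seg r a")
    case True
    then have "hd a = []" "last a \<noteq> []" "a \<noteq> []" using r by (auto simp: valid_seg_def)
    then show ?thesis using emeasure_trajectory_then_cone[OF a] True by simp
  qed simp
  finally show ?thesis .
qed

lemma emeasure_path_seg_path_seg:
  assumes r: "1 \<le> r" "r < k" and a: "a \<in> lists W" and b: "b \<in> lists W"
  shows "emeasure M {\<omega> \<in> space M. path_seg 0 r \<omega> = a \<and> path_seg r k \<omega> = b} =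
    (if valid_seg r a \<and> valid_seg (k - r) b \<and> b \<in> lists (sw (3 - ty (last a)))
     then ennreal (path_weight q a) * (ennreal (path_weight q b) * hold (ty (last b))) else 0)"
proof -
  (* the whole trajectory: the first point of b is the last point of a *)
  define c where "c = a @ map ((@) (last a)) (tl b)"
  have iff: "AE \<omega> in M. (path_seg 0 r \<omega> = a \<and> path_seg r k \<omega> = b) \<longleftrightarrow>
     (valid_seg r a \<and> valid_seg (k - r) b \<and> map (\<lambda>i. X i \<omega>) [0 ..< length c] = c \<and>
      (\<forall>i\<ge>length c - 1. prefix (last c) (X i \<omega>)))"
    using AE_transient_walk
  proof eventually_elim
    case (elim \<omega>)
    interpret transient_walk F \<alpha> X \<omega> by fact
    show ?case by (rule seg_seg_eq_iff[OF r c_def])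
  qed
  show ?thesis
  proof (cases "valid_seg r a \<and> valid_seg (k - r) b")
    case True
    have ab: "2 \<le> length a" "hd a = []" "length (last a) = r" "2 \<le> length b" "hd b = []" "length (last b) = k - r"
      using True by (auto simp: valid_seg_def)
    have ne: "a \<noteq> []" "b \<noteq> []" "tl b \<noteq> []" "last a \<noteq> []" "last b \<noteq> []"
      using ab r by (auto simp: tl_Nil)
    have la: "last a \<in> W" using a ne last_in_set[of a] by auto
    have b_split: "b = [] # tl b" using ab ne by (metis list.collapse)
    have mem: "c \<in> lists W \<longleftrightarrow> b \<in> lists (sw (3 - ty (last a)))"
    proof -
      have "c \<in> lists W \<longleftrightarrow> (\<forall>z\<in>set (tl b). last a @ z \<in> W)" using a by (auto simp: c_def)
      also have "\<dots> \<longleftrightarrow> (\<forall>z\<in>set (tl b). z \<in> sw (3 - ty (last a)))"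
        using words_append_iff[OF la ne(4)] by simp
      also have "\<dots> \<longleftrightarrow> b \<in> lists (sw (3 - ty (last a)))"
        by (subst (2) b_split) auto
      finally show ?thesis .
    qed
    have [measurable]: "Measurable.pred M (\<lambda>\<omega>. map (\<lambda>i. X i \<omega>) [0 ..< length c] = c)"
    proof -
      have "map (\<lambda>i. X i \<omega>) [0 ..< length c] = c \<longleftrightarrow> (\<forall>i<length c. X i \<omega> = c ! i)" for \<omega>
        unfolding list_eq_iff_nth_eq by auto
      then show ?thesis by simp
    qed
    have "emeasure M {\<omega> \<in> space M. path_seg 0 r \<omega> = a \<and> path_seg r k \<omega> = b} =
       emeasure M {\<omega> \<in> space M. map (\<lambda>i. X i \<omega>) [0 ..< length c] = c \<and> (\<forall>i\<ge>length c - 1. prefix (last c) (X i \<omega>))}"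
      using iff True by (intro emeasure_eq_AE) auto
    also have "\<dots> = (if c \<in> lists W then ennreal (path_weight q c) * hold (ty (last c)) else 0)"
    proof (cases "c \<in> lists W")
      case True
      then show ?thesis
        using emeasure_trajectory_then_cone[of c] ne ab by (simp add: c_def last_map)
    next
      case False
      have "{\<omega> \<in> space M. map (\<lambda>i. X i \<omega>) [0 ..< length c] = c \<and> (\<forall>i\<ge>length c - 1. prefix (last c) (X i \<omega>))} = {}"
      proof -
        have "map (\<lambda>i. X i \<omega>) [0 ..< length c] \<noteq> c" if "\<omega> \<in> space M" for \<omega>
        proof
          assume "map (\<lambda>i. X i \<omega>) [0 ..< length c] = c"
          then have "set c = set (map (\<lambda>i. X i \<omega>) [0 ..< length c])" by simp
          then have "set c \<subseteq> W" using X_in_words[OF that] by auto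
          then show False using False by auto
        qed
        then show ?thesis by blast
      qed
      then show ?thesis using False by (simp only: emeasure_empty if_False)
    qed
    finally have em: "emeasure M {\<omega> \<in> space M. path_seg 0 r \<omega> = a \<and> path_seg r k \<omega> = b} =
      (if c \<in> lists W then ennreal (path_weight q c) * hold (ty (last c)) else 0)" .
    have "last c = last a @ last b" using ne(3) by (simp add: c_def last_map last_tl)
    then have tyc: "ty (last c) = ty (last b)" using ne(5) by (simp add: type_append)
    have pwc: "path_weight q c = path_weight q a * path_weight q b" if cW: "c \<in> lists W"
    proof -
      have "last a # map ((@) (last a)) (tl b) = map ((@) (last a)) ([] # tl b)" by simp
      then have "last a # map ((@) (last a)) (tl b) = map ((@) (last a)) b"
        by (simp only: b_split[symmetric])
      moreover have "path_weight q (map ((@) (last a)) b) = path_weight q b"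
        by (rule path_weight_shift[OF la ne(4) iffD1[OF mem cW]])
      ultimately show ?thesis by (simp only: c_def path_weight_append[OF ne(1)])
    qed
    show ?thesis
    proof (cases "c \<in> lists W")
      case cW: True
      have "ennreal (path_weight q c) * hold (ty (last c)) =
          ennreal (path_weight q a) * (ennreal (path_weight q b) * hold (ty (last b)))"
        unfolding pwc[OF cW] tyc by (simp add: ennreal_mult' path_weight_nonneg mult.assoc)
      then show ?thesis using em cW mem True by (simp only: if_True simp_thms)
    next
      case False
      then show ?thesis using em mem by (simp only: if_False simp_thms)
    qed
  next
    case False
    have "emeasure M {\<omega> \<in> space M. path_seg 0 r \<omega> = a \<and> path_seg r k \<omega> = b} = emeasure M {}"
      using iff False by (intro emeasure_eq_AE) auto
    then show ?thesis using False by auto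
  qed
qed

end

section \<open>Independence of segments given the type of the first final cone\<close>

definition alt_type :: "nat \<Rightarrow> nat \<Rightarrow> nat" where
  "alt_type t r = (if odd r then t else 3 - t)"

lemma alt_type_mem: "t \<in> {1, 2} \<Longrightarrow> alt_type t r \<in> {1, 2}"
  by (auto simp: alt_type_def)

context transient_chain
begin

text \<open>The type of the first letter of the limiting word.  It fixes the types of all \<open>X\<close> at final cone
  entries, and it is the only information that a segment shares with the past.\<close>

definition ftype :: "'w \<Rightarrow> nat" where
  "ftype \<omega> = ty [hd (last (path_seg 0 1 \<omega>))]"

text \<open>The law of a segment with level difference \<open>d\<close> that starts at a word of type \<open>s\<close>.\<close>

definition seg_law :: "nat \<Rightarrow> nat \<Rightarrow> 'a list list \<Rightarrow> ennreal" where
  "seg_law s d b = (if valid_seg d b \<and> b \<in> lists (sw (3 - s))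
     then ennreal (path_weight q b) * hold (ty (last b)) / hold s else 0)"

definition seg_dist :: "nat \<Rightarrow> nat \<Rightarrow> 'a list list measure" where
  "seg_dist s d = density (count_space (lists W)) (seg_law s d)"

lemma ftype_mem: "ftype \<omega> \<in> {1, 2}"
  using type_cases[of "[hd (last (path_seg 0 1 \<omega>))]"] by (auto simp: ftype_def)

lemma pred_ftype [measurable]: "Measurable.pred M (\<lambda>\<omega>. ftype \<omega> = t)"
  unfolding ftype_def by (rule pred_path_seg)

lemma AE_ftype:
  assumes "1 \<le> r"
  shows "AE \<omega> in M. ty [hd (last (path_seg 0 r \<omega>))] = ftype \<omega>"
  using AE_transient_walk
proof eventually_elim
  case (elim \<omega>)
  interpret transient_walk F \<alpha> X \<omega> by fact
  have l: "last (path_seg 0 r \<omega>) = X (e r) \<omega>" "last (path_seg 0 1 \<omega>) = X (e 1) \<omega>"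
    using seg_basic(3)[of 0 r] seg_basic(3)[of 0 1] by auto
  have "X (e 1) \<omega> = take 1 (X (e r) \<omega>)" by (rule take_final_entry[OF assms])
  moreover have "X (e r) \<omega> \<noteq> []" using length_at_final_entry[of r] assms by auto
  ultimately have "hd (X (e 1) \<omega>) = hd (X (e r) \<omega>)" by simp
  then show ?case by (simp add: ftype_def l)
qed

text \<open>For prescribed segments \<open>a\<close>, \<open>b\<close> the probability is the product of the weights of \<open>a\<close> and \<open>b\<close> with
  the holding probability at the end of \<open>b\<close>.  Dividing by the holding probability at the end of \<open>a\<close>
  separates the two, and this one depends on \<open>a\<close> only through its type, which is a constant here.\<close>

lemma emeasure_joint_segments:
  assumes r: "1 \<le> r" "r < k" and t: "t \<in> {1, 2}" and B: "B \<subseteq> lists W"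
  shows "emeasure M {\<omega> \<in> space M. (path_seg 0 r \<omega> \<in> A \<and> ftype \<omega> = t) \<and> path_seg r k \<omega> \<in> B}
    = emeasure M {\<omega> \<in> space M. path_seg 0 r \<omega> \<in> A \<and> ftype \<omega> = t} * emeasure (seg_dist (alt_type t r) (k - r)) B"
proof -
  let ?s = "alt_type t r"
  define A' where "A' = {a \<in> A \<inter> lists W. valid_seg r a \<and> ty [hd (last a)] = t}"
  have A': "A' \<subseteq> lists W" by (auto simp: A'_def)
  have AE_A': "AE \<omega> in M. (path_seg 0 r \<omega> \<in> A \<and> ftype \<omega> = t) = (path_seg 0 r \<omega> \<in> A')"
    using AE_ftype[OF r(1)] AE_transient_walk AE_space
  proof eventually_elim
    case (elim \<omega>)
    interpret transient_walk F \<alpha> X \<omega> by fact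
    show ?case using elim valid_seg_seg[of 0 r] r path_seg_in_lists[of \<omega> 0 r] by (auto simp: A'_def)
  qed
  have h: "hold ?s \<noteq> 0" "hold ?s \<noteq> top"
    using hold_pos[OF alt_type_mem[OF t, of r]] hold_le_1[of ?s] by (auto simp: top_unique)
  have factor: "emeasure M {\<omega> \<in> space M. path_seg r k \<omega> = b \<and> path_seg 0 r \<omega> = a} =
      emeasure M {\<omega> \<in> space M. path_seg 0 r \<omega> = a} * seg_law ?s (k - r) b"
    if a: "a \<in> A'" and b: "b \<in> B" for a b
  proof -
    have aW: "a \<in> lists W" and bW: "b \<in> lists W" and va: "valid_seg r a" using a b B by (auto simp: A'_def)
    have la: "length (last a) = r" "last a \<noteq> []" "a \<noteq> []" using va r by (auto simp: valid_seg_def)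
    have "last a \<in> W" using aW la last_in_set[of a] by auto
    then have "ty (last a) = ?s"
      using type_alternates[of "last a"] la a by (simp add: A'_def alt_type_def)
    moreover have "hold ?s * (c * h' / hold ?s) = c * h'" for c h'
      using h by (simp add: ennreal_times_divide mult.commute[of "hold ?s"] mult_divide_eq_ennreal)
    ultimately show ?thesis
      using va by (subst conj_commute)
        (simp add: emeasure_path_seg[OF r(1) aW] emeasure_path_seg_path_seg[OF r aW bW] seg_law_def mult.assoc)
  qed
  have "emeasure M {\<omega> \<in> space M. (path_seg 0 r \<omega> \<in> A \<and> ftype \<omega> = t) \<and> path_seg r k \<omega> \<in> B}
    = emeasure M {\<omega> \<in> space M. path_seg 0 r \<omega> \<in> A' \<and> path_seg r k \<omega> \<in> B}"
    by (rule emeasure_eq_AE) (use AE_A' in \<open>auto elim!: eventually_mono\<close>)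
  also have "\<dots> = (\<integral>\<^sup>+ a. emeasure M {\<omega> \<in> space M. path_seg 0 r \<omega> = a \<and> path_seg r k \<omega> \<in> B} \<partial>count_space A')"
    by (rule emeasure_partition[OF path_seg_measurable countable_lists_words A']) measurable
  also have "\<dots> = (\<integral>\<^sup>+ a. (\<integral>\<^sup>+ b. emeasure M {\<omega> \<in> space M. path_seg r k \<omega> = b \<and> path_seg 0 r \<omega> = a}
      \<partial>count_space B) \<partial>count_space A')"
    by (intro nn_integral_cong, subst conj_commute)
       (rule emeasure_partition[OF path_seg_measurable countable_lists_words B], measurable)
  also have "\<dots> = (\<integral>\<^sup>+ a. (\<integral>\<^sup>+ b. emeasure M {\<omega> \<in> space M. path_seg 0 r \<omega> = a} * seg_law ?s (k - r) b
      \<partial>count_space B) \<partial>count_space A')"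
    by (intro nn_integral_cong) (simp add: factor)
  also have "\<dots> = (\<integral>\<^sup>+ a. emeasure M {\<omega> \<in> space M. path_seg 0 r \<omega> = a \<and> True} \<partial>count_space A') *
      (\<integral>\<^sup>+ b. seg_law ?s (k - r) b \<partial>count_space B)"
    by (simp add: nn_integral_cmult nn_integral_multc)
  also have "(\<integral>\<^sup>+ a. emeasure M {\<omega> \<in> space M. path_seg 0 r \<omega> = a \<and> True} \<partial>count_space A') =
      emeasure M {\<omega> \<in> space M. path_seg 0 r \<omega> \<in> A' \<and> True}"
    by (rule emeasure_partition[OF path_seg_measurable countable_lists_words A', symmetric]) measurable
  also have "\<dots> = emeasure M {\<omega> \<in> space M. path_seg 0 r \<omega> \<in> A \<and> ftype \<omega> = t}"
    by (rule emeasure_eq_AE) (use AE_A' in \<open>auto elim!: eventually_mono\<close>)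
  also have "(\<integral>\<^sup>+ b. seg_law ?s (k - r) b \<partial>count_space B) = emeasure (seg_dist ?s (k - r)) B"
    using B by (auto simp: seg_dist_def emeasure_density nn_integral_count_space_indicator indicator_def
        intro!: nn_integral_cong)
  finally show ?thesis .
qed

end

text \<open>Conditioning on the type of the first letter turns the factorisation into independence.\<close>

locale typed_chain = transient_chain F \<alpha> M X
  for F :: "'a free_factors" and \<alpha> :: real and M :: "'w measure" and X :: "nat \<Rightarrow> 'w \<Rightarrow> 'a list" +
  fixes t :: nat
  assumes t: "t \<in> {1, 2}" and type_possible: "emeasure M {\<omega> \<in> space M. ftype \<omega> = t} \<noteq> 0"
begin

definition T :: "'w set" where "T = {\<omega> \<in> space M. ftype \<omega> = t}"

definition N :: "'w measure" where "N = uniform_measure M T"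

lemma T_sets [measurable]: "T \<in> sets M"
  unfolding T_def by measurable

lemma T_pos: "emeasure M T \<noteq> 0" "0 < prob T"
  using type_possible by (auto simp: T_def emeasure_eq_measure less_le)

sublocale N: prob_space N
  unfolding N_def using T_pos by (intro prob_space_uniform_measure) auto

lemma sets_N [measurable_cong, simp]: "sets N = sets M" and space_N [simp]: "space N = space M"
  by (simp_all add: N_def)

lemma AE_N: "AE \<omega> in M. P \<omega> \<Longrightarrow> AE \<omega> in N. P \<omega>"
  unfolding N_def using T_pos by (subst AE_uniform_measure) (auto simp: emeasure_eq_measure)

lemma AE_N_iff: "(AE \<omega> in N. P \<omega>) \<longleftrightarrow> (AE \<omega> in M. ftype \<omega> = t \<longrightarrow> P \<omega>)"
  unfolding N_def using T_pos
  by (subst AE_uniform_measure) (auto simp: emeasure_eq_measure T_def intro!: AE_cong)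

lemma nn_integral_N_le:
  assumes "f \<in> borel_measurable M"
  shows "(\<integral>\<^sup>+ \<omega>. f \<omega> \<partial>N) \<le> (\<integral>\<^sup>+ \<omega>. f \<omega> \<partial>M) / ennreal (prob T)"
  using assms unfolding N_def
  by (subst nn_integral_uniform_measure)
     (auto simp: emeasure_eq_measure intro!: divide_right_mono_ennreal nn_integral_mono split: split_indicator)

lemma emeasure_N_joint:
  assumes r: "1 \<le> r" "r < k" and B: "B \<subseteq> lists W"
  shows "emeasure N {\<omega> \<in> space M. path_seg 0 r \<omega> \<in> A \<and> path_seg r k \<omega> \<in> B}
     = emeasure N {\<omega> \<in> space M. path_seg 0 r \<omega> \<in> A} * emeasure (seg_dist (alt_type t r) (k - r)) B"
proof -
  have "T \<inter> {\<omega> \<in> space M. path_seg 0 r \<omega> \<in> A \<and> path_seg r k \<omega> \<in> B} =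
     {\<omega> \<in> space M. (path_seg 0 r \<omega> \<in> A \<and> ftype \<omega> = t) \<and> path_seg r k \<omega> \<in> B}"
    "T \<inter> {\<omega> \<in> space M. path_seg 0 r \<omega> \<in> A} = {\<omega> \<in> space M. path_seg 0 r \<omega> \<in> A \<and> ftype \<omega> = t}"
    by (auto simp: T_def)
  moreover have "emeasure N E = emeasure M (T \<inter> E) / emeasure M T" if "E \<in> sets M" for E
    using that by (simp add: N_def)
  moreover have "{\<omega> \<in> space M. path_seg 0 r \<omega> \<in> A \<and> path_seg r k \<omega> \<in> B} \<in> sets M"
    "{\<omega> \<in> space M. path_seg 0 r \<omega> \<in> A} \<in> sets M"
    by measurable
  ultimately show ?thesis
    by (simp only: emeasure_joint_segments[OF r t B] divide_ennreal_def mult_ac)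
qed

lemma emeasure_N_seg:
  assumes r: "1 \<le> r" "r < k" and B: "B \<subseteq> lists W"
  shows "emeasure N {\<omega> \<in> space M. path_seg r k \<omega> \<in> B} = emeasure (seg_dist (alt_type t r) (k - r)) B"
  using emeasure_N_joint[OF assms, of UNIV] N.emeasure_space_1 by simp

lemma seg_measurable_N: "path_seg r k \<in> measurable N (count_space (lists W))"
  using path_seg_measurable by (simp add: measurable_def)

lemma distr_seg:
  assumes r: "1 \<le> r" "r < k"
  shows "distr N (count_space (lists W)) (path_seg r k) = seg_dist (alt_type t r) (k - r)"
proof (rule measure_eqI)
  fix B assume "B \<in> sets (distr N (count_space (lists W)) (path_seg r k))"
  then have B: "B \<subseteq> lists W" by simp
  have "emeasure (distr N (count_space (lists W)) (path_seg r k)) B = emeasure N {\<omega> \<in> space M. path_seg r k \<omega> \<in> B}"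
    using B by (subst emeasure_distr[OF seg_measurable_N]) (auto intro!: arg_cong[where f = "emeasure N"])
  then show "emeasure (distr N (count_space (lists W)) (path_seg r k)) B = emeasure (seg_dist (alt_type t r) (k - r)) B"
    using emeasure_N_seg[OF r B] by simp
qed (simp add: seg_dist_def)

lemma indep_segments:
  assumes r: "1 \<le> r" "r < k"
  shows "N.indep_var (count_space (lists W)) (path_seg 0 r) (count_space (lists W)) (path_seg r k)"
  unfolding N.indep_var_eq
proof (intro conjI)
  show "path_seg 0 r \<in> measurable N (count_space (lists W))" "path_seg r k \<in> measurable N (count_space (lists W))"
    by (rule seg_measurable_N)+
  let ?G = "\<lambda>Z. {Z -` A \<inter> space N |A. A \<in> sets (count_space (lists W))}"
  have sub: "?G (path_seg i j) \<subseteq> sets N" for i j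
    using measurable_sets[OF seg_measurable_N] by blast
  have stable: "Int_stable (?G Z)" for Z :: "'w \<Rightarrow> 'a list list"
  proof (rule Int_stableI)
    fix a b assume "a \<in> ?G Z" "b \<in> ?G Z"
    then obtain A B where "a = Z -` A \<inter> space N" "b = Z -` B \<inter> space N" "A \<subseteq> lists W" "B \<subseteq> lists W" by auto
    then have "a \<inter> b = Z -` (A \<inter> B) \<inter> space N" "A \<inter> B \<in> sets (count_space (lists W))" by auto
    then show "a \<inter> b \<in> ?G Z" by blast
  qed
  show "N.indep_set (sigma_sets (space N) (?G (path_seg 0 r))) (sigma_sets (space N) (?G (path_seg r k)))"
  proof (rule N.indep_set_sigma_sets[OF _ stable stable])
    show "N.indep_set (?G (path_seg 0 r)) (?G (path_seg r k))"
    proof (rule N.indep_setI[OF sub sub])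
      fix a b assume "a \<in> ?G (path_seg 0 r)" "b \<in> ?G (path_seg r k)"
      then obtain A B where ab: "a = {\<omega> \<in> space M. path_seg 0 r \<omega> \<in> A}" "b = {\<omega> \<in> space M. path_seg r k \<omega> \<in> B}"
        and B: "B \<subseteq> lists W" by (auto simp: vimage_def Int_def conj_commute)
      have "a \<inter> b = {\<omega> \<in> space M. path_seg 0 r \<omega> \<in> A \<and> path_seg r k \<omega> \<in> B}" using ab by auto
      then have "emeasure N (a \<inter> b) = emeasure N a * emeasure N b"
        using emeasure_N_joint[OF r B, of A] emeasure_N_seg[OF r B] ab by simp
      then show "N.prob (a \<inter> b) = N.prob a * N.prob b"
        by (simp add: N.emeasure_eq_measure ennreal_mult'[symmetric])
    qed
  qed
qed

end

section \<open>Limits of averages\<close>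

lemma averages_tendsto_of_tendsto:
  fixes a :: "nat \<Rightarrow> real"
  assumes a: "a \<longlonglongrightarrow> l"
  shows "(\<lambda>n. (\<Sum>k<n. a k) / real n) \<longlonglongrightarrow> l"
proof (rule LIMSEQ_I)
  fix \<epsilon> :: real assume \<epsilon>: "0 < \<epsilon>"
  obtain N where N: "\<And>k. k \<ge> N \<Longrightarrow> norm (a k - l) < \<epsilon> / 2"
    using LIMSEQ_D[OF a, of "\<epsilon> / 2"] \<epsilon> by auto
  define B where "B = (\<Sum>k<N. \<bar>a k - l\<bar>)"
  have B: "0 \<le> B" by (simp add: B_def sum_nonneg)
  obtain N' :: nat where N': "2 * B / \<epsilon> < real N'" using reals_Archimedean2 by blast
  have "norm ((\<Sum>k<n. a k) / real n - l) < \<epsilon>" if n: "n \<ge> Suc (max N N')" for n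
  proof -
    have n0: "0 < real n" "N \<le> n" "real N' \<le> real n" using n by auto
    have "{..<n} = {..<N} \<union> {N..<n}" using n0 by auto
    then have "(\<Sum>k<n. \<bar>a k - l\<bar>) = (\<Sum>k\<in>{..<N} \<union> {N..<n}. \<bar>a k - l\<bar>)" by (rule arg_cong)
    also have "\<dots> = B + (\<Sum>k=N..<n. \<bar>a k - l\<bar>)"
      unfolding B_def by (rule sum.union_disjoint) auto
    finally have split: "(\<Sum>k<n. \<bar>a k - l\<bar>) = B + (\<Sum>k=N..<n. \<bar>a k - l\<bar>)" .
    have "\<bar>\<Sum>k<n. a k - l\<bar> \<le> (\<Sum>k<n. \<bar>a k - l\<bar>)" by (rule sum_abs)
    also note split
    also have "(\<Sum>k=N..<n. \<bar>a k - l\<bar>) \<le> (\<Sum>k=N..<n. \<epsilon> / 2)"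
      using N by (intro sum_mono) (auto simp: less_imp_le)
    also have "\<dots> \<le> real n * (\<epsilon> / 2)" using \<epsilon> by simp
    also have "B < real n * (\<epsilon> / 2)"
    proof -
      have "2 * B < real N' * \<epsilon>" using N' \<epsilon> by (simp add: divide_less_eq)
      also have "\<dots> \<le> real n * \<epsilon>" using n0 \<epsilon> by (intro mult_right_mono) auto
      finally show ?thesis by simp
    qed
    finally have "\<bar>\<Sum>k<n. a k - l\<bar> < real n * \<epsilon>" by (simp add: field_simps)
    moreover have "(\<Sum>k<n. a k) / real n - l = (\<Sum>k<n. a k - l) / real n"
      using n0 by (simp add: sum_subtractf field_simps)
    ultimately show ?thesis using n0 by (simp add: abs_divide divide_less_eq mult.commute)
  qed
  then show "\<exists>no. \<forall>n\<ge>no. norm ((\<Sum>k<n. a k) / real n - l) < \<epsilon>" by blast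
qed

text \<open>The means of the summands need not converge, because the types at even and odd positions differ; their
  averages converge when the sums of two neighbours do.\<close>

lemma averages_tendsto_of_pair_sums:
  fixes y :: "nat \<Rightarrow> real"
  assumes bound: "\<And>k. \<bar>y k\<bar> \<le> B" and lim: "(\<lambda>k. y k + y (Suc k)) \<longlonglongrightarrow> l"
  shows "(\<lambda>n. (\<Sum>k<n. y k) / real n) \<longlonglongrightarrow> l / 2"
proof -
  have "(\<Sum>k<n. y k + y (Suc k)) = 2 * (\<Sum>k<n. y k) - y 0 + y n" for n
    by (induction n) auto
  then have eq: "(\<Sum>k<n. y k) / real n = ((\<Sum>k<n. y k + y (Suc k)) / real n + (y 0 - y n) / real n) / 2" for n
    by (simp add: add_divide_distrib[symmetric])
  have "(\<lambda>n. (y 0 - y n) / real n) \<longlonglongrightarrow> 0"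
  proof (rule Lim_null_comparison)
    show "\<forall>\<^sub>F n in sequentially. norm ((y 0 - y n) / real n) \<le> 2 * B / real n"
    proof (rule always_eventually, rule allI)
      fix n
      have "\<bar>y 0 - y n\<bar> \<le> 2 * B" using bound[of 0] bound[of n] by linarith
      then show "norm ((y 0 - y n) / real n) \<le> 2 * B / real n"
        by (simp add: abs_divide divide_right_mono)
    qed
    show "(\<lambda>n. 2 * B / real n) \<longlonglongrightarrow> 0" by (rule lim_const_over_n)
  qed
  from tendsto_add[OF averages_tendsto_of_tendsto[OF lim] this]
  have "(\<lambda>n. ((\<Sum>k<n. y k + y (Suc k)) / real n + (y 0 - y n) / real n) / 2) \<longlonglongrightarrow> (l + 0) / 2"
    by (rule tendsto_divide) auto
  then show ?thesis unfolding eq by simp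
qed

text \<open>Each \<open>S d\<close> approximates all late members of \<open>u\<close>, so \<open>u\<close> is Cauchy and shares its limit with \<open>S\<close>.
  In the application \<open>u\<close> depends on the type of the first letter and \<open>S\<close> does not.\<close>

lemma uniform_approximation_limit:
  fixes u S \<epsilon> :: "nat \<Rightarrow> real"
  assumes approx: "\<And>d k. 1 \<le> d \<Longrightarrow> d < k \<Longrightarrow> \<bar>u k - S d\<bar> \<le> \<epsilon> d" and \<epsilon>: "\<epsilon> \<longlonglongrightarrow> 0"
  shows "\<exists>l. u \<longlonglongrightarrow> l \<and> S \<longlonglongrightarrow> l"
proof -
  have "Cauchy u"
  proof (rule metric_CauchyI)
    fix \<eta> :: real assume "0 < \<eta>"
    then obtain d0 where d0: "\<And>d. d \<ge> d0 \<Longrightarrow> norm (\<epsilon> d - 0) < \<eta> / 2"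
      using LIMSEQ_D[OF \<epsilon>, of "\<eta> / 2"] by auto
    define d where "d = Suc d0"
    have d: "1 \<le> d" "\<epsilon> d < \<eta> / 2" using d0[of d] by (auto simp: d_def)
    have "dist (u k) (u k') < \<eta>" if "k \<ge> Suc d" "k' \<ge> Suc d" for k k'
      using approx[of d k] approx[of d k'] that d by (auto simp: dist_real_def)
    then show "\<exists>M. \<forall>m\<ge>M. \<forall>n\<ge>M. dist (u m) (u n) < \<eta>" by blast
  qed
  then obtain l where l: "u \<longlonglongrightarrow> l" using Cauchy_convergent convergent_def by blast
  have "(\<lambda>d. S d - l) \<longlonglongrightarrow> 0"
  proof (rule Lim_null_comparison[OF _ \<epsilon>])
    show "\<forall>\<^sub>F d in sequentially. norm (S d - l) \<le> \<epsilon> d"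
      using eventually_ge_at_top[of 1]
    proof eventually_elim
      case (elim d)
      have "(\<lambda>k. \<bar>u k - S d\<bar>) \<longlonglongrightarrow> \<bar>l - S d\<bar>" by (intro tendsto_intros l)
      moreover have "\<forall>\<^sub>F k in sequentially. \<bar>u k - S d\<bar> \<le> \<epsilon> d"
        using eventually_gt_at_top[of d] by eventually_elim (rule approx[OF elim])
      ultimately have "\<bar>l - S d\<bar> \<le> \<epsilon> d" by (intro tendsto_upperbound[of _ _ sequentially]) auto
      then show ?case by (simp add: abs_minus_commute)
    qed
  qed
  then have "S \<longlonglongrightarrow> l" by (simp add: LIM_zero_iff)
  then show ?thesis using l by blast
qed

lemma (in prob_space) integrable_of_nn_integral_bound:
  fixes f :: "'a \<Rightarrow> real"
  assumes [measurable]: "f \<in> borel_measurable M" and nn: "\<And>\<omega>. 0 \<le> f \<omega>"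
    and le: "(\<integral>\<^sup>+ \<omega>. ennreal (f \<omega>) \<partial>M) \<le> ennreal B" and B: "0 \<le> B"
  shows "integrable M f" "expectation f \<le> B"
proof -
  show int: "integrable M f"
    using le by (intro integrableI_nonneg) (auto simp: nn intro: le_less_trans)
  have "ennreal (expectation f) = (\<integral>\<^sup>+ \<omega>. ennreal (f \<omega>) \<partial>M)"
    by (rule nn_integral_eq_integral[symmetric, OF int]) (simp add: nn)
  then show "expectation f \<le> B" using le B by (metis ennreal_le_iff)
qed

section \<open>A strong law for functionals of segments\<close>

locale moment_chain = transient_chain F \<alpha> M X
  for F :: "'a free_factors" and \<alpha> :: real and M :: "'w measure" and X :: "nat \<Rightarrow> 'w \<Rightarrow> 'a list" +
  fixes R K :: real
  assumes R: "1 < R" and K: "1 \<le> K"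
    and moment: "\<And>k. 2 \<le> k \<Longrightarrow>
      (\<integral>\<^sup>+ \<omega>. ennreal (R ^ path_length (cone_path (seg (\<lambda>i. X i \<omega>) 0 k))) \<partial>M) \<le> ennreal K"
begin

definition len :: "nat \<Rightarrow> 'w \<Rightarrow> nat" where
  "len k \<omega> = path_length (cone_path (path_seg 0 k \<omega>))"

lemma len_power_measurable [measurable]: "(\<lambda>\<omega>. r ^ len k \<omega> :: real) \<in> borel_measurable M"
  unfolding len_def by (rule measurable_compose[OF path_seg_measurable]) simp

end

text \<open>A functional of segments whose value up to the \<open>k\<close>-th final cone entry is at most a multiple of
  $r_0^{\mathrm{length}(\psi_k)}$ and depends on the start \<open>r\<close> of the segment only if $\psi_{r+1}$ is long.
  The instances are the two signed parts of the values of the cone-additive function on the pieces of the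
  trajectory, and the increments of the final cone entry times.\<close>

locale segment_functional = moment_chain F \<alpha> M X R K
  for F :: "'a free_factors" and \<alpha> :: real and M :: "'w measure" and X :: "nat \<Rightarrow> 'w \<Rightarrow> 'a list"
    and R K :: real +
  fixes g :: "'a list list \<Rightarrow> real" and C0 r0 :: real
  assumes g_nonneg: "\<And>b. 0 \<le> g b" and C0: "0 < C0" and r0: "1 < r0" "r0 < R"
    and g_bound: "AE \<omega> in M. \<forall>k\<ge>2. \<forall>r<k. g (path_seg r k \<omega>) \<le> C0 * r0 ^ len k \<omega>"
    and g_local: "AE \<omega> in M. \<forall>r\<ge>1. \<forall>k>r. g (path_seg r k \<omega>) \<noteq> g (path_seg 0 k \<omega>) \<longrightarrow>
       k \<le> len (Suc r) \<omega> + r + 2"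
begin

abbreviation Y :: "nat \<Rightarrow> nat \<Rightarrow> 'w \<Rightarrow> real" where "Y r k \<omega> \<equiv> g (path_seg r k \<omega>)"

lemma Y_measurable [measurable]: "Y r k \<in> borel_measurable M"
  by (rule measurable_compose[OF path_seg_measurable]) simp

text \<open>The largest order of moments up to $2$ that the moments of $R^{\mathrm{length}(\psi_k)}$ control.\<close>

definition p :: real where "p = min 2 (ln R / ln r0)"

lemma p_props: "1 < p" "p \<le> 2" "r0 powr p \<le> R"
proof -
  have "1 < ln R / ln r0" using r0 by (simp add: less_divide_eq)
  then show "1 < p" "p \<le> 2" by (auto simp: p_def)
  have "r0 powr p \<le> r0 powr (ln R / ln r0)" using r0 by (intro powr_mono) (auto simp: p_def)
  also have "\<dots> = R" using r0 R by (simp add: powr_def)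
  finally show "r0 powr p \<le> R" .
qed

lemma bound_powr_le: "(C0 * r0 ^ n) powr p \<le> C0 powr p * R ^ n"
proof -
  have "(C0 * r0 ^ n) powr p = C0 powr p * (r0 powr p) ^ n"
    using C0 r0 by (simp add: powr_mult powr_powr powr_power mult.commute flip: powr_realpow)
  also have "\<dots> \<le> C0 powr p * R ^ n"
    using p_props by (intro mult_left_mono power_mono) auto
  finally show ?thesis .
qed

definition mean :: "nat \<Rightarrow> nat \<Rightarrow> real" where
  "mean s d = (\<integral>b. g b \<partial>seg_dist s d)"

end

locale typed_functional = typed_chain F \<alpha> M X t + segment_functional F \<alpha> M X R K g C0 r0
  for F :: "'a free_factors" and \<alpha> :: real and M :: "'w measure" and X :: "nat \<Rightarrow> 'w \<Rightarrow> 'a list"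
    and t :: nat and R K :: real and g :: "'a list list \<Rightarrow> real" and C0 r0 :: real
begin

lemma borel_N: "f \<in> borel_measurable M \<Longrightarrow> f \<in> borel_measurable N"
  by (simp add: measurable_def)

definition K1 :: real where "K1 = C0 powr p * (K / prob T)"
definition K2 :: real where "K2 = K / prob T * R\<^sup>2"

lemma K_pos: "0 < K / prob T" "0 < K1" "0 < K2"
  using K T_pos(2) C0 R by (auto simp: K1_def K2_def)

lemma len_moment:
  assumes k: "2 \<le> k"
  shows "integrable N (\<lambda>\<omega>. R ^ len k \<omega>)" "N.expectation (\<lambda>\<omega>. R ^ len k \<omega>) \<le> K / prob T"
proof -
  have "(\<integral>\<^sup>+ \<omega>. ennreal (R ^ len k \<omega>) \<partial>N) \<le> (\<integral>\<^sup>+ \<omega>. ennreal (R ^ len k \<omega>) \<partial>M) / ennreal (prob T)"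
    by (rule nn_integral_N_le) measurable
  also have "\<dots> \<le> ennreal K / ennreal (prob T)"
    using moment[OF k] by (intro divide_right_mono_ennreal) (simp add: len_def)
  also have "\<dots> = ennreal (K / prob T)" using K T_pos by (simp add: divide_ennreal)
  finally have le: "(\<integral>\<^sup>+ \<omega>. ennreal (R ^ len k \<omega>) \<partial>N) \<le> ennreal (K / prob T)" .
  show "integrable N (\<lambda>\<omega>. R ^ len k \<omega>)" "N.expectation (\<lambda>\<omega>. R ^ len k \<omega>) \<le> K / prob T"
    using N.integrable_of_nn_integral_bound[OF borel_N[OF len_power_measurable] _ le] R K_pos by auto
qed

lemma AE_Y_le:
  assumes "2 \<le> k" "r < k"
  shows "AE \<omega> in N. Y r k \<omega> \<le> C0 * r0 ^ len k \<omega>"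
  using AE_N[OF g_bound]
proof eventually_elim
  case (elim \<omega>)
  show ?case by (rule elim[rule_format, OF assms])
qed

lemma Y_powr_integrable:
  assumes k: "2 \<le> k" "r < k"
  shows "integrable N (\<lambda>\<omega>. Y r k \<omega> powr p)" "N.expectation (\<lambda>\<omega>. Y r k \<omega> powr p) \<le> K1"
proof -
  have ae: "AE \<omega> in N. Y r k \<omega> powr p \<le> C0 powr p * R ^ len k \<omega>"
    using AE_Y_le[OF k]
  proof eventually_elim
    case (elim \<omega>)
    then have "Y r k \<omega> powr p \<le> (C0 * r0 ^ len k \<omega>) powr p"
      using g_nonneg p_props by (intro powr_mono2) auto
    also note bound_powr_le
    finally show ?case .
  qed
  show int: "integrable N (\<lambda>\<omega>. Y r k \<omega> powr p)"
  proof (rule Bochner_Integration.integrable_bound)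
    show "integrable N (\<lambda>\<omega>. C0 powr p * R ^ len k \<omega>)" using len_moment[OF k(1)] by simp
    show "(\<lambda>\<omega>. Y r k \<omega> powr p) \<in> borel_measurable N" by (rule borel_N) measurable
    show "AE \<omega> in N. norm (Y r k \<omega> powr p) \<le> norm (C0 powr p * R ^ len k \<omega>)"
      using ae by eventually_elim (use R in auto)
  qed
  have "N.expectation (\<lambda>\<omega>. Y r k \<omega> powr p) \<le> N.expectation (\<lambda>\<omega>. C0 powr p * R ^ len k \<omega>)"
    using len_moment[OF k(1)] by (intro integral_mono_AE int ae) auto
  also have "\<dots> = C0 powr p * N.expectation (\<lambda>\<omega>. R ^ len k \<omega>)" by simp
  also have "\<dots> \<le> K1" unfolding K1_def by (intro mult_left_mono len_moment k) simp
  finally show "N.expectation (\<lambda>\<omega>. Y r k \<omega> powr p) \<le> K1" .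
qed

lemma dominating_integrable:
  assumes "2 \<le> k" shows "integrable N (\<lambda>\<omega>. C0 * r0 ^ len k \<omega>)"
proof (rule Bochner_Integration.integrable_bound)
  show "integrable N (\<lambda>\<omega>. C0 * R ^ len k \<omega>)" using len_moment[OF assms] by simp
  show "(\<lambda>\<omega>. C0 * r0 ^ len k \<omega>) \<in> borel_measurable N" by (rule borel_N) measurable
  show "AE \<omega> in N. norm (C0 * r0 ^ len k \<omega>) \<le> norm (C0 * R ^ len k \<omega>)"
    using C0 r0 R by (auto simp: abs_mult intro!: power_mono)
qed

lemma Y_integrable:
  assumes k: "2 \<le> k" "r < k"
  shows "integrable N (Y r k)"
proof (rule Bochner_Integration.integrable_bound[OF dominating_integrable[OF k(1)]])
  show "Y r k \<in> borel_measurable N" by (rule borel_N) measurable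
  show "AE \<omega> in N. norm (Y r k \<omega>) \<le> norm (C0 * r0 ^ len k \<omega>)"
    using AE_Y_le[OF k] by eventually_elim (use g_nonneg in auto)
qed

text \<open>Markov's inequality for $R^{\mathrm{length}(\psi_{r+1})}$.\<close>

lemma prob_differs_le:
  assumes r: "1 \<le> r" "r < k"
  shows "N.prob {\<omega> \<in> space N. Y 0 k \<omega> \<noteq> Y r k \<omega>} \<le> K2 * (1 / R) ^ (k - r)"
proof -
  define c where "c = R ^ (k - r) / R\<^sup>2"
  have c: "0 < c" using R by (simp add: c_def)
  have "N.prob {\<omega> \<in> space N. Y 0 k \<omega> \<noteq> Y r k \<omega>} \<le> N.prob {\<omega> \<in> space N. c \<le> R ^ len (Suc r) \<omega>}"
  proof (rule N.finite_measure_mono_AE)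
    show "AE \<omega> in N. \<omega> \<in> {\<omega> \<in> space N. Y 0 k \<omega> \<noteq> Y r k \<omega>} \<longrightarrow> \<omega> \<in> {\<omega> \<in> space N. c \<le> R ^ len (Suc r) \<omega>}"
      using AE_N[OF g_local]
    proof eventually_elim
      case (elim \<omega>)
      show ?case
      proof
        assume w: "\<omega> \<in> {\<omega> \<in> space N. Y 0 k \<omega> \<noteq> Y r k \<omega>}"
        then have "Y r k \<omega> \<noteq> Y 0 k \<omega>" by auto
        then have "k \<le> len (Suc r) \<omega> + r + 2" by (rule elim[rule_format, OF r])
        then have "R ^ (k - r) \<le> R ^ (len (Suc r) \<omega> + 2)" using R by (intro power_increasing) auto
        then have "R ^ (k - r) \<le> R ^ len (Suc r) \<omega> * R\<^sup>2" by (simp only: power_add)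
        then have "c \<le> R ^ len (Suc r) \<omega>" using R by (simp add: c_def pos_divide_le_eq)
        then show "\<omega> \<in> {\<omega> \<in> space N. c \<le> R ^ len (Suc r) \<omega>}" using w by auto
      qed
    qed
    have "{\<omega> \<in> space M. c \<le> R ^ len (Suc r) \<omega>} \<in> sets M" by measurable
    then show "{\<omega> \<in> space N. c \<le> R ^ len (Suc r) \<omega>} \<in> N.events" by simp
  qed
  also have "\<dots> \<le> N.expectation (\<lambda>\<omega>. R ^ len (Suc r) \<omega>) / c"
    using R r by (intro integral_Markov_inequality_measure[where A = "{}"] len_moment c) auto
  also have "\<dots> \<le> K / prob T / c"
    using len_moment(2)[of "Suc r"] r c by (intro divide_right_mono) auto
  also have "\<dots> = K2 * (1 / R) ^ (k - r)" by (simp add: c_def K2_def power_divide)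
  finally show ?thesis .
qed

lemma expectation_Y:
  assumes "1 \<le> r" "r < k"
  shows "N.expectation (Y r k) = mean (alt_type t r) (k - r)"
proof -
  have "mean (alt_type t r) (k - r) = (\<integral>b. g b \<partial>distr N (count_space (lists W)) (path_seg r k))"
    by (simp add: mean_def distr_seg[OF assms])
  also have "\<dots> = N.expectation (Y r k)"
    by (rule integral_distr[OF seg_measurable_N]) simp
  finally show ?thesis by simp
qed

text \<open>The effect on the mean of replacing the past: below the level $l = R^{d/2}$ the probability of a
  difference is used, above it the moment of order $p$.\<close>

definition err :: "nat \<Rightarrow> real" where
  "err d = K2 * R powr (- (1 / 2) * real d) + K1 * R powr ((1 - p) / 2 * real d)"

lemma err_tendsto: "err \<longlonglongrightarrow> 0"
proof -
  have *: "(\<lambda>d. R powr (a * real d)) \<longlonglongrightarrow> 0" if "a < 0" for a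
  proof -
    have "R powr (a * real d) = (R powr a) ^ d" for d
      using R by (simp add: powr_powr[symmetric] powr_realpow)
    moreover have "R powr a < 1" using powr_less_mono[of a 0 R] that R by simp
    ultimately show ?thesis by (auto intro!: LIMSEQ_power_zero)
  qed
  have "(\<lambda>d. K2 * R powr (- (1 / 2) * real d) + K1 * R powr ((1 - p) / 2 * real d)) \<longlonglongrightarrow> K2 * 0 + K1 * 0"
    using p_props by (intro tendsto_add tendsto_mult tendsto_const *) auto
  then show ?thesis by (simp add: err_def[abs_def])
qed

lemma expectation_approx:
  assumes r: "1 \<le> r" "r < k"
  shows "\<bar>N.expectation (Y 0 k) - mean (alt_type t r) (k - r)\<bar> \<le> err (k - r)"
proof -
  have k: "2 \<le> k" and k0: "0 < k" using r by auto
  define l where "l = R powr (1 / 2 * real (k - r))"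
  have l: "0 < l" using R by (simp add: l_def)
  define D where "D = {\<omega> \<in> space M. Y 0 k \<omega> \<noteq> Y r k \<omega>}"
  have [measurable]: "D \<in> sets M" unfolding D_def by measurable
  have Dint: "integrable N (\<lambda>\<omega>. l * indicator D \<omega>)"
    by (intro integrable_mult_right N.integrable_const_bound[where B = 1]) (auto intro: borel_N)
  have int: "integrable N (Y 0 k)" "integrable N (Y r k)"
    using Y_integrable[OF k] r by auto
  have Rint: "integrable N (\<lambda>\<omega>. l powr (1 - p) * (C0 powr p * R ^ len k \<omega>))"
    using len_moment[OF k] by simp
  have "\<bar>N.expectation (Y 0 k) - N.expectation (Y r k)\<bar> = \<bar>N.expectation (\<lambda>\<omega>. Y 0 k \<omega> - Y r k \<omega>)\<bar>"
    using int by simp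
  also have "\<dots> \<le> N.expectation (\<lambda>\<omega>. \<bar>Y 0 k \<omega> - Y r k \<omega>\<bar>)" by (rule integral_abs_bound)
  also have "\<dots> \<le> N.expectation (\<lambda>\<omega>. l * indicator D \<omega> + l powr (1 - p) * (C0 powr p * R ^ len k \<omega>))"
  proof (rule integral_mono_AE)
    have "AE \<omega> in N. \<omega> \<in> space N" by (rule AE_space)
    then show "AE \<omega> in N. \<bar>Y 0 k \<omega> - Y r k \<omega>\<bar> \<le> l * indicator D \<omega> + l powr (1 - p) * (C0 powr p * R ^ len k \<omega>)"
      using AE_Y_le[OF k k0] AE_Y_le[OF k r(2)]
    proof eventually_elim
      case (elim \<omega>)
      define z where "z = C0 * r0 ^ len k \<omega>"
      have z: "0 < z" using C0 r0 by (simp add: z_def)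
      have nonneg: "0 \<le> l powr (1 - p) * (C0 powr p * R ^ len k \<omega>)" using R by simp
      show ?case
      proof (cases "\<omega> \<in> D")
        case False
        then have "Y 0 k \<omega> = Y r k \<omega>" using elim by (auto simp: D_def)
        then show ?thesis using False nonneg by simp
      next
        case True
        have "\<bar>Y 0 k \<omega> - Y r k \<omega>\<bar> \<le> z"
          using elim r g_nonneg[of "path_seg 0 k \<omega>"] g_nonneg[of "path_seg r k \<omega>"] unfolding z_def by linarith
        also have "z \<le> l + l powr (1 - p) * (C0 powr p * R ^ len k \<omega>)"
        proof (cases "z \<le> l")
          case True
          then show ?thesis using nonneg by linarith
        next
          case False
          have "z = z powr (1 - p) * z powr p" using z by (simp flip: powr_add)
          also have "\<dots> \<le> l powr (1 - p) * (C0 powr p * R ^ len k \<omega>)"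
            using False l p_props bound_powr_le[of "len k \<omega>"]
            by (intro mult_mono powr_mono2') (auto simp: z_def[symmetric])
          finally show ?thesis using l by linarith
        qed
        finally show ?thesis using True by simp
      qed
    qed
  qed (use int Dint Rint in auto)
  also have "\<dots> = l * N.prob D + l powr (1 - p) * (C0 powr p * N.expectation (\<lambda>\<omega>. R ^ len k \<omega>))"
    by (subst Bochner_Integration.integral_add[OF Dint Rint]) simp
  also have "\<dots> \<le> l * (K2 * (1 / R) ^ (k - r)) + l powr (1 - p) * (C0 powr p * (K / prob T))"
    using prob_differs_le[OF r] len_moment(2)[OF k] l
    by (intro add_mono mult_left_mono) (auto simp: D_def)
  also have "\<dots> = err (k - r)"
  proof -
    have "R powr (- real (k - r)) = inverse (R ^ (k - r))"
      using R by (simp add: powr_minus powr_realpow)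
    then have "(1 / R) ^ (k - r) = R powr (- real (k - r))"
      by (simp add: power_divide inverse_eq_divide)
    then have "l * (1 / R) ^ (k - r) = R powr (1 / 2 * real (k - r) + - real (k - r))"
      by (simp only: l_def powr_add)
    also have "1 / 2 * real (k - r) + - real (k - r) = - (1 / 2) * real (k - r)" by simp
    finally have 1: "l * (1 / R) ^ (k - r) = R powr (- (1 / 2) * real (k - r))" .
    have 2: "l powr (1 - p) = R powr ((1 - p) / 2 * real (k - r))"
      by (simp add: l_def powr_powr mult_ac)
    show ?thesis unfolding err_def K1_def 1[symmetric] 2[symmetric] by (simp add: mult_ac)
  qed
  finally show ?thesis by (simp add: expectation_Y[OF r])
qed

text \<open>Over two consecutive positions both types occur once as type of the start of the segment, so the sum of
  the two means is close to a quantity that does not involve the type of the first letter.\<close>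

lemma pair_sum_limit:
  "\<exists>l. (\<lambda>k. N.expectation (Y 0 k) + N.expectation (Y 0 (Suc k))) \<longlonglongrightarrow> l \<and>
      (\<lambda>d. mean 1 d + mean 2 d) \<longlonglongrightarrow> l"
proof (rule uniform_approximation_limit)
  show "(\<lambda>d. 2 * err d) \<longlonglongrightarrow> 0" using tendsto_mult_right_zero[OF err_tendsto] by simp
  fix d k :: nat assume d: "1 \<le> d" "d < k"
  define r where "r = k - d"
  have r: "1 \<le> r" "r < k" "k - r = d" "Suc k - Suc r = d" using d by (auto simp: r_def)
  have "mean (alt_type t r) d + mean (alt_type t (Suc r)) d = mean 1 d + mean 2 d"
    using t by (auto simp: alt_type_def simp flip: One_nat_def)
  then show "\<bar>N.expectation (Y 0 k) + N.expectation (Y 0 (Suc k)) - (mean 1 d + mean 2 d)\<bar> \<le> 2 * err d"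
    using expectation_approx[of r k] expectation_approx[of "Suc r" "Suc k"] r by auto
qed

lemma segment_averages_tendsto:
  assumes l: "(\<lambda>k. N.expectation (Y 0 k) + N.expectation (Y 0 (Suc k))) \<longlonglongrightarrow> l"
  shows "AE \<omega> in N. (\<lambda>n. (\<Sum>k<n. Y 0 (k + 2) \<omega>) / real n) \<longlonglongrightarrow> l / 2"
proof -
  define KK where "KK = max 1 (max K1 K2)"
  interpret mix: mixing_sequence N "\<lambda>k. Y 0 (k + 2)" "\<lambda>i k. Y (i + 2) (k + 2)" p KK "1 / R"
  proof
    show "Y 0 (k + 2) \<in> borel_measurable N" for k by (rule borel_N) measurable
    show "integrable N (\<lambda>\<omega>. Y 0 (k + 2) \<omega> powr p)" for k by (rule Y_powr_integrable) auto
    show "N.expectation (\<lambda>\<omega>. Y 0 (k + 2) \<omega> powr p) \<le> KK" for k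
      using Y_powr_integrable(2)[of "k + 2" 0] by (simp add: KK_def)
    show "N.indep_var borel (Y 0 (i + 2)) borel (Y (i + 2) (k + 2))" if "i < k" for i k
    proof -
      have "N.indep_var borel (g \<circ> path_seg 0 (i + 2)) borel (g \<circ> path_seg (i + 2) (k + 2))"
        by (rule N.indep_var_compose[OF indep_segments]) (use that in auto)
      then show ?thesis by (simp add: comp_def)
    qed
    show "N.prob {\<omega> \<in> space N. Y 0 (k + 2) \<omega> \<noteq> Y (i + 2) (k + 2) \<omega>} \<le> KK * (1 / R) ^ (k - i)" if "i < k" for i k
    proof -
      have "N.prob {\<omega> \<in> space N. Y 0 (k + 2) \<omega> \<noteq> Y (i + 2) (k + 2) \<omega>} \<le> K2 * (1 / R) ^ (k - i)"
        using prob_differs_le[of "i + 2" "k + 2"] that by simp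
      also have "\<dots> \<le> KK * (1 / R) ^ (k - i)" using R by (intro mult_right_mono) (auto simp: KK_def)
      finally show ?thesis .
    qed
  qed (use g_nonneg p_props R in \<open>auto simp: KK_def\<close>)
  have bound: "\<bar>N.expectation (Y 0 (k + 2))\<bar> \<le> 1 + KK" for k
  proof -
    have "N.expectation (Y 0 (k + 2)) \<le> N.expectation (\<lambda>\<omega>. 1 + Y 0 (k + 2) \<omega> powr p)"
    proof (rule integral_mono)
      fix \<omega>
      show "Y 0 (k + 2) \<omega> \<le> 1 + Y 0 (k + 2) \<omega> powr p"
      proof (cases "Y 0 (k + 2) \<omega> \<le> 1")
        case True
        then show ?thesis using powr_ge_zero[of "Y 0 (k + 2) \<omega>" p] by linarith
      next
        case False
        then have "Y 0 (k + 2) \<omega> powr 1 \<le> Y 0 (k + 2) \<omega> powr p" using p_props by (intro powr_mono) auto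
        then show ?thesis using False by simp
      qed
    qed (use mix.Y_integrable mix.moment_integrable in auto)
    also have "\<dots> \<le> 1 + KK" using mix.moment_integrable mix.moment_le[of k] N.prob_space by simp
    finally have "N.expectation (Y 0 (k + 2)) \<le> 1 + KK" .
    moreover have "0 \<le> N.expectation (Y 0 (k + 2))" using g_nonneg by simp
    ultimately show ?thesis by simp
  qed
  have "(\<lambda>k. N.expectation (Y 0 (k + 2)) + N.expectation (Y 0 (Suc k + 2))) \<longlonglongrightarrow> l"
    using LIMSEQ_ignore_initial_segment[OF l, of 2] by simp
  from averages_tendsto_of_pair_sums[of "\<lambda>k. N.expectation (Y 0 (k + 2))", OF bound this]
  show ?thesis by (rule mix.averages_tendsto)
qed

text \<open>Positivity of every single mean would allow the limit to be $0$.  But for a fixed length \<open>d\<close> the segments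
  have only two possible laws, so they exceed some \<open>\<eta> > 0\<close> with probability $3/4$ at all positions;
  if \<open>d\<close> is large, replacing the past destroys this with probability less than $1/2$.\<close>

lemma limit_pos:
  assumes pos: "\<And>r k. 1 \<le> r \<Longrightarrow> r < k \<Longrightarrow> AE \<omega> in M. 0 < Y r k \<omega>"
    and l: "(\<lambda>k. N.expectation (Y 0 k) + N.expectation (Y 0 (Suc k))) \<longlonglongrightarrow> l"
  shows "0 < l"
proof -
  have "(\<lambda>d. K2 * (1 / R) ^ d) \<longlonglongrightarrow> K2 * 0"
    using R by (intro tendsto_mult tendsto_const LIMSEQ_power_zero) auto
  then obtain d0 where d0: "\<And>d. d \<ge> d0 \<Longrightarrow> norm (K2 * (1 / R) ^ d - 0) < 1 / 2"
    using LIMSEQ_D[of "\<lambda>d. K2 * (1 / R) ^ d" 0 "1 / 2"] by auto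
  define d where "d = Suc d0"
  have d: "1 \<le> d" "K2 * (1 / R) ^ d < 1 / 2"
  proof -
    show "1 \<le> d" by (simp add: d_def)
    have "d0 \<le> d" by (simp add: d_def)
    from d0[OF this] show "K2 * (1 / R) ^ d < 1 / 2" unfolding real_norm_def by linarith
  qed
  have "\<exists>\<eta>>0. 3 / 4 \<le> N.prob {\<omega> \<in> space M. \<eta> \<le> Y r (r + d) \<omega>}" if r: "1 \<le> r" for r
  proof -
    let ?E = "\<lambda>n. {\<omega> \<in> space M. 1 / real (Suc n) \<le> Y r (r + d) \<omega>}"
    have E: "?E n \<in> sets N" for n by simp
    have mono: "incseq ?E"
    proof (rule incseq_SucI, rule subsetI)
      fix n \<omega> assume "\<omega> \<in> ?E n"
      moreover have "1 / real (Suc (Suc n)) \<le> 1 / real (Suc n)" by (simp add: frac_le)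
      ultimately show "\<omega> \<in> ?E (Suc n)" by auto
    qed
    have "(\<lambda>n. N.prob (?E n)) \<longlonglongrightarrow> N.prob (\<Union>n. ?E n)"
      by (rule N.finite_Lim_measure_incseq) (use E mono in auto)
    also have "N.prob (\<Union>n. ?E n) = 1"
    proof (rule N.prob_eq_1[THEN iffD2])
      show "(\<Union>n. ?E n) \<in> N.events" by (intro sets.countable_UN') (use E in auto)
      have "AE \<omega> in N. \<omega> \<in> space N" by (rule AE_space)
      moreover have "AE \<omega> in N. 0 < Y r (r + d) \<omega>" by (intro AE_N pos r) (use d in simp)
      ultimately show "AE \<omega> in N. \<omega> \<in> (\<Union>n. ?E n)"
      proof eventually_elim
        case (elim \<omega>)
        from elim(2) obtain n where "1 / real (Suc n) < Y r (r + d) \<omega>" using nat_approx_posE by blast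
        then show ?case using elim(1) by (auto intro!: exI[of _ n] simp del: of_nat_Suc)
      qed
    qed
    finally have "(\<lambda>n. N.prob (?E n)) \<longlonglongrightarrow> 1" .
    from LIMSEQ_D[OF this, of "1 / 4"] obtain n where "norm (N.prob (?E n) - 1) < 1 / 4"
      by auto
    then have "3 / 4 \<le> N.prob (?E n)" by (simp add: abs_less_iff)
    then show ?thesis by (intro exI[of _ "1 / real (Suc n)"]) simp
  qed
  from this[of 1] this[of 2] obtain \<eta>1 \<eta>2 where \<eta>12: "0 < \<eta>1" "0 < \<eta>2"
    "3 / 4 \<le> N.prob {\<omega> \<in> space M. \<eta>1 \<le> Y 1 (1 + d) \<omega>}" "3 / 4 \<le> N.prob {\<omega> \<in> space M. \<eta>2 \<le> Y 2 (2 + d) \<omega>}"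
    by auto
  define \<eta> where "\<eta> = min \<eta>1 \<eta>2"
  have \<eta>: "0 < \<eta>" using \<eta>12 by (simp add: \<eta>_def)
  have base: "3 / 4 \<le> N.prob {\<omega> \<in> space M. \<eta> \<le> Y r (r + d) \<omega>}" if "r = 1 \<or> r = 2" for r
  proof -
    have "N.prob {\<omega> \<in> space M. \<eta>1 \<le> Y r (r + d) \<omega>} \<le> N.prob {\<omega> \<in> space M. \<eta> \<le> Y r (r + d) \<omega>}"
      "N.prob {\<omega> \<in> space M. \<eta>2 \<le> Y r (r + d) \<omega>} \<le> N.prob {\<omega> \<in> space M. \<eta> \<le> Y r (r + d) \<omega>}"
      by (auto intro!: N.finite_measure_mono simp: \<eta>_def)
    then show ?thesis using \<eta>12 that by auto
  qed
  (* the law does not depend on the position, except for the type *)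
  have law: "N.prob {\<omega> \<in> space M. \<eta> \<le> Y r (r + d) \<omega>} = measure (seg_dist (alt_type t r) d) {b \<in> lists W. \<eta> \<le> g b}"
    if "1 \<le> r" for r
  proof -
    have "{\<omega> \<in> space M. \<eta> \<le> Y r (r + d) \<omega>} = {\<omega> \<in> space M. path_seg r (r + d) \<omega> \<in> {b \<in> lists W. \<eta> \<le> g b}}"
      using path_seg_in_lists by auto
    then show ?thesis
      using emeasure_N_seg[of r "r + d" "{b \<in> lists W. \<eta> \<le> g b}"] that d by (simp add: measure_def)
  qed
  have all: "3 / 4 \<le> N.prob {\<omega> \<in> space M. \<eta> \<le> Y r (r + d) \<omega>}" if r: "1 \<le> r" for r
  proof (cases "odd r")
    case True
    then show ?thesis using base[of 1] law[of 1] law[OF r] by (simp add: alt_type_def)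
  next
    case False
    then show ?thesis using base[of 2] law[of 2] law[OF r] by (simp add: alt_type_def)
  qed
  have lower: "\<eta> / 4 \<le> N.expectation (Y 0 k)" if k: "d < k" for k
  proof -
    define r where "r = k - d"
    have r: "1 \<le> r" "r < k" "r + d = k" "k - r = d" using k d by (auto simp: r_def)
    let ?A = "{\<omega> \<in> space M. \<eta> \<le> Y r k \<omega>}" and ?B = "{\<omega> \<in> space M. Y 0 k \<omega> \<noteq> Y r k \<omega>}"
      and ?C = "{\<omega> \<in> space M. \<eta> \<le> Y 0 k \<omega>}"
    have "N.prob ?A \<le> N.prob (?B \<union> ?C)" by (intro N.finite_measure_mono) auto
    also have "\<dots> \<le> N.prob ?B + N.prob ?C" by (intro measure_Un_le) auto
    finally have "1 / 4 \<le> N.prob ?C"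
      using all[OF r(1)] prob_differs_le[OF r(1,2)] d r by simp
    also have "N.prob ?C \<le> N.expectation (Y 0 k) / \<eta>"
      using integral_Markov_inequality_measure[of N "Y 0 k" "{}" \<eta>] Y_integrable[of k 0] r d g_nonneg \<eta> by simp
    finally show ?thesis using \<eta> by (simp add: field_simps)
  qed
  have "\<eta> / 2 \<le> l"
  proof (rule tendsto_lowerbound[OF l])
    show "\<forall>\<^sub>F k in sequentially. \<eta> / 2 \<le> N.expectation (Y 0 k) + N.expectation (Y 0 (Suc k))"
      using eventually_gt_at_top[of d]
    proof eventually_elim
      case (elim k)
      then show ?case using lower[of k] lower[of "Suc k"] by simp
    qed
  qed simp
  then show ?thesis using \<eta> by linarith
qed

end

context segment_functional
begin

theorem strong_law:
  "\<exists>c. (AE \<omega> in M. (\<lambda>n. (\<Sum>k<n. Y 0 (k + 2) \<omega>) / real n) \<longlonglongrightarrow> c) \<and>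
       ((\<forall>r\<ge>1. \<forall>k>r. AE \<omega> in M. 0 < Y r k \<omega>) \<longrightarrow> 0 < c)"
proof -
  define l where "l = lim (\<lambda>d. mean 1 d + mean 2 d)"
  have typed: "(AE \<omega> in M. ftype \<omega> = t \<longrightarrow> (\<lambda>n. (\<Sum>k<n. Y 0 (k + 2) \<omega>) / real n) \<longlonglongrightarrow> l / 2) \<and>
      ((\<forall>r\<ge>1. \<forall>k>r. AE \<omega> in M. 0 < Y r k \<omega>) \<longrightarrow> 0 < l)"
    if t: "t \<in> {1, 2}" "emeasure M {\<omega> \<in> space M. ftype \<omega> = t} \<noteq> 0" for t
  proof -
    interpret typed_functional F \<alpha> M X t R K g C0 r0
      by unfold_locales (use t in auto)
    obtain l' where l': "(\<lambda>k. N.expectation (Y 0 k) + N.expectation (Y 0 (Suc k))) \<longlonglongrightarrow> l'"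
        "(\<lambda>d. mean 1 d + mean 2 d) \<longlonglongrightarrow> l'"
      using pair_sum_limit by blast
    have "l = l'" unfolding l_def by (rule limI[OF l'(2)])
    then show ?thesis
      using segment_averages_tendsto[OF l'(1)] limit_pos[OF _ l'(1)] by (auto simp: AE_N_iff)
  qed
  have null: "AE \<omega> in M. ftype \<omega> \<noteq> t" if "emeasure M {\<omega> \<in> space M. ftype \<omega> = t} = 0" for t
    using that by (intro AE_I[OF subset_refl]) auto
  have "AE \<omega> in M. ftype \<omega> = t \<longrightarrow> (\<lambda>n. (\<Sum>k<n. Y 0 (k + 2) \<omega>) / real n) \<longlonglongrightarrow> l / 2" if "t \<in> {1, 2}" for t
    using typed[OF that] null[of t] by (cases "emeasure M {\<omega> \<in> space M. ftype \<omega> = t} = 0") auto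
  then have "AE \<omega> in M. ftype \<omega> = 1 \<longrightarrow> (\<lambda>n. (\<Sum>k<n. Y 0 (k + 2) \<omega>) / real n) \<longlonglongrightarrow> l / 2"
    "AE \<omega> in M. ftype \<omega> = 2 \<longrightarrow> (\<lambda>n. (\<Sum>k<n. Y 0 (k + 2) \<omega>) / real n) \<longlonglongrightarrow> l / 2"
    by auto
  then have conv: "AE \<omega> in M. (\<lambda>n. (\<Sum>k<n. Y 0 (k + 2) \<omega>) / real n) \<longlonglongrightarrow> l / 2"
  proof eventually_elim
    case (elim \<omega>)
    then show ?case using ftype_mem[of \<omega>] by auto
  qed
  have "\<exists>t\<in>{1, 2}. emeasure M {\<omega> \<in> space M. ftype \<omega> = t} \<noteq> 0"
  proof (rule ccontr)
    assume "\<not> ?thesis"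
    then have "AE \<omega> in M. ftype \<omega> \<noteq> 1" "AE \<omega> in M. ftype \<omega> \<noteq> 2" using null by auto
    then have "AE \<omega> in M. False"
      by eventually_elim (use ftype_mem in auto)
    then show False by simp
  qed
  then obtain t where "t \<in> {1, 2}" "emeasure M {\<omega> \<in> space M. ftype \<omega> = t} \<noteq> 0" by blast
  from typed[OF this] conv show ?thesis by (intro exI[of _ "l / 2"]) auto
qed

end

section \<open>Final cone entry times grow linearly\<close>

context moment_chain
begin

lemma AE_block_functional_bound:
  assumes "1 < r0"
  shows "AE \<omega> in M. \<forall>k\<ge>2. \<forall>r<k. real (last_block_length (path_seg r k \<omega>)) \<le> (1 / (r0 - 1)) * r0 ^ len k \<omega>"
  using AE_transient_walk
proof eventually_elim
  case (elim \<omega>)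
  interpret transient_walk F \<alpha> X \<omega> by fact
  show ?case
  proof (intro allI impI)
    fix k r :: nat assume k: "2 \<le> k" "r < k"
    have "last_block_length (path_seg r k \<omega>) \<le> len k \<omega>"
      using last_block_length_seg[OF k(2)] block_length_le[of k] k by (simp add: len_def)
    moreover have "real (len k \<omega>) \<le> (1 / (r0 - 1)) * r0 ^ len k \<omega>"
    proof -
      have "1 + real (len k \<omega>) * (r0 - 1) \<le> (1 + (r0 - 1)) ^ len k \<omega>"
        using assms by (intro Bernoulli_inequality) auto
      then have "real (len k \<omega>) * (r0 - 1) \<le> r0 ^ len k \<omega>" by simp
      then show ?thesis using assms by (simp add: pos_le_divide_eq)
    qed
    ultimately show "real (last_block_length (path_seg r k \<omega>)) \<le> (1 / (r0 - 1)) * r0 ^ len k \<omega>"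
      by linarith
  qed
qed

text \<open>The increments of the final cone entry times are block lengths.  They do not depend on the start of the
  segment, and they are bounded by the length of $\psi_k$, hence by a multiple of every exponential of it.\<close>

lemma final_entries_linear:
  "\<exists>\<mu>>0. AE \<omega> in M. (\<lambda>n. real (final_entry (\<lambda>i. X i \<omega>) (Suc n)) / real n) \<longlonglongrightarrow> \<mu>"
proof -
  (* any base strictly between 1 and R dominates the lengths *)
  define r0 where "r0 = (1 + R) / 2"
  have r0: "1 < r0" "r0 < R" using R by (auto simp: r0_def)
  interpret bl: segment_functional F \<alpha> M X R K "\<lambda>b. real (last_block_length b)" "1 / (r0 - 1)" r0
  proof
    show "AE \<omega> in M. \<forall>k\<ge>2. \<forall>r<k. real (last_block_length (path_seg r k \<omega>)) \<le> 1 / (r0 - 1) * r0 ^ len k \<omega>"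
      by (rule AE_block_functional_bound[OF r0(1)])
    show "AE \<omega> in M. \<forall>r\<ge>1. \<forall>k>r. real (last_block_length (path_seg r k \<omega>)) \<noteq> real (last_block_length (path_seg 0 k \<omega>)) \<longrightarrow>
       k \<le> len (Suc r) \<omega> + r + 2"
      using AE_transient_walk
    proof eventually_elim
      case (elim \<omega>)
      interpret transient_walk F \<alpha> X \<omega> by fact
      have same: "last_block_length (path_seg r k \<omega>) = last_block_length (path_seg 0 k \<omega>)" if "r < k" for r k
        using last_block_length_seg[OF that] last_block_length_seg[of 0 k] that by simp
      show ?case
      proof (intro allI impI)
        fix r k :: nat
        assume lt: "r < k" and "real (last_block_length (path_seg r k \<omega>)) \<noteq> real (last_block_length (path_seg 0 k \<omega>))"
        then show "k \<le> len (Suc r) \<omega> + r + 2" using same[OF lt] by simp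
      qed
    qed
  qed (use r0 in auto)
  obtain c where c: "AE \<omega> in M. (\<lambda>n. (\<Sum>k<n. real (last_block_length (path_seg 0 (k + 2) \<omega>))) / real n) \<longlonglongrightarrow> c"
    and pos: "(\<forall>r\<ge>1. \<forall>k>r. AE \<omega> in M. 0 < real (last_block_length (path_seg r k \<omega>))) \<longrightarrow> 0 < c"
    using bl.strong_law by (elim exE conjE) (rule that)
  have "0 < c"
  proof (rule pos[rule_format])
    fix r k :: nat assume r: "1 \<le> r" "r < k"
    show "AE \<omega> in M. 0 < real (last_block_length (path_seg r k \<omega>))"
      using AE_transient_walk
    proof eventually_elim
      case (elim \<omega>)
      interpret transient_walk F \<alpha> X \<omega> by fact
      have "e (k - 1) < e k" by (rule final_entry_strict_mono) (use r in simp)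
      then show ?case using last_block_length_seg[OF r(2)] by simp
    qed
  qed
  moreover have "AE \<omega> in M. (\<lambda>n. real (final_entry (\<lambda>i. X i \<omega>) (Suc n)) / real n) \<longlonglongrightarrow> c"
    using c AE_transient_walk
  proof eventually_elim
    case (elim \<omega>)
    interpret transient_walk F \<alpha> X \<omega> by fact
    have "(\<Sum>k<n. real (last_block_length (path_seg 0 (k + 2) \<omega>))) = real (e (Suc n)) - real (e 1)" for n
    proof (induction n)
      case (Suc n)
      have "last_block_length (path_seg 0 (n + 2) \<omega>) = e (Suc (Suc n)) - e (Suc n)"
        using last_block_length_seg[of 0 "n + 2"] by (simp add: numeral_2_eq_2)
      moreover have "e (Suc n) \<le> e (Suc (Suc n))" by (rule final_entry_mono) simp
      ultimately have "real (last_block_length (path_seg 0 (n + 2) \<omega>)) = real (e (Suc (Suc n))) - real (e (Suc n))"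
        by (simp only: of_nat_diff)
      then show ?case using Suc by (simp only: sum.lessThan_Suc)
    next
      case 0
      have "real (e (Suc 0)) - real (e 1) = 0" by (simp only: One_nat_def diff_self)
      then show ?case by simp
    qed
    then have "(\<lambda>n. (real (e (Suc n)) - real (e 1)) / real n) \<longlonglongrightarrow> c" using elim(1) by (simp only:)
    from tendsto_add[OF this lim_const_over_n[of "real (e 1)"]]
    show ?case by (simp add: diff_divide_distrib)
  qed
  ultimately show ?thesis by blast
qed

section \<open>Excursion lengths are negligible\<close>

text \<open>The quantity has a bounded moment of order $p = \ln R / \ln r_0 > 1$, so the probabilities of exceeding
  a multiple of \<open>k\<close> are summable.\<close>

lemma AE_power_len_negligible:
  assumes r0: "1 < r0" "r0 < R"
  shows "AE \<omega> in M. (\<lambda>k. r0 ^ len k \<omega> / real k) \<longlonglongrightarrow> 0"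
proof -
  define p where "p = ln R / ln r0"
  have p: "1 < p" using r0 by (simp add: p_def less_divide_eq)
  have r0p: "r0 powr p = R" using r0 R by (simp add: powr_def p_def)
  define E where "E i k = {\<omega> \<in> space M. real k / real (Suc i) \<le> r0 ^ len k \<omega>}" for i k
  have E_sets [measurable]: "E i k \<in> sets M" for i k unfolding E_def by measurable
  have int: "integrable M (\<lambda>\<omega>. R ^ len k \<omega>)" "expectation (\<lambda>\<omega>. R ^ len k \<omega>) \<le> K" if "2 \<le> k" for k
  proof -
    have "(\<integral>\<^sup>+ \<omega>. ennreal (R ^ len k \<omega>) \<partial>M) \<le> ennreal K"
      unfolding len_def by (rule moment[OF that])
    note integrable_of_nn_integral_bound[OF len_power_measurable _ this]
    then show "integrable M (\<lambda>\<omega>. R ^ len k \<omega>)" "expectation (\<lambda>\<omega>. R ^ len k \<omega>) \<le> K"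
      using R K by auto
  qed
  have bound: "prob (E i k) \<le> K * real (Suc i) powr p * real k powr (- p)" if k: "2 \<le> k" for i k
  proof -
    define c where "c = (real k / real (Suc i)) powr p"
    have c: "0 < c" using k by (simp add: c_def)
    have "prob (E i k) \<le> prob {\<omega> \<in> space M. c \<le> R ^ len k \<omega>}"
    proof (rule finite_measure_mono)
      show "E i k \<subseteq> {\<omega> \<in> space M. c \<le> R ^ len k \<omega>}"
      proof
        fix \<omega> assume w: "\<omega> \<in> E i k"
        then have "c \<le> (r0 ^ len k \<omega>) powr p"
          unfolding c_def E_def using p by (intro powr_mono2) auto
        also have "\<dots> = (r0 powr p) ^ len k \<omega>"
          using r0 by (simp add: powr_powr powr_power mult.commute flip: powr_realpow)
        finally show "\<omega> \<in> {\<omega> \<in> space M. c \<le> R ^ len k \<omega>}" using w r0p by (simp add: E_def)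
      qed
    qed measurable
    also have "\<dots> \<le> expectation (\<lambda>\<omega>. R ^ len k \<omega>) / c"
      using R by (intro integral_Markov_inequality_measure[where A = "{}"] int k c) auto
    also have "\<dots> \<le> K / c" using int(2)[OF k] c by (intro divide_right_mono) auto
    also have "\<dots> = K * real (Suc i) powr p * real k powr (- p)"
      unfolding c_def by (simp add: powr_divide powr_minus divide_simps del: of_nat_Suc)
    finally show ?thesis .
  qed
  have "AE \<omega> in M. \<forall>\<^sub>F k in sequentially. \<omega> \<in> space M - E i k" for i
  proof (rule borel_cantelli_AE1)
    show "summable (\<lambda>k. prob (E i k))"
    proof (rule summable_comparison_test_ev)
      show "\<forall>\<^sub>F k in sequentially. norm (prob (E i k)) \<le> K * real (Suc i) powr p * real k powr (- p)"
        using eventually_ge_at_top[of 2]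
      proof eventually_elim
        case (elim k)
        show ?case using bound[OF elim, of i] by simp
      qed
      show "summable (\<lambda>k. K * real (Suc i) powr p * real k powr (- p))"
        using p by (intro summable_mult) (simp add: summable_real_powr_iff)
    qed
  qed (auto simp: less_top[symmetric])
  then have "AE \<omega> in M. \<forall>i. \<forall>\<^sub>F k in sequentially. \<omega> \<in> space M - E i k"
    unfolding AE_all_countable by blast
  then show ?thesis
  proof eventually_elim
    case (elim \<omega>)
    show ?case
    proof (rule LIMSEQ_I)
      fix \<epsilon> :: real assume "0 < \<epsilon>"
      then obtain i where i: "1 / real (Suc i) < \<epsilon>" using nat_approx_posE by blast
      obtain k0 where k0: "\<And>k. k \<ge> k0 \<Longrightarrow> \<omega> \<in> space M - E i k"
        using elim unfolding eventually_sequentially by blast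
      have "norm (r0 ^ len k \<omega> / real k - 0) < \<epsilon>" if "k \<ge> Suc k0" for k
      proof -
        have "r0 ^ len k \<omega> < real k / real (Suc i)" using k0[of k] that by (auto simp: E_def)
        then have "r0 ^ len k \<omega> / real k < 1 / real (Suc i)"
          using that by (simp add: field_simps del: of_nat_Suc)
        then show ?thesis using i r0 by simp
      qed
      then show "\<exists>no. \<forall>k\<ge>no. norm (r0 ^ len k \<omega> / real k - 0) < \<epsilon>" by blast
    qed
  qed
qed

end

section \<open>Cone-additive functions\<close>

locale cone_additive_walk = moment_chain F \<alpha> M X R K
  for F :: "'a free_factors" and \<alpha> :: real and M :: "'w measure" and X :: "nat \<Rightarrow> 'w \<Rightarrow> 'a list"
    and R K :: real +
  fixes f :: "'a list list \<Rightarrow> real" and C r0 :: real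
  assumes additive: "cone_additive F M X f"
    and C: "0 < C" and r0: "1 < r0" "r0 < R"
    and f_bound: "\<And>\<pi>. \<pi> \<in> paths F \<alpha> \<Longrightarrow> \<bar>f \<pi>\<bar> \<le> C * r0 ^ path_length \<pi>"
begin

text \<open>The strong law needs nonnegative summands; \<open>h\<close> will be the positive or the negative part.\<close>

lemma piece_averages:
  fixes h :: "real \<Rightarrow> real"
  assumes h: "\<And>y. 0 \<le> h y" "\<And>y. h y \<le> \<bar>y\<bar>"
  shows "\<exists>c. (AE \<omega> in M. (\<lambda>n. (\<Sum>k<n. h (f (trim (cone_path (path_seg 0 (k + 2) \<omega>))))) / real n) \<longlonglongrightarrow> c) \<and>
     ((\<forall>\<pi>\<in>paths F \<alpha>. 0 < h (f \<pi>)) \<longrightarrow> 0 < c)"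
proof -
  interpret sf: segment_functional F \<alpha> M X R K "\<lambda>b. h (f (trim (cone_path b)))" C r0
  proof
    show "AE \<omega> in M. \<forall>k\<ge>2. \<forall>r<k. h (f (trim (cone_path (path_seg r k \<omega>)))) \<le> C * r0 ^ len k \<omega>"
      using AE_transient_walk
    proof eventually_elim
      case (elim \<omega>)
      interpret transient_walk F \<alpha> X \<omega> by fact
      show ?case
      proof (intro allI impI)
        fix k r :: nat assume k: "2 \<le> k" "r < k"
        let ?p = "trim (cone_path (path_seg r k \<omega>))"
        have "path_length ?p \<le> len k \<omega>"
          using path_length_trim_le[of "cone_path (path_seg r k \<omega>)"] path_length_cone_path_seg_le[OF k(2)]
          by (simp add: len_def)
        then have "r0 ^ path_length ?p \<le> r0 ^ len k \<omega>" using r0 by (intro power_increasing) auto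
        then have "C * r0 ^ path_length ?p \<le> C * r0 ^ len k \<omega>" using C by simp
        moreover have "h (f ?p) \<le> \<bar>f ?p\<bar>" by (rule h)
        moreover have "\<bar>f ?p\<bar> \<le> C * r0 ^ path_length ?p"
          by (rule f_bound[OF trim_in_paths[OF k(2,1)]])
        ultimately show "h (f ?p) \<le> C * r0 ^ len k \<omega>" by linarith
      qed
    qed
    show "AE \<omega> in M. \<forall>r\<ge>1. \<forall>k>r. h (f (trim (cone_path (path_seg r k \<omega>)))) \<noteq> h (f (trim (cone_path (path_seg 0 k \<omega>)))) \<longrightarrow>
       k \<le> len (Suc r) \<omega> + r + 2"
      using AE_transient_walk
    proof eventually_elim
      case (elim \<omega>)
      interpret transient_walk F \<alpha> X \<omega> by fact
      show ?case
      proof (intro allI impI)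
        fix r k :: nat
        assume r: "1 \<le> r" "r < k"
          and ne: "h (f (trim (cone_path (path_seg r k \<omega>)))) \<noteq> h (f (trim (cone_path (path_seg 0 k \<omega>))))"
        then have "cone_path (path_seg r k \<omega>) \<noteq> cone_path (path_seg 0 k \<omega>)" by auto
        then show "k \<le> len (Suc r) \<omega> + r + 2"
          using cone_path_seg_differs[OF r(2)] by (simp add: len_def)
      qed
    qed
  qed (use h C r0 in auto)
  obtain c where c: "AE \<omega> in M. (\<lambda>n. (\<Sum>k<n. h (f (trim (cone_path (path_seg 0 (k + 2) \<omega>))))) / real n) \<longlonglongrightarrow> c"
    and pos: "(\<forall>r\<ge>1. \<forall>k>r. AE \<omega> in M. 0 < h (f (trim (cone_path (path_seg r k \<omega>))))) \<longrightarrow> 0 < c"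
    using sf.strong_law by (elim exE conjE) (rule that)
  have "0 < c" if fpos: "\<forall>\<pi>\<in>paths F \<alpha>. 0 < h (f \<pi>)"
  proof (rule pos[rule_format])
    fix r k :: nat assume r: "1 \<le> r" "r < k"
    show "AE \<omega> in M. 0 < h (f (trim (cone_path (path_seg r k \<omega>))))"
      using AE_transient_walk
    proof eventually_elim
      case (elim \<omega>)
      interpret transient_walk F \<alpha> X \<omega> by fact
      have "trim (cone_path (path_seg r k \<omega>)) \<in> paths F \<alpha>" using r by (intro trim_in_paths) auto
      then show ?case using fpos by blast
    qed
  qed
  then show ?thesis using c by blast
qed

lemma signed_piece_averages:
  "\<exists>c. (AE \<omega> in M. (\<lambda>n. (\<Sum>k<n. f (trim (cone_path (path_seg 0 (k + 2) \<omega>)))) / real n) \<longlonglongrightarrow> c) \<and>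
     ((\<forall>\<pi>\<in>paths F \<alpha>. 0 < f \<pi>) \<longrightarrow> 0 < c)"
proof -
  let ?p = "\<lambda>k \<omega>. trim (cone_path (path_seg 0 (k + 2) \<omega>))"
  have max_abs: "max 0 y \<le> \<bar>y\<bar>" "max 0 (- y) \<le> \<bar>y\<bar>" for y :: real
    by (auto simp: max_def)
  obtain c1 where c1: "AE \<omega> in M. (\<lambda>n. (\<Sum>k<n. max 0 (f (?p k \<omega>))) / real n) \<longlonglongrightarrow> c1"
    "(\<forall>\<pi>\<in>paths F \<alpha>. 0 < max 0 (f \<pi>)) \<longrightarrow> 0 < c1"
    using piece_averages[of "\<lambda>y. max 0 y", OF max.cobounded1 max_abs(1)]
    by (elim exE conjE) (rule that)
  obtain c2 where c2: "AE \<omega> in M. (\<lambda>n. (\<Sum>k<n. max 0 (- f (?p k \<omega>))) / real n) \<longlonglongrightarrow> c2"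
    using piece_averages[of "\<lambda>y. max 0 (- y)", OF max.cobounded1 max_abs(2)]
    by (elim exE conjE) (rule that)
  have conv: "AE \<omega> in M. (\<lambda>n. (\<Sum>k<n. f (?p k \<omega>)) / real n) \<longlonglongrightarrow> c1 - c2"
    using c1(1) c2
  proof eventually_elim
    case (elim \<omega>)
    have "(\<Sum>k<n. f (?p k \<omega>)) = (\<Sum>k<n. max 0 (f (?p k \<omega>))) - (\<Sum>k<n. max 0 (- f (?p k \<omega>)))" for n
      unfolding sum_subtractf[symmetric] by (intro sum.cong) auto
    then show ?case using tendsto_diff[OF elim] by (simp add: diff_divide_distrib)
  qed
  have "0 < c1 - c2" if pos: "\<forall>\<pi>\<in>paths F \<alpha>. 0 < f \<pi>"
  proof -
    have "0 < c1" using c1(2) pos by auto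
    moreover have "c2 = 0"
    proof -
      have "AE \<omega> in M. c2 = 0"
        using c2 AE_transient_walk
      proof eventually_elim
        case (elim \<omega>)
        interpret transient_walk F \<alpha> X \<omega> by fact
        have "0 < f (?p k \<omega>)" for k
          using pos trim_in_paths[of 0 "k + 2"] by auto
        then have "max 0 (- f (?p k \<omega>)) = 0" for k
          by (simp add: less_imp_le max.absorb1)
        then have "(\<lambda>_. 0) \<longlonglongrightarrow> c2" using elim(1) by simp
        then show ?case using LIMSEQ_unique[OF _ tendsto_const[of 0]] by (simp add: LIMSEQ_const_iff)
      qed
      then show ?thesis by simp
    qed
    ultimately show ?thesis by simp
  qed
  then show ?thesis using conv by blast
qed

text \<open>With $m + 1$ final cone entries up to time $n$, the first piece and the unfinished last one are
  negligible.  The other $m$ pieces have sum about $c m$, and $n/m$ tends to the linear growth rate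
  $\mu$ of the entry times, so the limit is $c/\mu$.\<close>

theorem rate_of_escape:
  "\<exists>c. (AE \<omega> in M. (\<lambda>n. f (traj X n \<omega>) / real n) \<longlonglongrightarrow> c) \<and>
     ((\<forall>\<pi>\<in>paths F \<alpha>. 0 < f \<pi>) \<longrightarrow> 0 < c)"
proof -
  obtain c where c: "AE \<omega> in M. (\<lambda>n. (\<Sum>k<n. f (trim (cone_path (path_seg 0 (k + 2) \<omega>)))) / real n) \<longlonglongrightarrow> c"
    and cpos: "(\<forall>\<pi>\<in>paths F \<alpha>. 0 < f \<pi>) \<Longrightarrow> 0 < c"
    using signed_piece_averages by blast
  obtain \<mu> where \<mu>: "0 < \<mu>"
    and lin: "AE \<omega> in M. (\<lambda>n. real (final_entry (\<lambda>i. X i \<omega>) (Suc n)) / real n) \<longlonglongrightarrow> \<mu>"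
    using final_entries_linear by blast
  have add: "AE \<omega> in M. \<forall>n\<ge>1. f (traj X n \<omega>) =
        (\<Sum>j = 1..last_exit F X n \<omega>. f (path_piece F X j \<omega>)) + f (path_rest F X n \<omega>)"
    and shift: "AE \<omega> in M. \<forall>j\<ge>1. f (path_piece F X j \<omega>) =
        f (unprefix_path (exit_pt F X (j - 1) \<omega>) (path_piece F X j \<omega>))"
  proof -
    have "AE \<omega> in M. 1 \<le> n \<longrightarrow> f (traj X n \<omega>) =
        (\<Sum>j = 1..last_exit F X n \<omega>. f (path_piece F X j \<omega>)) + f (path_rest F X n \<omega>)" for n
      using additive unfolding cone_additive_def by (cases "1 \<le> n") simp_all
    then show "AE \<omega> in M. \<forall>n\<ge>1. f (traj X n \<omega>) =
        (\<Sum>j = 1..last_exit F X n \<omega>. f (path_piece F X j \<omega>)) + f (path_rest F X n \<omega>)"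
      by (intro AE_all_countable[THEN iffD2] allI)
    have "AE \<omega> in M. 1 \<le> j \<longrightarrow> f (path_piece F X j \<omega>) =
        f (unprefix_path (exit_pt F X (j - 1) \<omega>) (path_piece F X j \<omega>))" for j
      using additive unfolding cone_additive_def by (cases "1 \<le> j") simp_all
    then show "AE \<omega> in M. \<forall>j\<ge>1. f (path_piece F X j \<omega>) =
        f (unprefix_path (exit_pt F X (j - 1) \<omega>) (path_piece F X j \<omega>))"
      by (intro AE_all_countable[THEN iffD2] allI)
  qed
  have "AE \<omega> in M. (\<lambda>n. f (traj X n \<omega>) / real n) \<longlonglongrightarrow> c / \<mu>"
    using c lin add shift AE_power_len_negligible[OF r0] AE_transient_walk
  proof (eventually_elim, goal_cases)
    case (1 \<omega>)
    interpret transient_walk F \<alpha> X \<omega> by fact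
    define \<kappa> where "\<kappa> n = last_exit F X n \<omega>" for n
    note \<kappa> = last_exit_props[folded \<kappa>_def]
    (* the first piece is left out, since the averages start with the second one *)
    define m where "m n = \<kappa> n - 1" for n
    define S where "S n = (\<Sum>k<n. f (trim (cone_path (path_seg 0 (k + 2) \<omega>))))" for n
    have \<kappa>_ge: "j \<le> \<kappa> n" if "e j \<le> n" for j n
    proof (rule ccontr)
      assume "\<not> j \<le> \<kappa> n"
      then have "e (Suc (\<kappa> n)) \<le> e j" by (intro final_entry_mono) simp
      then show False using \<kappa>(2)[of n] that by simp
    qed
    have m_lim: "filterlim m at_top sequentially"
      unfolding filterlim_at_top eventually_sequentially
    proof
      fix Z
      show "\<exists>N. \<forall>n\<ge>N. Z \<le> m n"
      proof (intro exI allI impI)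
        fix n assume "e (Suc Z) \<le> n"
        from \<kappa>_ge[OF this] show "Z \<le> m n" unfolding m_def by linarith
      qed
    qed
    have large: "\<forall>\<^sub>F n in sequentially. 1 \<le> m n \<and> 1 \<le> n"
      using filterlim_at_top[THEN iffD1, OF m_lim, rule_format, of 1] eventually_ge_at_top[of 1]
      by eventually_elim simp
    have shift_ratio: "(\<lambda>k. real (k + 2) / real k) \<longlonglongrightarrow> 1"
    proof -
      have "(\<lambda>k. 1 + 2 / real k) \<longlonglongrightarrow> 1 + 0"
        by (intro tendsto_add tendsto_const lim_const_over_n)
      then have "(\<lambda>k. 1 + 2 / real k) \<longlonglongrightarrow> 1" by simp
      moreover have "\<forall>\<^sub>F k in sequentially. 1 + 2 / real k = real (k + 2) / real k"
        using eventually_ge_at_top[of 1] by eventually_elim (simp add: field_simps)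
      ultimately show ?thesis by (rule Lim_transform_eventually)
    qed
    have e_shift: "(\<lambda>k. real (e (k + 2)) / real k) \<longlonglongrightarrow> \<mu>"
    proof -
      have "(\<lambda>k. real (e (Suc (Suc k))) / real (Suc k)) \<longlonglongrightarrow> \<mu>" using 1(2) by (rule LIMSEQ_Suc)
      moreover have "(\<lambda>k. real (Suc k) / real k) \<longlonglongrightarrow> 1" by (rule LIMSEQ_Suc_n_over_n)
      ultimately have "(\<lambda>k. real (e (Suc (Suc k))) / real (Suc k) * (real (Suc k) / real k)) \<longlonglongrightarrow> \<mu> * 1"
        by (rule tendsto_mult)
      then show ?thesis by (simp del: of_nat_Suc add: numeral_2_eq_2)
    qed
    have n_over_m: "(\<lambda>n. real n / real (m n)) \<longlonglongrightarrow> \<mu>"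
    proof (rule tendsto_sandwich)
      show "(\<lambda>n. real (e (Suc (m n))) / real (m n)) \<longlonglongrightarrow> \<mu>" by (rule filterlim_compose[OF 1(2) m_lim])
      show "(\<lambda>n. real (e (m n + 2)) / real (m n)) \<longlonglongrightarrow> \<mu>" by (rule filterlim_compose[OF e_shift m_lim])
      show "\<forall>\<^sub>F n in sequentially. real (e (Suc (m n))) / real (m n) \<le> real n / real (m n)"
        using large
      proof eventually_elim
        case (elim n)
        then have "Suc (m n) = \<kappa> n" unfolding m_def by linarith
        then show ?case using \<kappa>(1)[of n] by (intro divide_right_mono) auto
      qed
      show "\<forall>\<^sub>F n in sequentially. real n / real (m n) \<le> real (e (m n + 2)) / real (m n)"
        using large
      proof eventually_elim
        case (elim n)
        then have "m n + 2 = Suc (\<kappa> n)" unfolding m_def by linarith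
        then show ?case using \<kappa>(2)[of n] by (intro divide_right_mono) auto
      qed
    qed
    have m_over_n: "(\<lambda>n. real (m n) / real n) \<longlonglongrightarrow> 1 / \<mu>"
    proof -
      have "(\<lambda>n. 1 / (real n / real (m n))) \<longlonglongrightarrow> 1 / \<mu>"
        using \<mu> by (intro tendsto_divide tendsto_const n_over_m) simp
      then show ?thesis by simp
    qed
    have main: "(\<lambda>n. S (m n) / real n) \<longlonglongrightarrow> c / \<mu>"
    proof -
      have "(\<lambda>k. S k / real k) \<longlonglongrightarrow> c" using 1(1) by (simp add: S_def)
      from tendsto_mult[OF filterlim_compose[OF this m_lim] m_over_n]
      have "(\<lambda>n. S (m n) / real (m n) * (real (m n) / real n)) \<longlonglongrightarrow> c / \<mu>" by simp
      moreover have "\<forall>\<^sub>F n in sequentially. S (m n) / real (m n) * (real (m n) / real n) = S (m n) / real n"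
        using large by eventually_elim simp
      ultimately show ?thesis by (rule Lim_transform_eventually)
    qed
    have rest: "(\<lambda>n. f (path_rest F X n \<omega>) / real n) \<longlonglongrightarrow> 0"
    proof (rule Lim_null_comparison)
      have m2_lim: "filterlim (\<lambda>n. m n + 2) at_top sequentially"
        by (rule filterlim_at_top_mono[OF m_lim]) simp
      have "(\<lambda>n. C * (r0 ^ len (m n + 2) \<omega> / real (m n + 2)) * (real (m n + 2) / real (m n)) * (real (m n) / real n))
          \<longlonglongrightarrow> C * 0 * 1 * (1 / \<mu>)"
        by (intro tendsto_mult tendsto_const m_over_n filterlim_compose[OF shift_ratio m_lim]
            filterlim_compose[OF 1(5) m2_lim])
      then show "(\<lambda>n. C * (r0 ^ len (m n + 2) \<omega> / real (m n + 2)) * (real (m n + 2) / real (m n)) * (real (m n) / real n))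
          \<longlonglongrightarrow> 0" by simp
      show "\<forall>\<^sub>F n in sequentially. norm (f (path_rest F X n \<omega>) / real n) \<le>
          C * (r0 ^ len (m n + 2) \<omega> / real (m n + 2)) * (real (m n + 2) / real (m n)) * (real (m n) / real n)"
        using large
      proof eventually_elim
        case (elim n)
        have mk: "m n + 2 = Suc (\<kappa> n)" using elim unfolding m_def by linarith
        have "\<bar>f (path_rest F X n \<omega>)\<bar> \<le> C * r0 ^ path_length (path_rest F X n \<omega>)"
          by (rule f_bound[OF path_rest_in_paths])
        also have "\<dots> \<le> C * r0 ^ len (m n + 2) \<omega>"
          using path_length_path_rest_le[of n] C r0
          unfolding mk len_def \<kappa>_def by (intro mult_left_mono power_increasing) auto
        finally have "norm (f (path_rest F X n \<omega>) / real n) \<le> C * r0 ^ len (m n + 2) \<omega> / real n"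
          by (simp only: real_norm_def abs_divide abs_of_nat) (rule divide_right_mono, simp_all)
        also have "C * r0 ^ len (m n + 2) \<omega> / real n =
          C * (r0 ^ len (m n + 2) \<omega> / real (m n + 2)) * (real (m n + 2) / real (m n)) * (real (m n) / real n)"
          using elim by simp
        finally show ?case .
      qed
    qed
    have "\<forall>\<^sub>F n in sequentially. f (path_piece F X 1 \<omega>) / real n + S (m n) / real n + f (path_rest F X n \<omega>) / real n
        = f (traj X n \<omega>) / real n"
      using large
    proof eventually_elim
      case (elim n)
      have kn: "\<kappa> n = Suc (m n)" using elim unfolding m_def by linarith
      have piece: "f (path_piece F X (k + 2) \<omega>) = f (trim (cone_path (path_seg 0 (k + 2) \<omega>)))" for k
        using 1(4)[rule_format, of "k + 2"] path_piece_eq[of "k + 2"] by simp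
      have "(\<Sum>j = 1..\<kappa> n. f (path_piece F X j \<omega>)) =
          f (path_piece F X 1 \<omega>) + (\<Sum>j = 2..Suc (m n). f (path_piece F X j \<omega>))"
        unfolding kn by (subst sum.atLeast_Suc_atMost) (auto simp: numeral_2_eq_2)
      also have "(\<Sum>j = 2..Suc (m n). f (path_piece F X j \<omega>)) = (\<Sum>k<m n. f (path_piece F X (k + 2) \<omega>))"
      proof -
        have "(\<Sum>j = 2..Suc i. g j) = (\<Sum>k<i. g (k + 2))" for i and g :: "nat \<Rightarrow> real"
          by (induction i) simp_all
        then show ?thesis .
      qed
      also have "\<dots> = S (m n)" unfolding S_def piece ..
      finally have "f (traj X n \<omega>) = f (path_piece F X 1 \<omega>) + S (m n) + f (path_rest F X n \<omega>)"
        using 1(3)[rule_format, of n] elim by (simp add: \<kappa>_def)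
      then show ?case by (simp add: add_divide_distrib)
    qed
    moreover have lim: "(\<lambda>n. f (path_piece F X 1 \<omega>) / real n + S (m n) / real n + f (path_rest F X n \<omega>) / real n)
        \<longlonglongrightarrow> 0 + c / \<mu> + 0"
      by (intro tendsto_add lim_const_over_n main rest)
    ultimately show ?case using Lim_transform_eventually[OF lim] by simp
  qed
  moreover have "0 < c / \<mu>" if "\<forall>\<pi>\<in>paths F \<alpha>. 0 < f \<pi>" using cpos[OF that] \<mu> by simp
  ultimately show ?thesis by blast
qed

end

theorem theorem2p10:
  fixes F :: "'a free_factors" and \<alpha> :: real
    and M :: "'w measure" and X :: "nat \<Rightarrow> 'w \<Rightarrow> 'a list"
    and f :: "'a list list \<Rightarrow> real" and R R\<^sub>f C :: real
  assumes "free_factors_valid F" and "0 < \<alpha>" "\<alpha> < 1"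
    and "markov_chain M (free_words F) (free_trans F \<alpha>) [] X"
    and "cone_additive F M X f"
    and "conv_radius (\<lambda>n. \<P>(\<omega> in M. X n \<omega> = [])) > 1"
    and "1 < R"
    and "(SUP k\<in>{1..}. \<integral>\<^sup>+ \<omega>. ennreal (R ^ path_length (psi F X k \<omega>)) \<partial>M) < \<infinity>"
    and "0 < C" and "0 < R\<^sub>f" "R\<^sub>f < R"
    and "\<And>\<pi>. \<pi> \<in> paths F \<alpha> \<Longrightarrow> \<bar>f \<pi>\<bar> \<le> C * R\<^sub>f ^ path_length \<pi>"
  shows "\<exists>c::real.
           (AE \<omega> in M. (\<lambda>n. f (traj X n \<omega>) / real n) \<longlonglongrightarrow> c) \<and>
           ((\<forall>\<pi>\<in>paths F \<alpha>. f \<pi> > 0) \<longrightarrow> c > 0)"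
proof -
  interpret transient_chain F \<alpha> M X
    using assms(1-4,6) by unfold_locales
  define B where "B = (SUP k\<in>{1..}. \<integral>\<^sup>+ \<omega>. ennreal (R ^ path_length (psi F X k \<omega>)) \<partial>M)"
  define K where "K = max 1 (enn2real B)"
  have B: "B \<le> ennreal K"
  proof -
    have "B = ennreal (enn2real B)" using assms(8) unfolding B_def[symmetric] by simp
    also have "\<dots> \<le> ennreal K" unfolding K_def by (intro ennreal_leI) simp
    finally show ?thesis .
  qed
  (* a base above R_f that also exceeds 1 and stays below R *)
  define r0 where "r0 = max R\<^sub>f ((1 + R) / 2)"
  have r0: "1 < r0" "r0 < R" "R\<^sub>f \<le> r0" using assms(7,11) by (auto simp: r0_def less_max_iff_disj)
  interpret cone_additive_walk F \<alpha> M X R K f C r0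
  proof
    fix k :: nat assume k: "2 \<le> k"
    have "(\<integral>\<^sup>+ \<omega>. ennreal (R ^ path_length (cone_path (seg (\<lambda>i. X i \<omega>) 0 k))) \<partial>M)
        = (\<integral>\<^sup>+ \<omega>. ennreal (R ^ path_length (psi F X k \<omega>)) \<partial>M)"
    proof (rule nn_integral_cong_AE)
      show "AE \<omega> in M. ennreal (R ^ path_length (cone_path (seg (\<lambda>i. X i \<omega>) 0 k)))
          = ennreal (R ^ path_length (psi F X k \<omega>))"
        using AE_transient_walk
      proof eventually_elim
        case (elim \<omega>)
        interpret transient_walk F \<alpha> X \<omega> by fact
        show ?case by (simp add: psi_eq[OF k])
      qed
    qed
    also have "\<dots> \<le> B" unfolding B_def using k by (intro SUP_upper) auto
    also note B
    finally show "(\<integral>\<^sup>+ \<omega>. ennreal (R ^ path_length (cone_path (seg (\<lambda>i. X i \<omega>) 0 k))) \<partial>M) \<le> ennreal K" .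
  next
    fix \<pi> assume p: "\<pi> \<in> paths F \<alpha>"
    have "R\<^sub>f ^ path_length \<pi> \<le> r0 ^ path_length \<pi>" using assms(10) r0 by (intro power_mono) auto
    then have "C * R\<^sub>f ^ path_length \<pi> \<le> C * r0 ^ path_length \<pi>" using assms(9) by simp
    then show "\<bar>f \<pi>\<bar> \<le> C * r0 ^ path_length \<pi>" using assms(12)[OF p] by linarith
  qed (use assms(5,7,9) r0 in \<open>auto simp: K_def\<close>)
  show ?thesis by (rule rate_of_escape)
qed

end
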